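(* Let $X$ be a real Banach space. Then the circle group $\mathbb{T}=\{z\in\mathbb{C} : |z|=1\}$ is displayable on $X$ if and only if $X$ admits a complex structure and $\dim X>2$.
   Context: $\mathbb{T}$ carries its usual topology. A real Banach space $X$ admits a complex structure if there exists a bounded linear operator $J$ on $X$ with $J^2=-\mathrm{Id}$. For a Banach space $X$ with norm $|\!|\!|\cdot|\!|\!|$, $\mathrm{Isom}(X,|\!|\!|\cdot|\!|\!|)$ is the group of surjective linear isometries, equipped with the strong operator topology (pointwise convergence on $X$), and $GL(X)$ is the group of linear automorphisms (bounded with bounded inverse), also with the strong operator topology. A display of a topological group $G$ on $X$ is a group homomorphism $\rho\colon G\to GL(X)$ which is a topological isomorphism onto its image $\rho(G)$ (with the strong operator topology) and such that $\rho(G)=\mathrm{Isom}(X,|\!|\!|\cdot|\!|\!|)$ for some equivalent norm $|\!|\!|\cdot|\!|\!|$ on $X$. $G$ is displayable on $X$ if there exists a display of $G$ on $X$. *)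

theory Defs
  imports "HOL-Analysis.Analysis" "HOL-Algebra.Group"
begin

text \<open>A topological group is a pair of an algebraic group and a topology on its carrier.
  No separation axiom is imposed.\<close>

definition topological_group :: "('g, 'm) monoid_scheme \<Rightarrow> 'g topology \<Rightarrow> bool" where
  "topological_group G \<T> \<longleftrightarrow>
     group G \<and> topspace \<T> = carrier G \<and>
     continuous_map (prod_topology \<T> \<T>) \<T> (\<lambda>(x, y). x \<otimes>\<^bsub>G\<^esub> y) \<and>
     continuous_map \<T> \<T> (\<lambda>x. inv\<^bsub>G\<^esub> x)"

definition circle_group :: "complex monoid" where
  "circle_group = \<lparr>carrier = {z. cmod z = 1}, monoid.mult = (*), one = 1\<rparr>"

definition circle_topology :: "complex topology" where
  "circle_topology = subtopology euclidean {z. cmod z = 1}"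

definition GL :: "('a::real_normed_vector \<Rightarrow>\<^sub>L 'a) monoid" where
  "GL = \<lparr>carrier = {T. \<exists>S. S o\<^sub>L T = id_blinfun \<and> T o\<^sub>L S = id_blinfun},
         monoid.mult = (o\<^sub>L), one = id_blinfun\<rparr>"

definition GL_topology :: "('a::real_normed_vector \<Rightarrow>\<^sub>L 'a) topology" where
  "GL_topology = subtopology strong_operator_topology (carrier GL)"

definition equivalent_norm :: "('a::real_normed_vector \<Rightarrow> real) \<Rightarrow> bool" where
  "equivalent_norm N \<longleftrightarrow>
     (\<forall>x. 0 \<le> N x) \<and> (\<forall>x. N x = 0 \<longleftrightarrow> x = 0) \<and>
     (\<forall>a x. N (a *\<^sub>R x) = \<bar>a\<bar> * N x) \<and> (\<forall>x y. N (x + y) \<le> N x + N y) \<and>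
     (\<exists>c>0. \<exists>C>0. \<forall>x. c * norm x \<le> N x \<and> N x \<le> C * norm x)"

text \<open>For an equivalent norm \<open>N\<close>, every linear \<open>N\<close>-isometry is bounded for the original norm,
  so nothing is lost by ranging over bounded operators only.\<close>

definition Isom :: "('a::real_normed_vector \<Rightarrow> real) \<Rightarrow> ('a \<Rightarrow>\<^sub>L 'a) set" where
  "Isom N = {T. surj (blinfun_apply T) \<and> (\<forall>x. N (blinfun_apply T x) = N x)}"

definition display ::
  "('g, 'm) monoid_scheme \<Rightarrow> 'g topology \<Rightarrow> ('g \<Rightarrow> 'a::real_normed_vector \<Rightarrow>\<^sub>L 'a) \<Rightarrow> bool" where
  "display G \<T> \<rho> \<longleftrightarrow>
     topological_group G \<T> \<and> \<rho> \<in> hom G GL \<and> embedding_map \<T> GL_topology \<rho> \<and>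
     (\<exists>N. equivalent_norm N \<and> \<rho> ` carrier G = Isom N)"

definition displayable ::
  "('g, 'm) monoid_scheme \<Rightarrow> 'g topology \<Rightarrow> 'a::real_normed_vector itself \<Rightarrow> bool" where
  "displayable G \<T> (X :: 'a itself) \<longleftrightarrow> (\<exists>\<rho> :: 'g \<Rightarrow> 'a \<Rightarrow>\<^sub>L 'a. display G \<T> \<rho>)"

definition admits_complex_structure :: "'a::real_normed_vector itself \<Rightarrow> bool" where
  "admits_complex_structure (X :: 'a itself) \<longleftrightarrow> (\<exists>J :: 'a \<Rightarrow>\<^sub>L 'a. J o\<^sub>L J = - id_blinfun)"

text \<open>The library constant \<^const>\<open>dim\<close> has no infinite value (it is \<open>0\<close> without a finite basis),
  hence the case distinction.\<close>

definition space_dim :: "'a::real_vector itself \<Rightarrow> enat" where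
  "space_dim (X :: 'a itself) =
     (if \<exists>B :: 'a set. finite B \<and> span B = UNIV then enat (dim (UNIV :: 'a set)) else \<infinity>)"

lemma inverse_unit_circle: "cmod x = 1 \<Longrightarrow> inverse x * x = 1"
  by (metis left_inverse norm_zero zero_neq_one)

lemma group_circle: "group circle_group"
proof (rule groupI)
  fix x assume "x \<in> carrier circle_group"
  then show "\<exists>y\<in>carrier circle_group. y \<otimes>\<^bsub>circle_group\<^esub> x = \<one>\<^bsub>circle_group\<^esub>"
    by (intro bexI[of _ "inverse x"]) (auto simp: circle_group_def norm_inverse inverse_unit_circle)
qed (auto simp: circle_group_def norm_mult)

lemma inv_circle: "x \<in> carrier circle_group \<Longrightarrow> inv\<^bsub>circle_group\<^esub> x = inverse x"
  by (rule group.inv_equality[OF group_circle]) (auto simp: circle_group_def norm_inverse inverse_unit_circle)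

lemma topological_group_circle: "topological_group circle_group circle_topology"
proof -
  have "prod_topology circle_topology circle_topology
      = subtopology euclidean ({z. cmod z = 1} \<times> {z. cmod z = 1})"
    by (simp add: circle_topology_def subtopology_Times euclidean_product_topology)
  then have m: "continuous_map (prod_topology circle_topology circle_topology) circle_topology
      (\<lambda>(x, y). x \<otimes>\<^bsub>circle_group\<^esub> y)"
    by (auto simp: circle_topology_def circle_group_def continuous_map_in_subtopology norm_mult
        case_prod_unfold intro!: continuous_intros)
  have "continuous_map circle_topology circle_topology inverse"
    by (auto simp: circle_topology_def continuous_map_in_subtopology norm_inverse
        intro!: continuous_intros)
  then have "continuous_map circle_topology circle_topology (\<lambda>x. inv\<^bsub>circle_group\<^esub> x)"
    by (rule continuous_map_eq) (subst inv_circle, auto simp: circle_topology_def circle_group_def)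
  moreover have "topspace circle_topology = carrier circle_group"
    by (simp add: circle_topology_def circle_group_def)
  ultimately show ?thesis
    using m group_circle by (simp add: topological_group_def)
qed

lemma blinfun_compose_assoc: "(R o\<^sub>L S) o\<^sub>L T = R o\<^sub>L (S o\<^sub>L T)"
  by (rule blinfun_eqI) simp

lemma blinfun_compose_id [simp]: "id_blinfun o\<^sub>L T = T" "T o\<^sub>L id_blinfun = T"
  by (rule blinfun_eqI, simp)+

lemma group_GL: "group (GL :: ('a::real_normed_vector \<Rightarrow>\<^sub>L 'a) monoid)"
proof (rule groupI)
  fix S T :: "'a \<Rightarrow>\<^sub>L 'a"
  assume "S \<in> carrier GL" "T \<in> carrier GL"
  then obtain S' T' where "S' o\<^sub>L S = id_blinfun" "S o\<^sub>L S' = id_blinfun"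
    "T' o\<^sub>L T = id_blinfun" "T o\<^sub>L T' = id_blinfun"
    by (auto simp: GL_def)
  then have "(T' o\<^sub>L S') o\<^sub>L (S o\<^sub>L T) = id_blinfun" "(S o\<^sub>L T) o\<^sub>L (T' o\<^sub>L S') = id_blinfun"
    by (metis blinfun_compose_assoc blinfun_compose_id(1))+
  then show "S \<otimes>\<^bsub>GL\<^esub> T \<in> carrier GL"
    by (auto simp: GL_def)
qed (auto simp: GL_def blinfun_compose_assoc)

end

theory Submission
  imports Defs "HOL-Algebra.Free_Abelian_Groups"
begin

text \<open>
  Sufficiency. The norm is \<open>N = max B (sup \<bar>\<phi>\<bar>)\<close>, where \<open>\<phi>\<close> runs through a bounded family \<open>F\<close> of
  complex-linear functionals and \<open>B\<close> is a small multiple of an equivalent norm that is strictly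
  convex in two complex directions; this is where complex dimension at least two enters. Every member
  of \<open>F\<close> has a point at which it beats \<open>B\<close> and all other members by a uniform amount, and this forces
  a real-linear isometry of \<open>N\<close> to permute the moduli of the members of \<open>F\<close>. The family consists of
  the coordinate functionals \<open>f s\<close> of a bounded biorthogonal system indexed by a well-ordered set and
  of combinations of \<open>f s\<close> and \<open>f t\<close> for \<open>s < t\<close>. The combinations encode the well-order, which has no
  nontrivial automorphism, so an isometry fixes each \<open>f s\<close> up to a phase or a conjugation; their
  coefficients exclude the conjugation and make the phases equal. Some combinations are
  slightly perturbed by functionals which together with the \<open>f s\<close> separate points, so the isometry is
  a scalar. There are enough indices for these perturbations: if a bounded biorthogonal system is
  maximal and infinite, then the functionals needed to separate the remaining points are at most as many
  as its members.

  Necessity. Injectivity gives \<open>\<rho> (- 1) = - Id\<close>, so \<open>J = \<rho> \<i>\<close> is a complex structure. In real dimension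
  two every \<open>\<rho> z\<close> is a complex multiplication, so the image contains all roots of unity and \<open>N\<close> is
  invariant under rotations. Then the complex conjugation is an isometry which does not commute with \<open>J\<close>.
\<close>

section \<open>The Hahn-Banach theorem\<close>

definition sublinear :: "('a::real_vector \<Rightarrow> real) \<Rightarrow> bool" where
  "sublinear q \<longleftrightarrow> (\<forall>x y. q (x + y) \<le> q x + q y) \<and> (\<forall>a\<ge>0. \<forall>x. q (a *\<^sub>R x) = a * q x)"

lemma sublinear_add: "sublinear q \<Longrightarrow> q (x + y) \<le> q x + q y"
  and sublinear_scaleR: "sublinear q \<Longrightarrow> 0 \<le> a \<Longrightarrow> q (a *\<^sub>R x) = a * q x"
  by (auto simp: sublinear_def)

text \<open>The inequalities for \<open>c\<close> and \<open>1/c\<close> together give equality, so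
  only one direction of homogeneity has to be checked later.\<close>

lemma sublinearI:
  assumes "\<And>x y. q (x + y) \<le> q x + q y" "\<And>c x. 0 < c \<Longrightarrow> q (c *\<^sub>R x) \<le> c * q x" "q 0 = 0"
  shows "sublinear q"
proof -
  have "q (c *\<^sub>R x) = c * q x" if "0 < c" for c x
    using assms(2)[OF that, of x] assms(2)[of "1/c" "c *\<^sub>R x"] that by (simp add: field_simps)
  then show ?thesis
    using assms(1,3) by (auto simp: sublinear_def order_le_less)
qed

lemma sublinear_0: "sublinear q \<Longrightarrow> q 0 = 0"
  using sublinear_scaleR[of q 0 0] by simp

lemma sublinear_minus: "sublinear q \<Longrightarrow> - q (- x) \<le> q x"
  using sublinear_add[of q x "- x"] sublinear_0[of q] by simp

text \<open>One step towards making \<open>q\<close> odd in the direction \<open>a\<close>. The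
  infimum is finite because \<open>t * q a\<close> is at most
  \<open>q (x + t *\<^sub>R a) + q (- x)\<close>; the choice \<open>t = 0\<close> compares it with
  \<open>q\<close>, and \<open>t = 1\<close> gives the value at \<open>- a\<close>.\<close>

lemma sublinear_shift:
  assumes q: "sublinear q"
  defines "r \<equiv> \<lambda>a x. INF t\<in>{0..}. q (x + t *\<^sub>R a) - t * q a"
  shows "sublinear (r a)" "r a x \<le> q x" "r a (- a) \<le> - q a"
proof -
  have bd: "bdd_below ((\<lambda>t. q (x + t *\<^sub>R a) - t * q a) ` {0..})" for x
  proof (rule bdd_belowI2[where m="- q (- x)"])
    fix t :: real assume "t \<in> {0..}"
    then have "t * q a \<le> q (x + t *\<^sub>R a) + q (- x)"
      using sublinear_add[OF q, of "x + t *\<^sub>R a" "- x"] sublinear_scaleR[OF q, of t a] by simp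
    then show "- q (- x) \<le> q (x + t *\<^sub>R a) - t * q a" by simp
  qed
  have le: "r a x \<le> q (x + t *\<^sub>R a) - t * q a" if "0 \<le> t" for x t
    unfolding r_def using that by (intro cINF_lower2[OF bd]) auto
  show "r a x \<le> q x" using le[of 0 x] by simp
  show "r a (- a) \<le> - q a" using le[of 1 "- a"] sublinear_0[OF q] by simp
  have add: "r a (x + y) \<le> r a x + r a y" for x y
  proof -
    have *: "r a (x + y) \<le> (q (x + s *\<^sub>R a) - s * q a) + (q (y + t *\<^sub>R a) - t * q a)"
      if "0 \<le> s" "0 \<le> t" for s t
      using le[of "s + t" "x + y"] that sublinear_add[OF q, of "x + s *\<^sub>R a" "y + t *\<^sub>R a"]
      by (simp add: algebra_simps)
    have "r a (x + y) - (q (y + t *\<^sub>R a) - t * q a) \<le> (INF s\<in>{0..}. q (x + s *\<^sub>R a) - s * q a)"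
      if "0 \<le> t" for t
      by (rule cINF_greatest) (use *[of _ t] that in \<open>auto simp: algebra_simps\<close>)
    then have **: "r a (x + y) - r a x \<le> q (y + t *\<^sub>R a) - t * q a" if "0 \<le> t" for t
      using that unfolding r_def by (simp add: algebra_simps)
    have "r a (x + y) - r a x \<le> (INF t\<in>{0..}. q (y + t *\<^sub>R a) - t * q a)"
      by (rule cINF_greatest) (use ** in auto)
    then have "r a (x + y) - r a x \<le> r a y"
      unfolding r_def .
    then show ?thesis by simp
  qed
  have sc: "r a (c *\<^sub>R x) \<le> c * r a x" if c: "0 < c" for c x
  proof -
    have "r a (c *\<^sub>R x) / c \<le> r a x"
      unfolding r_def
    proof (rule cINF_greatest)
      fix t :: real assume t: "t \<in> {0..}"
      have "r a (c *\<^sub>R x) \<le> q (c *\<^sub>R x + (c * t) *\<^sub>R a) - c * t * q a"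
        using le[of "c * t" "c *\<^sub>R x"] t c by simp
      also have "\<dots> = c * (q (x + t *\<^sub>R a) - t * q a)"
        using sublinear_scaleR[OF q, of c "x + t *\<^sub>R a"] c by (simp add: algebra_simps)
      finally show "(INF t\<in>{0..}. q (c *\<^sub>R x + t *\<^sub>R a) - t * q a) / c \<le> q (x + t *\<^sub>R a) - t * q a"
        using c by (simp add: r_def field_simps)
    qed simp
    then show ?thesis using c by (simp add: field_simps)
  qed
  have "r a 0 = 0"
  proof (rule antisym)
    show "r a 0 \<le> 0" using le[of 0 0] sublinear_0[OF q] by simp
    show "0 \<le> r a 0" unfolding r_def
      by (rule cINF_greatest) (auto simp: sublinear_scaleR[OF q])
  qed
  then show "sublinear (r a)" using add sc by (rule sublinearI[rotated 2])
qed

text \<open>A pointwise minimal sublinear functional \<open>m\<close> coincides with its shifts, so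
  \<open>m x = - m (- x)\<close>.\<close>

lemma hahn_banach_sublinear:
  fixes p :: "'a::real_vector \<Rightarrow> real"
  assumes p: "sublinear p"
  obtains f where "linear f" "\<And>x. f x \<le> p x" "f x0 = p x0"
proof -
  \<comment> \<open>Shifting along \<open>x0\<close> first secures the value at \<open>x0\<close>: a
    linear functional below \<open>p0\<close> is at most \<open>- p x0\<close> at
    \<open>- x0\<close>, hence at least \<open>p x0\<close> at \<open>x0\<close>.\<close>
  obtain p0 where p0: "sublinear p0" "\<And>x. p0 x \<le> p x" "p0 (- x0) \<le> - p x0"
    using sublinear_shift[OF p] by blast
  define A where "A = {q. sublinear q \<and> (\<forall>x. q x \<le> p0 x)}"
  \<comment> \<open>The order is reversed, so a maximal element is a pointwise minimal functional,
    and a chain is bounded by its pointwise infimum.\<close>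
  have "\<exists>m\<in>A. \<forall>a\<in>A. (\<forall>x. a x \<le> m x) \<longrightarrow> a = m"
  proof (rule predicate_Zorn)
    show "partial_order_on A (relation_of (\<lambda>m a. \<forall>x. a x \<le> m x) A)"
      by (rule partial_order_on_relation_ofI) (auto simp: fun_eq_iff intro: order_trans antisym)
  next
    fix C assume C: "C \<in> Chains (relation_of (\<lambda>m a. \<forall>x. a x \<le> m x) A)"
    then have CA: "C \<subseteq> A" by (auto simp: Chains_def relation_of_def)
    have tot: "(\<forall>x. b x \<le> a x) \<or> (\<forall>x. a x \<le> b x)" if "a \<in> C" "b \<in> C" for a b
      using C that by (auto simp: Chains_def relation_of_def)
    show "\<exists>u\<in>A. \<forall>a\<in>C. \<forall>x. u x \<le> a x"
    proof (cases "C = {}")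
      case True
      then show ?thesis using p0 by (auto simp: A_def)
    next
      case False
      define u where "u = (\<lambda>x. INF q\<in>C. q x)"
      have bd: "bdd_below ((\<lambda>q. q x) ` C)" for x
      proof (rule bdd_belowI2[where m="- p0 (- x)"])
        fix q assume "q \<in> C"
        then have "sublinear q" "q (- x) \<le> p0 (- x)" using CA by (auto simp: A_def)
        then show "- p0 (- x) \<le> q x" using sublinear_minus[of q x] by simp
      qed
      have le: "u x \<le> q x" if "q \<in> C" for q x
        unfolding u_def by (rule cINF_lower[OF bd that])
      have u_add: "u (x + y) \<le> u x + u y" for x y
      proof -
        \<comment> \<open>The smaller of two members of the chain bounds both terms at once, so
          subadditivity passes to the infimum.\<close>
        have *: "u (x + y) \<le> q x + q' y" if qq: "q \<in> C" "q' \<in> C" for q q'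
        proof -
          obtain q'' where "q'' \<in> C" "q'' x \<le> q x" "q'' y \<le> q' y"
            using tot[OF qq] qq by auto
          moreover from this have "sublinear q''" using CA by (auto simp: A_def)
          ultimately show ?thesis using le[of q'' "x + y"] sublinear_add[of q'' x y] by linarith
        qed
        have "u (x + y) - q' y \<le> (INF q\<in>C. q x)" if "q' \<in> C" for q'
          by (rule cINF_greatest[OF False]) (use *[of _ q'] that in \<open>auto simp: algebra_simps\<close>)
        then have **: "u (x + y) - u x \<le> q' y" if "q' \<in> C" for q'
          using that unfolding u_def by (simp add: algebra_simps)
        have "u (x + y) - u x \<le> (INF q\<in>C. q y)"
          by (rule cINF_greatest[OF False]) (use ** in auto)
        then have "u (x + y) - u x \<le> u y"
          unfolding u_def .
        then show ?thesis by simp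
      qed
      have u_sc: "u (c *\<^sub>R x) \<le> c * u x" if c: "0 < c" for c x
      proof -
        have "u (c *\<^sub>R x) / c \<le> (INF q\<in>C. q x)"
        proof (rule cINF_greatest[OF False])
          fix q assume "q \<in> C"
          then have "q (c *\<^sub>R x) = c * q x" using CA c by (auto simp: A_def sublinear_scaleR)
          then show "u (c *\<^sub>R x) / c \<le> q x" using le[OF \<open>q \<in> C\<close>, of "c *\<^sub>R x"] c by (simp add: field_simps)
        qed
        then have "u (c *\<^sub>R x) / c \<le> u x" unfolding u_def .
        then show ?thesis using c by (simp add: field_simps)
      qed
      have u_0: "u 0 = 0"
      proof -
        have "(\<lambda>q. q 0) ` C = (\<lambda>q. 0) ` C"
        proof (rule image_cong)
          fix q assume "q \<in> C"
          then have "sublinear q" using CA by (auto simp: A_def)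
          then show "q 0 = 0" by (rule sublinear_0)
        qed simp
        then show ?thesis using False by (simp add: u_def)
      qed
      have u_le: "u x \<le> p0 x" for x
      proof -
        obtain q where "q \<in> C" using False by blast
        moreover from this have "q x \<le> p0 x" using CA by (auto simp: A_def)
        ultimately show ?thesis using le[of q x] by simp
      qed
      have "u \<in> A"
        unfolding A_def using sublinearI[OF u_add u_sc u_0] u_le by simp
      then show ?thesis using le by blast
    qed
  qed
  then obtain m where m: "m \<in> A" and min: "\<And>a. a \<in> A \<Longrightarrow> (\<And>x. a x \<le> m x) \<Longrightarrow> a = m" by blast
  have sm: "sublinear m" and mp0: "\<And>x. m x \<le> p0 x" using m by (auto simp: A_def)
  have odd: "m (- a) = - m a" for a
  proof -
    let ?r = "\<lambda>x. INF t\<in>{0..}. m (x + t *\<^sub>R a) - t * m a"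
    have "?r = m"
      using sublinear_shift(1,2)[OF sm, where a=a] mp0
      by (intro min) (auto simp: A_def intro: order_trans)
    from fun_cong[OF this, of "- a"] have "m (- a) \<le> - m a"
      using sublinear_shift(3)[OF sm, of a] by simp
    then show ?thesis using sublinear_minus[OF sm, of "- a"] by simp
  qed
  have "m (x + y) = m x + m y" for x y
    using sublinear_add[OF sm, of x y] sublinear_add[OF sm, of "- x" "- y"] odd[of "x + y"] odd[of x] odd[of y]
    by simp
  moreover have "m (c *\<^sub>R x) = c * m x" for c x
    using sublinear_scaleR[OF sm, of c x] sublinear_scaleR[OF sm, of "- c" x] odd[of "c *\<^sub>R x"]
    by (cases "c \<ge> 0") auto
  ultimately have "linear m" by (auto intro!: linearI)
  moreover have "m x \<le> p x" for x using mp0 p0(2) order_trans by blast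
  moreover have "m x0 = p x0"
    using mp0[of "- x0"] p0(3) odd[of x0] calculation(2)[of x0] by simp
  ultimately show ?thesis using that by blast
qed

section \<open>Complex structures\<close>

locale complex_norm =
  fixes J :: "'a::real_normed_vector \<Rightarrow> 'a" and p :: "'a \<Rightarrow> real" and K :: real
  assumes linear_J: "linear J" and JJ: "J (J x) = - x"
    and p_add: "p (x + y) \<le> p x + p y"
    and p_rot: "p (Re z *\<^sub>R x + Im z *\<^sub>R J x) = cmod z * p x"
    and norm_le_p: "norm x \<le> p x" and p_le: "p x \<le> K * norm x"
begin

definition cscale :: "complex \<Rightarrow> 'a \<Rightarrow> 'a" where
  "cscale z x = Re z *\<^sub>R x + Im z *\<^sub>R J x"

definition clin :: "('a \<Rightarrow> complex) \<Rightarrow> bool" where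
  "clin f \<longleftrightarrow> linear f \<and> (\<forall>x. f (J x) = \<i> * f x)"

lemmas J_simps = linear_add[OF linear_J] linear_diff[OF linear_J] linear_scale[OF linear_J]
  linear_neg[OF linear_J] linear_0[OF linear_J]

lemma p_cscale [simp]: "p (cscale z x) = cmod z * p x"
  by (simp add: cscale_def p_rot)

lemma cscale_add_right: "cscale z (x + y) = cscale z x + cscale z y"
  by (simp add: cscale_def J_simps algebra_simps)

lemma cscale_diff_right: "cscale z (x - y) = cscale z x - cscale z y"
  by (simp add: cscale_def J_simps algebra_simps)

lemma cscale_add_left: "cscale (z + w) x = cscale z x + cscale w x"
  by (simp add: cscale_def algebra_simps)

lemma cscale_scaleR: "cscale z (r *\<^sub>R x) = r *\<^sub>R cscale z x"
  by (simp add: cscale_def J_simps algebra_simps)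

lemma cscale_cscale: "cscale z (cscale w x) = cscale (z * w) x"
  by (simp add: cscale_def J_simps JJ algebra_simps)

lemma cscale_simps [simp]: "cscale 1 x = x" "cscale 0 x = 0" "cscale z 0 = 0" "cscale \<i> x = J x"
  "cscale (of_real r) x = r *\<^sub>R x"
  by (simp_all add: cscale_def J_simps)

lemma J_cscale: "J (cscale z x) = cscale (\<i> * z) x"
  by (metis cscale_cscale cscale_simps(4))

lemma p_scaleR [simp]: "p (r *\<^sub>R x) = \<bar>r\<bar> * p x"
  using p_cscale[of "of_real r" x] by simp

lemma p_minus [simp]: "p (- x) = p x"
  using p_scaleR[of "- 1" x] by simp

lemma p_0 [simp]: "p 0 = 0"
  using p_scaleR[of 0 0] by simp

lemma p_nonneg [simp]: "0 \<le> p x"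
  using norm_le_p[of x] norm_ge_zero[of x] by linarith

lemma p_eq_0 [simp]: "p x = 0 \<longleftrightarrow> x = 0"
  using norm_le_p[of x] by auto

lemma p_diff: "p (x - y) \<le> p x + p y"
  using p_add[of x "- y"] by simp

lemma p_triangle: "p x \<le> p (x - y) + p y"
  using p_add[of "x - y" y] by simp

lemma p_swap: "p (x - y) = p (y - x)"
  using p_minus[of "x - y"] by simp

lemma clin_simps:
  assumes "clin f"
  shows "f (x + y) = f x + f y" "f (x - y) = f x - f y" "f (r *\<^sub>R x) = of_real r * f x" "f 0 = 0"
    "f (- x) = - f x" "f (J x) = \<i> * f x" "f (cscale z x) = z * f x"
proof -
  have l: "linear f" and i: "\<And>x. f (J x) = \<i> * f x" using assms by (auto simp: clin_def)
  show "f (x + y) = f x + f y" "f (x - y) = f x - f y" "f (r *\<^sub>R x) = of_real r * f x" "f 0 = 0"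
    "f (- x) = - f x" "f (J x) = \<i> * f x"
    using l by (simp_all add: linear_add linear_diff linear_scale linear_0 linear_neg i scaleR_conv_of_real)
  have "f (cscale z x) = (of_real (Re z) + of_real (Im z) * \<i>) * f x"
    using l by (simp add: cscale_def linear_add linear_scale i scaleR_conv_of_real algebra_simps)
  moreover have "of_real (Re z) + of_real (Im z) * \<i> = z" by (simp add: complex_eq_iff)
  ultimately show "f (cscale z x) = z * f x" by simp
qed

lemma clin_comb: "clin f \<Longrightarrow> clin g \<Longrightarrow> clin (\<lambda>x. a * f x + b * g x)"
  unfolding clin_def[of "\<lambda>x. a * f x + b * g x"]
  by (auto intro!: linearI simp: clin_simps scaleR_conv_of_real algebra_simps)

lemma clin_mult: "clin f \<Longrightarrow> clin (\<lambda>x. a * f x)"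
  using clin_comb[of f f a 0] by simp

lemma clin_zero: "clin (\<lambda>x. 0)"
  by (auto simp: clin_def intro: linearI)

text \<open>The real functional \<open>f\<close> is the real part of \<open>F\<close>. Rotating the
  argument until \<open>F\<close> is nonnegative turns the bound on \<open>f\<close> into one on the
  modulus; at \<open>x0\<close> the real part already exhausts this bound, so the imaginary part
  vanishes.\<close>

lemma complex_hahn_banach:
  assumes add: "\<And>x y. q (x + y) \<le> q x + q y" and sc: "\<And>z x. q (cscale z x) = cmod z * q x"
  obtains F where "clin F" "\<And>x. cmod (F x) \<le> q x" "F x0 = of_real (q x0)"
proof -
  have "sublinear q"
    using add sc[of "of_real r" for r] by (auto simp: sublinear_def)
  then obtain f where f: "linear f" "\<And>x. f x \<le> q x" "f x0 = q x0"
    using hahn_banach_sublinear by blast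
  define F where "F x = Complex (f x) (- f (J x))" for x
  have "linear F"
    using f(1) by (auto intro!: linearI simp: F_def J_simps linear_add linear_scale complex_eq_iff)
  then have F: "clin F"
    using f(1) by (auto simp: clin_def F_def JJ linear_neg complex_eq_iff)
  have le: "cmod (F x) \<le> q x" for x
  proof (cases "F x = 0")
    case True
    have "0 \<le> q x" using sc[of 0 x] add[of x "cscale (-1) x"] sc[of "-1" x]
      by (simp add: cscale_def)
    then show ?thesis using True by simp
  next
    case False
    define z where "z = cnj (F x) / cmod (F x)"
    have z: "cmod z = 1" using False by (simp add: z_def norm_divide)
    have "z * F x = cmod (F x)"
      using False by (simp add: z_def complex_norm_square[symmetric] power2_eq_square mult.commute)
    then have "F (cscale z x) = cmod (F x)" using F by (simp add: clin_simps)
    then have "cmod (F x) = f (cscale z x)" by (auto simp: F_def complex_eq_iff)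
    also have "\<dots> \<le> q x" using f(2)[of "cscale z x"] sc z by simp
    finally show ?thesis .
  qed
  have "F x0 = of_real (q x0)"
  proof -
    have "Re (F x0) = q x0" by (simp add: F_def f)
    moreover have "Im (F x0) = 0"
    proof (rule ccontr)
      assume "Im (F x0) \<noteq> 0"
      then have "\<bar>Re (F x0)\<bar> < cmod (F x0)"
        by (simp add: cmod_def real_less_rsqrt)
      then show False using le[of x0] \<open>Re (F x0) = q x0\<close> by simp
    qed
    ultimately show ?thesis by (simp add: complex_eq_iff)
  qed
  then show thesis using that F le by blast
qed

lemma norming_functional:
  obtains h where "clin h" "\<And>x. cmod (h x) \<le> p x" "h x0 = of_real (p x0)"
  using complex_hahn_banach[of p x0] p_add by auto

text \<open>\<open>d\<close> is the quotient seminorm of \<open>p\<close> modulo \<open>V\<close>. A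
  functional dominated by \<open>d\<close> and attaining it at \<open>x0\<close> vanishes on
  \<open>V\<close>; dividing by \<open>d x0\<close>, which is at least \<open>1 / c\<close>,
  normalises it.\<close>

lemma separating_functional:
  assumes V: "subspace V" "\<And>v. v \<in> V \<Longrightarrow> J v \<in> V"
    and c: "0 < c" "\<And>v. v \<in> V \<Longrightarrow> 1 \<le> c * p (x0 - v)"
  obtains F where "clin F" "\<And>x. cmod (F x) \<le> c * p x" "F x0 = 1" "\<And>v. v \<in> V \<Longrightarrow> F v = 0"
proof -
  define d where "d x = (INF v\<in>V. p (x - v))" for x
  have V0: "0 \<in> V" using V(1) by (rule subspace_0)
  have csV: "cscale z v \<in> V" if "v \<in> V" for z v
    using V that by (simp add: cscale_def subspace_add subspace_scale)
  have bd: "bdd_below ((\<lambda>v. p (x - v)) ` V)" for x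
    by (rule bdd_belowI2[where m=0]) simp
  have le: "d x \<le> p (x - v)" if "v \<in> V" for x v
    unfolding d_def by (rule cINF_lower[OF bd that])
  have ge: "b \<le> d x" if "\<And>v. v \<in> V \<Longrightarrow> b \<le> p (x - v)" for b x
    unfolding d_def by (rule cINF_greatest) (use that V0 in auto)
  have "d (x + y) \<le> d x + d y" for x y
  proof -
    have *: "d (x + y) \<le> p (x - v) + p (y - w)" if "v \<in> V" "w \<in> V" for v w
      using le[of "v + w" "x + y"] that V(1) p_add[of "x - v" "y - w"]
      by (simp add: subspace_add algebra_simps)
    have "d (x + y) - p (y - w) \<le> d x" if "w \<in> V" for w
      by (rule ge) (use *[OF _ that] in \<open>auto simp: algebra_simps\<close>)
    then have "d (x + y) - d x \<le> d y"
      by (intro ge) (auto simp: algebra_simps)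
    then show ?thesis by simp
  qed
  moreover have sc: "d (cscale z x) \<le> cmod z * d x" if "z \<noteq> 0" for z x
  proof -
    have "d (cscale z x) / cmod z \<le> d x"
    proof (rule ge)
      fix v assume "v \<in> V"
      then have "d (cscale z x) \<le> cmod z * p (x - v)"
        using le[OF csV[of v z], of "cscale z x"] by (simp add: cscale_diff_right[symmetric])
      then show "d (cscale z x) / cmod z \<le> p (x - v)" using that by (simp add: field_simps)
    qed
    then show ?thesis using that by (simp add: field_simps)
  qed
  have d0: "d 0 = 0"
    using le[OF V0, of 0] ge[of 0 0] by simp
  have "d (cscale z x) = cmod z * d x" for z x
  proof (cases "z = 0")
    case False
    then show ?thesis
      using sc[of z x] sc[of "1 / z" "cscale z x"]
      by (auto simp: cscale_cscale norm_divide field_simps)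
  qed (simp add: d0)
  ultimately obtain F where F: "clin F" "\<And>x. cmod (F x) \<le> d x" "F x0 = of_real (d x0)"
    using complex_hahn_banach[of d x0] by blast
  have dx0: "1 / c \<le> d x0" using c by (intro ge) (auto simp: field_simps)
  then have pos: "0 < d x0" using c(1) by (meson divide_pos_pos less_le_trans zero_less_one)
  show thesis
  proof
    show "clin (\<lambda>x. (1 / of_real (d x0)) * F x)" by (rule clin_mult[OF F(1)])
    show "cmod (1 / of_real (d x0) * F x) \<le> c * p x" for x
    proof -
      have "cmod (F x) \<le> p x" using F(2)[of x] le[OF V0, of x] by simp
      then have "cmod (F x) \<le> (c * d x0) * p x"
        using dx0 c(1) mult_right_mono[of 1 "c * d x0" "p x"] by (simp add: field_simps)
      then show ?thesis using pos by (simp add: norm_mult norm_divide field_simps)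
    qed
    show "1 / of_real (d x0) * F x0 = 1" using F(3) pos by simp
    show "1 / of_real (d x0) * F v = 0" if "v \<in> V" for v
      using order_trans[OF F(2)[of v] le[OF that, of v]] by simp
  qed
qed

end

section \<open>Total families and biorthogonal systems\<close>

context complex_norm
begin

text \<open>Each new generator adds a continuous image of a disc, and sums of compact sets are
  compact. This supplies the compactness of bounded sets in finite-dimensional complex
  spans.\<close>

lemma compact_combinations:
  assumes "finite A"
  shows "\<exists>C. compact C \<and> (\<forall>c. (\<forall>a\<in>A. cmod (c a) \<le> M) \<longrightarrow> (\<Sum>a\<in>A. cscale (c a) (g a)) \<in> C)"
  using assms
proof induction
  case empty
  show ?case by (intro exI[of _ "{0}"]) auto
next
  case (insert a A)
  then obtain C where C: "compact C"
    "\<And>c. (\<forall>a\<in>A. cmod (c a) \<le> M) \<Longrightarrow> (\<Sum>a\<in>A. cscale (c a) (g a)) \<in> C" by blast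
  let ?D = "(\<lambda>z. cscale z (g a)) ` cball 0 M"
  have "compact ?D"
    by (rule compact_continuous_image) (auto simp: cscale_def intro!: continuous_intros)
  then have "compact {x + y | x y. x \<in> ?D \<and> y \<in> C}" using C(1) by (rule compact_sums)
  moreover have "(\<Sum>a\<in>insert a A. cscale (c a) (g a)) \<in> {x + y | x y. x \<in> ?D \<and> y \<in> C}"
    if "\<forall>b\<in>insert a A. cmod (c b) \<le> M" for c
    using that C(2)[of c] insert(1,2) by force
  ultimately show ?case by blast
qed

section \<open>Complex spans and biorthogonal systems\<close>

definition cspan :: "'a set \<Rightarrow> 'a set" where
  "cspan S = span (S \<union> J ` S)"

lemma subspace_cspan: "subspace (cspan S)"
  by (simp add: cspan_def)

lemma cspan_superset: "x \<in> S \<Longrightarrow> x \<in> cspan S"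
  by (simp add: cspan_def span_base)

lemma J_cspan: "v \<in> cspan S \<Longrightarrow> J v \<in> cspan S"
  unfolding cspan_def
proof (induction rule: span_induct)
  case base
  then show ?case
    by (simp add: subspace_def J_simps span_add span_scale span_zero)
next
  case (step x)
  then consider "x \<in> S" | y where "y \<in> S" "x = J y" by blast
  then show ?case
    by cases (auto simp: JJ intro!: span_base span_neg)
qed

lemma cspan_finite: "v \<in> cspan S \<Longrightarrow> \<exists>S'. finite S' \<and> S' \<subseteq> S \<and> v \<in> cspan S'"
proof -
  assume "v \<in> cspan S"
  then obtain T r where T: "finite T" "T \<subseteq> S \<union> J ` S" "v = (\<Sum>a\<in>T. r a *\<^sub>R a)"
    by (auto simp: cspan_def span_explicit)
  then obtain U where U: "finite U" "U \<subseteq> S" "T \<inter> J ` S = J ` U"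
    using finite_subset_image[of "T \<inter> J ` S" J S] T(1) by auto
  have "T \<subseteq> ((T \<inter> S) \<union> U) \<union> J ` ((T \<inter> S) \<union> U)" using T(2) U(3) by blast
  then have "v \<in> cspan ((T \<inter> S) \<union> U)"
    unfolding cspan_def T(3) by (intro span_sum span_scale span_base) auto
  then show ?thesis using T(1) U by (intro exI[of _ "(T \<inter> S) \<union> U"]) auto
qed

text \<open>Normalised vectors are paired with functionals of one common bound. Keeping the pairs as
  a bare set lets inclusion serve as the order for Zorn's lemma.\<close>

definition biorthogonal :: "real \<Rightarrow> ('a \<times> ('a \<Rightarrow> complex)) set \<Rightarrow> bool" where
  "biorthogonal D A \<longleftrightarrow>
     (\<forall>(x, f)\<in>A. p x = 1 \<and> clin f \<and> (\<forall>y. cmod (f y) \<le> D * p y) \<and> f x = 1) \<and>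
     (\<forall>a\<in>A. \<forall>b\<in>A. a \<noteq> b \<longrightarrow> snd a (fst b) = 0)"

lemma biorthogonal_mono:
  assumes A: "biorthogonal D A" and B: "B \<subseteq> A"
  shows "biorthogonal D B"
  unfolding biorthogonal_def
proof (intro conjI ballI)
  fix a assume "a \<in> B"
  then have "a \<in> A" using B by blast
  then show "case a of (x, f) \<Rightarrow> p x = 1 \<and> clin f \<and> (\<forall>y. cmod (f y) \<le> D * p y) \<and> f x = 1"
    using A by (auto simp: biorthogonal_def)
next
  fix a b assume "a \<in> B" "b \<in> B"
  then have "a \<in> A" "b \<in> A" using B by blast+
  then show "a \<noteq> b \<longrightarrow> snd a (fst b) = 0"
    using A by (simp add: biorthogonal_def)
qed

text \<open>The conditions involve only two members at a time, which is why they pass to the union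
  of a chain.\<close>

lemma biorthogonal_pairI:
  assumes "\<And>a b. a \<in> A \<Longrightarrow> b \<in> A \<Longrightarrow> biorthogonal D {a, b}"
  shows "biorthogonal D A"
  unfolding biorthogonal_def
proof (intro conjI ballI)
  fix a assume "a \<in> A"
  from assms[OF this this] show "case a of (x, f) \<Rightarrow> p x = 1 \<and> clin f \<and> (\<forall>y. cmod (f y) \<le> D * p y) \<and> f x = 1"
    by (simp add: biorthogonal_def)
next
  fix a b assume "a \<in> A" "b \<in> A"
  from assms[OF this] show "a \<noteq> b \<longrightarrow> snd a (fst b) = 0"
    by (simp add: biorthogonal_def)
qed

text \<open>Both sides are real-linear in \<open>v\<close>, so the vectors of the system and their
  images under \<open>J\<close> suffice. Together with the bound on the functionals this confines
  unit vectors of a finite span to a compact set.\<close>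

lemma biorthogonal_expansion:
  assumes A: "biorthogonal D A" "finite A" and v: "v \<in> cspan (fst ` A)"
  shows "v = (\<Sum>a\<in>A. cscale (snd a v) (fst a))"
proof -
  have cl: "clin (snd a)" "snd a (fst a) = 1" if "a \<in> A" for a
    using A(1) that by (auto simp: biorthogonal_def)
  have orth: "snd a (fst b) = (if a = b then 1 else 0)" if "a \<in> A" "b \<in> A" for a b
    using A(1) that cl by (auto simp: biorthogonal_def)
  have base: "y = (\<Sum>a\<in>A. cscale (snd a y) (fst a))" if y: "y \<in> fst ` A" for y
  proof -
    from y obtain b where b: "y = fst b" "b \<in> A" by (rule imageE)
    have "(\<Sum>a\<in>A. cscale (snd a y) (fst a)) = (\<Sum>a\<in>A. if a = b then fst b else 0)"
      using b orth by (intro sum.cong) auto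
    then show ?thesis using b A(2) by simp
  qed
  show ?thesis
    using v unfolding cspan_def
  proof (induction rule: span_induct)
    case base
    have "(\<Sum>a\<in>A. cscale (snd a (x + y)) (fst a))
       = (\<Sum>a\<in>A. cscale (snd a x) (fst a)) + (\<Sum>a\<in>A. cscale (snd a y) (fst a))" for x y
      unfolding sum.distrib[symmetric]
      by (rule sum.cong) (use cl in \<open>auto simp: clin_simps cscale_add_left\<close>)
    moreover have "(\<Sum>a\<in>A. cscale (snd a (c *\<^sub>R x)) (fst a)) = c *\<^sub>R (\<Sum>a\<in>A. cscale (snd a x) (fst a))" for c x
      unfolding scaleR_sum_right
      by (rule sum.cong) (use cl in \<open>auto simp: clin_simps cscale_def algebra_simps\<close>)
    moreover have "0 = (\<Sum>a\<in>A. cscale (snd a 0) (fst a))"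
      by (rule sum.neutral[symmetric]) (use cl in \<open>auto simp: clin_simps\<close>)
    ultimately show ?case
      by (auto simp: subspace_def)
  next
    case (step x)
    show ?case
    proof (cases "x \<in> fst ` A")
      case True
      then show ?thesis by (rule base)
    next
      case False
      then obtain y where y: "y \<in> fst ` A" "x = J y" using step by blast
      have "x = J (\<Sum>a\<in>A. cscale (snd a y) (fst a))" using y base by metis
      also have "\<dots> = (\<Sum>a\<in>A. J (cscale (snd a y) (fst a)))" by (rule linear_sum[OF linear_J])
      also have "\<dots> = (\<Sum>a\<in>A. cscale (snd a x) (fst a))"
        using cl y by (intro sum.cong) (auto simp: J_cscale clin_simps)
      finally show ?thesis .
    qed
  qed
qed

text \<open>The projection of \<open>V + W\<close> onto \<open>V\<close> along the common kernel
  \<open>W\<close> of \<open>H\<close> has \<open>p\<close>-norm at most \<open>2\<close>. This is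
  the angle condition in Mazur's construction of basic sequences.\<close>

definition shields :: "('a \<Rightarrow> complex) set \<Rightarrow> 'a set \<Rightarrow> bool" where
  "shields H V \<longleftrightarrow> (\<forall>h\<in>H. clin h \<and> (\<forall>x. cmod (h x) \<le> p x)) \<and>
     (\<forall>x. (\<forall>h\<in>H. h x = 0) \<longrightarrow> (\<forall>v\<in>V. p v \<le> 2 * p (x - v)))"

text \<open>Mazur's argument: the unit sphere of the span has a finite net, and functionals norming
  the net points keep every unit vector of the span at distance at least \<open>1/2\<close> from
  their common kernel.\<close>

lemma finite_shield:
  assumes A: "biorthogonal D A" "finite A"
  shows "\<exists>H. finite H \<and> shields H (cspan (fst ` A))"
proof -
  let ?V = "cspan (fst ` A)"
  obtain C where C: "compact C"
    "\<And>c. (\<forall>a\<in>A. cmod (c a) \<le> D) \<Longrightarrow> (\<Sum>a\<in>A. cscale (c a) (fst a)) \<in> C"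
    using compact_combinations[OF A(2), of D fst] by blast
  \<comment> \<open>A net of this mesh in the original norm has mesh at most \<open>1/4\<close> for
    \<open>p\<close>.\<close>
  define d where "d = 1 / (4 * (\<bar>K\<bar> + 1))"
  have d: "0 < d" by (simp add: d_def)
  obtain N where N: "finite N" "C \<subseteq> (\<Union>y\<in>N. ball y d)"
    using C(1) d unfolding compact_eq_totally_bounded by blast
  have "\<exists>h. clin h \<and> (\<forall>x. cmod (h x) \<le> p x) \<and> h y = of_real (p y)" for y
    using norming_functional[of y] by metis
  then obtain h where h: "\<And>y. clin (h y)" "\<And>y x. cmod (h y x) \<le> p x" "\<And>y. h y y = of_real (p y)"
    by metis
  have unit: "1 / 2 \<le> p (x - v)" if v: "v \<in> ?V" "p v = 1" and x: "\<And>y. y \<in> N \<Longrightarrow> h y x = 0" for x v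
  proof -
    have "cmod (snd a v) \<le> D * p v" if "a \<in> A" for a
      using A(1) that by (auto simp: biorthogonal_def)
    then have "cmod (snd a v) \<le> D" if "a \<in> A" for a
      using that v(2) by fastforce
    then have "v \<in> C" using C(2)[of "\<lambda>a. snd a v"] biorthogonal_expansion[OF A v(1)] by simp
    then obtain y where y: "y \<in> N" "dist y v < d" using N(2) by auto
    have "p (y - v) \<le> K * norm (y - v)" by (rule p_le)
    also have "\<dots> \<le> (\<bar>K\<bar> + 1) * d"
      using y(2) by (intro mult_mono) (auto simp: dist_norm)
    also have "\<dots> = 1 / 4" unfolding d_def by (simp add: field_simps) 
    finally have yv: "p (y - v) \<le> 1 / 4" .
    \<comment> \<open>The functional of \<open>y\<close> is at least \<open>3/4\<close> at
      \<open>y\<close> and changes by at most \<open>1/4\<close> on the way to \<open>v\<close>,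
      which leaves \<open>1/2\<close>.\<close>
    have "3 / 4 \<le> p y" using p_triangle[of v y] yv v(2) p_swap[of v y] by simp
    moreover have "cmod (h y y) \<le> cmod (h y (y - v)) + cmod (h y v)"
      using norm_triangle_ineq[of "h y (y - v)" "h y v"] by (simp add: clin_simps(2)[OF h(1)])
    moreover have "cmod (h y (y - v)) \<le> 1 / 4" using h(2)[of y "y - v"] yv by linarith
    ultimately have "1 / 2 \<le> cmod (h y v)" using h(3)[of y] by simp
    also have "\<dots> = cmod (h y (x - v))" using x[OF y(1)] by (simp add: clin_simps(2)[OF h(1)])
    also have "\<dots> \<le> p (x - v)" by (rule h(2))
    finally show ?thesis .
  qed
  have "p v \<le> 2 * p (x - v)" if v: "v \<in> ?V" and x: "\<And>y. y \<in> N \<Longrightarrow> h y x = 0" for x v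
  proof (cases "v = 0")
    case False
    then have pos: "0 < p v" using p_nonneg[of v] p_eq_0[of v] by linarith
    let ?r = "1 / p v"
    have "1 / 2 \<le> p (?r *\<^sub>R x - ?r *\<^sub>R v)"
      using x v pos by (intro unit) (auto simp: clin_simps(3)[OF h(1)] subspace_scale subspace_cspan)
    also have "\<dots> = p (x - v) / p v" using pos by (simp add: scaleR_diff_right[symmetric])
    finally show ?thesis using pos by (simp add: field_simps)
  qed simp
  then have "shields (h ` N) ?V" using h by (auto simp: shields_def)
  then show ?thesis using N(1) by blast
qed

text \<open>The normalised vector \<open>u\<close> satisfies
  \<open>p u \<le> p (u - v) + p v \<le> 3 * p (u - v)\<close>, so its distance from the span is at
  least \<open>1/3\<close>. Hence the bound \<open>3\<close> for the new functional.\<close>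

lemma biorthogonal_extend:
  assumes A: "biorthogonal 3 A" and H: "shields H (cspan (fst ` A))"
    and x: "\<And>h. h \<in> H \<Longrightarrow> h x = 0" "\<And>a. a \<in> A \<Longrightarrow> snd a x = 0" "x \<noteq> 0"
  shows "\<exists>b. b \<notin> A \<and> biorthogonal 3 (insert b A)"
proof -
  let ?V = "cspan (fst ` A)"
  have clA: "clin (snd a)" if "a \<in> A" for a using A that by (auto simp: biorthogonal_def)
  have clH: "clin h" if "h \<in> H" for h using H that by (auto simp: shields_def)
  have pos: "0 < p x" using x(3) p_nonneg[of x] p_eq_0[of x] by linarith
  define u where "u = (1 / p x) *\<^sub>R x"
  have pu: "p u = 1" using pos x(3) by (simp add: u_def)
  have uH: "h u = 0" if "h \<in> H" for h using x(1)[OF that] clH[OF that] by (simp add: u_def clin_simps)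
  have uA: "snd a u = 0" if "a \<in> A" for a using x(2)[OF that] clA[OF that] by (simp add: u_def clin_simps)
  have "1 \<le> 3 * p (u - v)" if "v \<in> ?V" for v
    using H uH that p_triangle[of u v] pu by (force simp: shields_def)
  then obtain F where F: "clin F" "\<And>y. cmod (F y) \<le> 3 * p y" "F u = 1" "\<And>v. v \<in> ?V \<Longrightarrow> F v = 0"
    using separating_functional[of ?V 3 u] subspace_cspan J_cspan by (metis zero_less_numeral)
  have "(u, F) \<notin> A" using uA[of "(u, F)"] F(3) by auto
  moreover have "biorthogonal 3 (insert (u, F) A)"
    using A F pu uA cspan_superset[of _ "fst ` A"] by (auto simp: biorthogonal_def)
  ultimately show ?thesis by blast
qed

text \<open>A minimal finite total family of functionals is biorthogonal to suitable vectors.\<close>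

lemma finite_biorthogonal_total:
  assumes H: "finite H" "\<And>h. h \<in> H \<Longrightarrow> clin h \<and> (\<exists>D. \<forall>x. cmod (h x) \<le> D * p x)"
    and tot: "\<And>x. (\<forall>h\<in>H. h x = 0) \<Longrightarrow> x = 0"
  shows "\<exists>D A. finite A \<and> biorthogonal D A \<and> (\<forall>x. (\<forall>a\<in>A. snd a x = 0) \<longrightarrow> x = 0)"
proof -
  obtain G where G: "G \<subseteq> H" "\<And>x. (\<forall>h\<in>G. h x = 0) \<Longrightarrow> x = 0"
    and min: "\<And>G'. G' \<subset> G \<Longrightarrow> \<not> (\<forall>x. (\<forall>h\<in>G'. h x = 0) \<longrightarrow> x = 0)"
  proof -
    have "finite {G. G \<subseteq> H \<and> (\<forall>x. (\<forall>h\<in>G. h x = 0) \<longrightarrow> x = 0)}" using H(1) by simp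
    moreover have "H \<in> {G. G \<subseteq> H \<and> (\<forall>x. (\<forall>h\<in>G. h x = 0) \<longrightarrow> x = 0)}" using tot by blast
    ultimately obtain G where "G \<in> {G. G \<subseteq> H \<and> (\<forall>x. (\<forall>h\<in>G. h x = 0) \<longrightarrow> x = 0)}"
      "\<And>G'. G' \<in> {G. G \<subseteq> H \<and> (\<forall>x. (\<forall>h\<in>G. h x = 0) \<longrightarrow> x = 0)} \<Longrightarrow> G' \<subseteq> G \<Longrightarrow> G = G'"
      using finite_has_minimal2 by (metis (no_types, lifting))
    note G = this
    show thesis
    proof (rule that)
      show "G \<subseteq> H" "\<And>x. \<forall>h\<in>G. h x = 0 \<Longrightarrow> x = 0" using G(1) by blast+
      show "\<not> (\<forall>x. (\<forall>h\<in>G'. h x = 0) \<longrightarrow> x = 0)" if "G' \<subset> G" for G'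
        using G(1) G(2)[of G'] that by blast
    qed
  qed
  have finG: "finite G" using G(1) H(1) finite_subset by blast
  have clG: "clin h" if "h \<in> G" for h using G(1) H(2) that by blast
  \<comment> \<open>By minimality the other members have a common nonzero zero, and \<open>h\<close>
    cannot vanish there.\<close>
  have "\<forall>h\<in>G. \<exists>x. p x = 1 \<and> h x \<noteq> 0 \<and> (\<forall>k\<in>G. k \<noteq> h \<longrightarrow> k x = 0)"
  proof
    fix h assume h: "h \<in> G"
    obtain x where x: "\<forall>k\<in>G - {h}. k x = 0" "x \<noteq> 0" using min[of "G - {h}"] h by blast
    then have "h x \<noteq> 0" using G(2)[of x] by blast
    moreover have "0 < p x" using x(2) p_nonneg[of x] p_eq_0[of x] by linarith
    ultimately show "\<exists>x. p x = 1 \<and> h x \<noteq> 0 \<and> (\<forall>k\<in>G. k \<noteq> h \<longrightarrow> k x = 0)"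
      using x clG h by (intro exI[of _ "(1 / p x) *\<^sub>R x"]) (auto simp: clin_simps)
  qed
  from bchoice[OF this] obtain v where v: "\<And>h. h \<in> G \<Longrightarrow> p (v h) = 1" "\<And>h. h \<in> G \<Longrightarrow> h (v h) \<noteq> 0"
    "\<And>h k. h \<in> G \<Longrightarrow> k \<in> G \<Longrightarrow> k \<noteq> h \<Longrightarrow> k (v h) = 0" by blast
  have "\<forall>h\<in>G. \<exists>D. \<forall>x. cmod (h x) \<le> D * p x" using H(2) G(1) by blast
  from bchoice[OF this] obtain d where d: "\<And>h x. h \<in> G \<Longrightarrow> cmod (h x) \<le> d h * p x" by blast
  define f where "f h x = (1 / h (v h)) * h x" for h x
  define D where "D = (\<Sum>h\<in>G. \<bar>d h\<bar> / cmod (h (v h)))"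
  define A where "A = (\<lambda>h. (v h, f h)) ` G"
  have bound: "cmod (f h x) \<le> D * p x" if h: "h \<in> G" for h x
  proof -
    have "cmod (f h x) \<le> (\<bar>d h\<bar> * p x) / cmod (h (v h))"
    proof -
      have "cmod (h x) \<le> \<bar>d h\<bar> * p x"
        using d[OF h, of x] mult_right_mono[of "d h" "\<bar>d h\<bar>" "p x", OF abs_ge_self p_nonneg] by linarith
      then show ?thesis by (simp add: f_def norm_divide divide_right_mono)
    qed
    also have "\<dots> \<le> D * p x"
      unfolding D_def using finG h
        mult_right_mono[OF member_le_sum[of h G "\<lambda>h. \<bar>d h\<bar> / cmod (h (v h))"], of "p x"] by simp
    finally show ?thesis .
  qed
  have clf: "clin (f h)" if "h \<in> G" for h
    unfolding f_def using clG[OF that] by (rule clin_mult)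
  have orth: "snd a (fst b) = 0" if ab: "a \<in> A" "b \<in> A" "a \<noteq> b" for a b
  proof -
    obtain h k where "h \<in> G" "k \<in> G" "a = (v h, f h)" "b = (v k, f k)" using ab by (auto simp: A_def)
    then show ?thesis using ab(3) v(3)[of k h] by (auto simp: f_def)
  qed
  have "biorthogonal D A"
    unfolding biorthogonal_def
  proof (intro conjI ballI)
    fix a assume "a \<in> A"
    then obtain h where "h \<in> G" "a = (v h, f h)" by (auto simp: A_def)
    then show "case a of (x, f) \<Rightarrow> p x = 1 \<and> clin f \<and> (\<forall>y. cmod (f y) \<le> D * p y) \<and> f x = 1"
      using bound v(1,2)[of h] clf[of h] by (simp add: f_def)
  qed (use orth in blast)
  moreover have "x = 0" if "\<forall>a\<in>A. snd a x = 0" for x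
    using that v(2) by (intro G(2)) (auto simp: A_def f_def)
  moreover have "finite A" using finG by (simp add: A_def)
  ultimately show ?thesis by blast
qed

text \<open>The shields of all finite subsystems are united. A vector of the span lies in the span
  of a finite subsystem, and an infinite set has only as many finite subsets as members.\<close>

lemma infinite_shield:
  assumes A: "biorthogonal D A" "infinite A"
  shows "\<exists>H. |H| \<le>o |A| \<and> shields H (cspan (fst ` A))"
proof -
  have "\<exists>H. finite H \<and> shields H (cspan (fst ` B))" if "B \<in> Fpow A" for B
  proof (rule finite_shield)
    show "biorthogonal D B" "finite B"
      using that biorthogonal_mono[OF A(1), of B] by (auto simp: Fpow_def)
  qed
  then obtain \<H> where \<H>: "\<And>B. B \<in> Fpow A \<Longrightarrow> finite (\<H> B) \<and> shields (\<H> B) (cspan (fst ` B))"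
    by metis
  let ?H = "\<Union>B\<in>Fpow A. \<H> B"
  have "|?H| \<le>o |A|"
  proof (rule card_of_UNION_ordLeq_infinite[OF A(2)])
    show "|Fpow A| \<le>o |A|"
      using eqpoll_Fpow[OF A(2)] by (simp add: eqpoll_iff_card_of_ordIso ordIso_imp_ordLeq)
    show "\<forall>B\<in>Fpow A. |\<H> B| \<le>o |A|"
    proof
      fix B assume "B \<in> Fpow A"
      then have "finite (\<H> B)" using \<H> by blast
      then show "|\<H> B| \<le>o |A|"
        by (rule ordLess_imp_ordLeq[OF finite_ordLess_infinite2[OF _ A(2)]])
    qed
  qed
  moreover have "shields ?H (cspan (fst ` A))"
    unfolding shields_def
  proof (intro conjI allI impI ballI)
    fix x v assume x: "\<forall>h\<in>?H. h x = 0" and "v \<in> cspan (fst ` A)"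
    obtain S where S: "finite S" "S \<subseteq> fst ` A" "v \<in> cspan S"
      using cspan_finite[OF \<open>v \<in> cspan (fst ` A)\<close>] by auto
    obtain B where "B \<subseteq> A" "finite B" "S = fst ` B"
      using finite_subset_image[OF S(1,2)] by auto
    then have "B \<in> Fpow A" "v \<in> cspan (fst ` B)" using S by (auto simp: Fpow_def)
    then show "p v \<le> 2 * p (x - v)" using \<H>[of B] x unfolding shields_def by blast
  qed (use \<H> in \<open>auto simp: shields_def\<close>)
  ultimately show ?thesis by blast
qed

text \<open>The functionals \<open>g\<close> are indexed by the system itself, and any one index may
  be left out: later this is the least index, which is never the second member of a pair and so
  carries no perturbation. If a finite total family exists, a finite system is total by itself;
  otherwise a maximal system with bound \<open>3\<close> is infinite.\<close>

theorem biorthogonal_total: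
  obtains D A where "biorthogonal D A"
    "\<And>m. \<exists>g. (\<forall>a\<in>A. clin (g a) \<and> (\<forall>x. cmod (g a x) \<le> p x)) \<and>
         (\<forall>x. (\<forall>a\<in>A. snd a x = 0) \<longrightarrow> (\<forall>a\<in>A - {m}. g a x = 0) \<longrightarrow> x = 0)"
proof (cases "\<exists>H. finite H \<and> (\<forall>h\<in>H. clin h \<and> (\<exists>D. \<forall>x. cmod (h x) \<le> D * p x)) \<and>
                 (\<forall>x. (\<forall>h\<in>H. h x = 0) \<longrightarrow> x = 0)")
  case True
  then obtain D A where "biorthogonal D A" "\<forall>x. (\<forall>a\<in>A. snd a x = 0) \<longrightarrow> x = 0"
    using finite_biorthogonal_total by metis
  then show thesis
    by (intro that[of D A] exI[of _ "\<lambda>a x. 0"]) (auto simp: clin_zero)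
next
  case False
  have "\<exists>M\<in>{A. biorthogonal 3 A}. \<forall>X\<in>{A. biorthogonal 3 A}. M \<subseteq> X \<longrightarrow> X = M"
  proof (rule subset_Zorn_nonempty)
    show "{A. biorthogonal 3 A} \<noteq> {}" by (auto simp: biorthogonal_def intro: exI[of _ "{}"])
  next
    fix \<C> assume \<C>: "subset.chain {A. biorthogonal 3 A} \<C>"
    have "biorthogonal 3 {a, b}" if ab: "a \<in> \<Union>\<C>" "b \<in> \<Union>\<C>" for a b
    proof -
      obtain B B' where B: "B \<in> \<C>" "a \<in> B" "B' \<in> \<C>" "b \<in> B'" using ab by auto
      then have "B \<subseteq> B' \<or> B' \<subseteq> B" using \<C> by (auto simp: subset_chain_def)
      then obtain B'' where "B'' \<in> \<C>" "{a, b} \<subseteq> B''" using B by auto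
      moreover from this have "biorthogonal 3 B''" using \<C> by (auto simp: subset_chain_def)
      ultimately show ?thesis using biorthogonal_mono by metis
    qed
    then show "\<Union>\<C> \<in> {A. biorthogonal 3 A}"
      using biorthogonal_pairI[of "\<Union>\<C>" 3] by simp
  qed
  then obtain A where A: "biorthogonal 3 A" and max: "\<And>b. biorthogonal 3 (insert b A) \<Longrightarrow> b \<in> A" by blast
  have total: "x = 0" if "shields H (cspan (fst ` A))" "\<forall>h\<in>H. h x = 0" "\<forall>a\<in>A. snd a x = 0" for H x
    using biorthogonal_extend[OF A that(1), of x] that(2,3) max by blast
  \<comment> \<open>A finite maximal system together with its finite shield would be a finite total
    family.\<close>
  have "infinite A"
  proof
    assume fin: "finite A"
    then obtain H where H: "finite H" "shields H (cspan (fst ` A))" using finite_shield[OF A] by blast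
    have "finite (H \<union> snd ` A)" using H fin by simp
    moreover have "clin h \<and> (\<exists>D. \<forall>x. cmod (h x) \<le> D * p x)" if h: "h \<in> H \<union> snd ` A" for h
    proof (cases "h \<in> H")
      case True
      then have "clin h \<and> (\<forall>x. cmod (h x) \<le> 1 * p x)" using H(2) by (simp add: shields_def)
      then show ?thesis by blast
    next
      case False
      then obtain a where "a \<in> A" "h = snd a" using h by auto
      then have "clin h \<and> (\<forall>x. cmod (h x) \<le> 3 * p x)" using A by (auto simp: biorthogonal_def)
      then show ?thesis by blast
    qed
    moreover have "x = 0" if "\<forall>h\<in>H \<union> snd ` A. h x = 0" for x
      using total[OF H(2), of x] that by blast
    ultimately have "\<exists>H. finite H \<and> (\<forall>h\<in>H. clin h \<and> (\<exists>D. \<forall>x. cmod (h x) \<le> D * p x)) \<and>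
        (\<forall>x. (\<forall>h\<in>H. h x = 0) \<longrightarrow> x = 0)"
      by (intro exI[of _ "H \<union> snd ` A"]) simp
    then show False using False by contradiction
  qed
  then obtain H where H: "|H| \<le>o |A|" "shields H (cspan (fst ` A))" using infinite_shield[OF A] by blast
  have "\<exists>g. (\<forall>a\<in>A. clin (g a) \<and> (\<forall>x. cmod (g a x) \<le> p x)) \<and>
         (\<forall>x. (\<forall>a\<in>A. snd a x = 0) \<longrightarrow> (\<forall>a\<in>A - {m}. g a x = 0) \<longrightarrow> x = 0)" for m
  proof -
    \<comment> \<open>Removing one index from an infinite set still leaves room for all of
      \<open>H\<close>.\<close>
    have "H \<lesssim> A - {m}"
    proof -
      have "H \<lesssim> A" using H(1) by (simp add: lepoll_def card_of_ordLeq)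
      also have "A \<approx> A - {m}"
        using infinite_imp_bij_betw[OF \<open>infinite A\<close>, of m] by (auto simp: eqpoll_def)
      finally show ?thesis .
    qed
    then obtain e where e: "H \<subseteq> e ` (A - {m})" by (auto simp: lepoll_iff)
    define g where "g a = (if e a \<in> H then e a else (\<lambda>x. 0))" for a
    have "x = 0" if "\<forall>a\<in>A. snd a x = 0" "\<forall>a\<in>A - {m}. g a x = 0" for x
      using that e by (intro total[OF H(2)]) (force simp: g_def)+
    moreover have "clin (g a) \<and> (\<forall>x. cmod (g a x) \<le> p x)" for a
      using H(2) clin_zero by (auto simp: g_def shields_def)
    ultimately show ?thesis by (intro exI[of _ g]) simp
  qed
  then show thesis by (rule that[OF A])
qed

end

section \<open>Isometries permute peaked families\<close>

lemma cmod_parallelogram: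
  "(cmod (a + b))\<^sup>2 + (cmod (a - b))\<^sup>2 = 2 * (cmod a)\<^sup>2 + 2 * (cmod b)\<^sup>2"
  unfolding cmod_power2 by (simp add: power2_eq_square algebra_simps)

text \<open>\<open>\<alpha>\<close> and \<open>\<beta>\<close> enter through the norm
  \<open>B\<close> below, and \<open>e1\<close>, \<open>e2\<close> make them independent. In
  \<open>peak\<close> both the margin \<open>1/10\<close> and the bound \<open>2\<close> are uniform
  over the family.\<close>

locale peaked_family = complex_norm J p K
  for J :: "'a::real_normed_vector \<Rightarrow> 'a" and p K +
  fixes F :: "('a \<Rightarrow> complex) set" and \<alpha> \<beta> :: "'a \<Rightarrow> complex" and e1 e2 :: 'a and r C :: real
  assumes clin_F: "\<phi> \<in> F \<Longrightarrow> clin \<phi>" and F_le: "\<phi> \<in> F \<Longrightarrow> cmod (\<phi> x) \<le> C * p x"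
    and F_nonempty: "F \<noteq> {}" and r_pos: "0 < r"
    and clin_ab: "clin \<alpha>" "clin \<beta>" and ab_le: "cmod (\<alpha> x) \<le> C * p x" "cmod (\<beta> x) \<le> C * p x"
    and e12: "\<alpha> e1 = 1" "\<beta> e1 = 0" "\<alpha> e2 = 0" "\<beta> e2 = 1"
    and peak: "\<phi> \<in> F \<Longrightarrow> \<exists>w. p w \<le> 2 \<and> r * norm (p w, \<alpha> w, \<beta> w) \<le> cmod (\<phi> w) - 1 / 10 \<and>
                 (\<forall>\<psi>\<in>F - {\<phi>}. cmod (\<psi> w) \<le> cmod (\<phi> w) - 1 / 10)"
begin

text \<open>The Euclidean norm of the triple makes \<open>B\<close> strictly convex in the
  directions that \<open>\<alpha>\<close> and \<open>\<beta>\<close> detect.\<close>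

definition B :: "'a \<Rightarrow> real" where
  "B x = r * norm (p x, \<alpha> x, \<beta> x)"

definition N :: "'a \<Rightarrow> real" where
  "N x = max (B x) (SUP \<phi>\<in>F. cmod (\<phi> x))"

lemma C_nonneg: "0 \<le> C"
proof -
  have "0 < cmod (\<alpha> e1)" using e12 by simp
  also have "\<dots> \<le> C * p e1" by (rule ab_le)
  finally have "0 < C * p e1" .
  then show ?thesis using p_nonneg[of e1] by (metis less_eq_real_def not_less zero_less_mult_iff)
qed

lemma B_nonneg: "0 \<le> B x"
  using r_pos by (simp add: B_def)

lemma B_ge: "r * p x \<le> B x"
proof -
  have "p x = norm (fst (p x, \<alpha> x, \<beta> x))" by simp
  also have "\<dots> \<le> norm (p x, \<alpha> x, \<beta> x)" using norm_fst_le[of "p x" "(\<alpha> x, \<beta> x)"] by simp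
  finally show ?thesis using r_pos by (simp add: B_def)
qed

lemma B_le: "B x \<le> r * (1 + 2 * C) * p x"
proof -
  have "norm (p x, \<alpha> x, \<beta> x) \<le> norm (p x) + (cmod (\<alpha> x) + cmod (\<beta> x))"
    using norm_Pair_le[of "p x" "(\<alpha> x, \<beta> x)"] norm_Pair_le[of "\<alpha> x" "\<beta> x"] by linarith
  also have "\<dots> \<le> (1 + 2 * C) * p x"
    using ab_le[of x] by (simp add: algebra_simps)
  finally show ?thesis using r_pos by (simp add: B_def mult.assoc)
qed

lemma B_add: "B (x + y) \<le> B x + B y"
proof -
  have "norm (p (x + y), \<alpha> (x + y), \<beta> (x + y)) \<le> norm ((p x, \<alpha> x, \<beta> x) + (p y, \<alpha> y, \<beta> y))"
    using p_add[of x y] clin_ab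
    by (simp add: norm_Pair clin_simps real_sqrt_le_iff power_mono)
  also have "\<dots> \<le> norm (p x, \<alpha> x, \<beta> x) + norm (p y, \<alpha> y, \<beta> y)" by (rule norm_triangle_ineq)
  finally show ?thesis using r_pos by (simp add: B_def distrib_left[symmetric])
qed

lemma B_cscale: "B (cscale z x) = cmod z * B x"
proof -
  have "(cmod z * p x)\<^sup>2 + ((cmod z * cmod (\<alpha> x))\<^sup>2 + (cmod z * cmod (\<beta> x))\<^sup>2)
     = (cmod z)\<^sup>2 * ((p x)\<^sup>2 + ((cmod (\<alpha> x))\<^sup>2 + (cmod (\<beta> x))\<^sup>2))"
    by (simp add: power_mult_distrib algebra_simps)
  then show ?thesis
    using clin_ab by (simp add: B_def norm_Pair clin_simps norm_mult real_sqrt_mult)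
qed

text \<open>The squared moduli obey the parallelogram law and \<open>p\<close> the corresponding
  inequality. Averaging over \<open>x + z\<close> and \<open>x - z\<close> thus adds the squares at
  \<open>z\<close>, for which the hypotheses leave no room.\<close>

lemma B_strict:
  assumes "B (x + z) \<le> B x" "B (x - z) \<le> B x"
  shows "\<alpha> z = 0" "\<beta> z = 0"
proof -
  have sq: "(p y)\<^sup>2 + (cmod (\<alpha> y))\<^sup>2 + (cmod (\<beta> y))\<^sup>2 \<le> (p x)\<^sup>2 + (cmod (\<alpha> x))\<^sup>2 + (cmod (\<beta> x))\<^sup>2"
    if "B y \<le> B x" for y
    using that r_pos by (simp add: B_def norm_Pair algebra_simps)
  have par: "(cmod (f (x + z)))\<^sup>2 + (cmod (f (x - z)))\<^sup>2 = 2 * (cmod (f x))\<^sup>2 + 2 * (cmod (f z))\<^sup>2"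
    if "clin f" for f
    using cmod_parallelogram[of "f x" "f z"] by (simp add: clin_simps(1,2)[OF that])
  have "2 * p x \<le> p (x + z) + p (x - z)"
    using p_add[of "x + z" "x - z"] p_scaleR[of 2 x] by (simp add: scaleR_2)
  then have "(2 * p x)\<^sup>2 \<le> (p (x + z) + p (x - z))\<^sup>2" by (intro power_mono) auto
  also have "\<dots> \<le> 2 * ((p (x + z))\<^sup>2 + (p (x - z))\<^sup>2)"
    using zero_le_power2[of "p (x + z) - p (x - z)"] by (simp add: power2_eq_square algebra_simps)
  finally have "2 * (p x)\<^sup>2 \<le> (p (x + z))\<^sup>2 + (p (x - z))\<^sup>2" by (simp add: power_mult_distrib)
  then have "(cmod (\<alpha> z))\<^sup>2 + (cmod (\<beta> z))\<^sup>2 \<le> 0"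
    using sq[OF assms(1)] sq[OF assms(2)] par[OF clin_ab(1)] par[OF clin_ab(2)] by linarith
  then show "\<alpha> z = 0" "\<beta> z = 0"
    by (simp_all add: sum_power2_le_zero_iff)
qed

section \<open>The norm \<open>N\<close>\<close>

lemma F_bdd: "bdd_above ((\<lambda>\<phi>. cmod (\<phi> x)) ` F)"
  using F_le by (intro bdd_aboveI2[where M="C * p x"])

lemma N_ge_F: "\<phi> \<in> F \<Longrightarrow> cmod (\<phi> x) \<le> N x"
  unfolding N_def by (rule max.coboundedI2) (rule cSUP_upper[OF _ F_bdd])

lemma N_ge_B: "B x \<le> N x"
  by (simp add: N_def)

lemma N_leI: "B x \<le> M \<Longrightarrow> (\<And>\<phi>. \<phi> \<in> F \<Longrightarrow> cmod (\<phi> x) \<le> M) \<Longrightarrow> N x \<le> M"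
  unfolding N_def using F_nonempty by (auto intro: cSUP_least)

lemma N_nonneg: "0 \<le> N x"
  using B_nonneg N_ge_B order_trans by blast

lemma N_ge: "r * p x \<le> N x"
  using B_ge N_ge_B order_trans by blast

definition M :: real where
  "M = 1 + C + r * (1 + 2 * C)"

lemma M_pos: "0 < M" and C_le_M: "C \<le> M"
  using C_nonneg r_pos by (auto simp: M_def intro!: add_pos_nonneg mult_nonneg_nonneg)

lemma B_le_M: "B x \<le> M * p x"
proof -
  have "r * (1 + 2 * C) * p x \<le> M * p x"
    using C_nonneg by (intro mult_right_mono) (auto simp: M_def)
  then show ?thesis using B_le[of x] by linarith
qed

lemma F_le_M: "\<phi> \<in> F \<Longrightarrow> cmod (\<phi> x) \<le> M * p x"
  using F_le[of \<phi> x] mult_right_mono[OF C_le_M p_nonneg[of x]] by linarith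

lemma N_le: "N x \<le> M * p x"
  by (rule N_leI[OF B_le_M F_le_M])

lemma N_add: "N (x + y) \<le> N x + N y"
proof (rule N_leI)
  show "B (x + y) \<le> N x + N y" using B_add[of x y] N_ge_B[of x] N_ge_B[of y] by linarith
  show "cmod (\<phi> (x + y)) \<le> N x + N y" if "\<phi> \<in> F" for \<phi>
    using norm_triangle_ineq[of "\<phi> x" "\<phi> y"] N_ge_F[OF that, of x] N_ge_F[OF that, of y]
    by (simp add: clin_simps(1)[OF clin_F[OF that]])
qed

lemma N_cscale_le: "N (cscale z x) \<le> cmod z * N x"
proof (rule N_leI)
  show "B (cscale z x) \<le> cmod z * N x"
    using N_ge_B[of x] by (simp add: B_cscale mult_left_mono)
  show "cmod (\<phi> (cscale z x)) \<le> cmod z * N x" if "\<phi> \<in> F" for \<phi>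
    using N_ge_F[OF that, of x] by (simp add: clin_simps(7)[OF clin_F[OF that]] norm_mult mult_left_mono)
qed

lemma N_cscale: "N (cscale z x) = cmod z * N x"
proof (cases "z = 0")
  case True
  then show ?thesis using N_cscale_le[of 0 x] N_nonneg[of 0] by simp
next
  case False
  have "N x \<le> cmod (1 / z) * N (cscale z x)"
    using N_cscale_le[of "1 / z" "cscale z x"] False by (simp add: cscale_cscale)
  then have "cmod z * N x \<le> N (cscale z x)" using False by (simp add: norm_divide field_simps)
  then show ?thesis using N_cscale_le[of z x] by simp
qed

lemma N_scaleR: "N (a *\<^sub>R x) = \<bar>a\<bar> * N x"
  using N_cscale[of "of_real a" x] by simp

lemma N_eq_0: "N x = 0 \<longleftrightarrow> x = 0"
proof
  assume "N x = 0"
  then have "r * p x \<le> 0" using N_ge[of x] by simp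
  then show "x = 0" using r_pos p_nonneg[of x] p_eq_0[of x] by (simp add: mult_le_0_iff)
qed (use N_scaleR[of 0 0] in simp)

section \<open>Isometries near a peak\<close>

lemma peak_point:
  assumes "\<phi> \<in> F"
  obtains w where "p w \<le> 2" "B w \<le> cmod (\<phi> w) - 1 / 10"
    "\<And>\<psi>. \<psi> \<in> F \<Longrightarrow> \<psi> \<noteq> \<phi> \<Longrightarrow> cmod (\<psi> w) \<le> cmod (\<phi> w) - 1 / 10"
  using peak[OF assms] unfolding B_def by blast

text \<open>The perturbation changes \<open>B\<close> and every member by at most
  \<open>1/20\<close>, so the margin \<open>1/10\<close> covers the loss of \<open>\<phi>\<close>
  and the gain of a competitor.\<close>

lemma N_near_peak:
  assumes \<phi>: "\<phi> \<in> F" and w: "B w \<le> cmod (\<phi> w) - 1 / 10"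
    "\<And>\<psi>. \<psi> \<in> F \<Longrightarrow> \<psi> \<noteq> \<phi> \<Longrightarrow> cmod (\<psi> w) \<le> cmod (\<phi> w) - 1 / 10"
    and y: "p y \<le> 1 / (20 * M)"
  shows "N (w + y) = cmod (\<phi> (w + y))"
proof (rule antisym)
  have My: "M * p y \<le> 1 / 20" using y M_pos by (simp add: field_simps)
  have low: "cmod (\<phi> w) - 1 / 20 \<le> cmod (\<phi> (w + y))"
    using norm_diff_ineq[of "\<phi> w" "\<phi> y"] F_le_M[OF \<phi>, of y] My
    by (simp add: clin_simps(1)[OF clin_F[OF \<phi>]])
  show "N (w + y) \<le> cmod (\<phi> (w + y))"
  proof (rule N_leI)
    show "B (w + y) \<le> cmod (\<phi> (w + y))" using B_add[of w y] B_le_M[of y] w(1) My low by linarith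
    fix \<psi> assume \<psi>: "\<psi> \<in> F"
    show "cmod (\<psi> (w + y)) \<le> cmod (\<phi> (w + y))"
    proof (cases "\<psi> = \<phi>")
      case False
      then show ?thesis
        using norm_triangle_ineq[of "\<psi> w" "\<psi> y"] F_le_M[OF \<psi>, of y] w(2)[OF \<psi>] My low
        by (simp add: clin_simps(1)[OF clin_F[OF \<psi>]])
    qed simp
  qed
qed (rule N_ge_F[OF \<phi>])

text \<open>Comparing the two squared moduli gives \<open>Re k = 0\<close>; what remains is
  \<open>(sin t)\<^sup>2 * (Im k)\<^sup>2 = (sin t)\<^sup>2\<close>.\<close>

lemma unit_rotation_imaginary:
  fixes k :: complex
  assumes "cos t \<noteq> 0" "sin t \<noteq> 0" "cmod (of_real (cos t) + of_real (sin t) * k) = 1"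
    "cmod (of_real (cos t) - of_real (sin t) * k) = 1"
  shows "k = \<i> \<or> k = - \<i>"
proof -
  have 1: "(cos t + sin t * Re k)\<^sup>2 + (sin t * Im k)\<^sup>2 = 1"
    using arg_cong[OF assms(3), of "\<lambda>x. x\<^sup>2"] by (simp add: cmod_power2)
  have 2: "(cos t - sin t * Re k)\<^sup>2 + (sin t * Im k)\<^sup>2 = 1"
    using arg_cong[OF assms(4), of "\<lambda>x. x\<^sup>2"] by (simp add: cmod_power2)
  have "4 * (cos t * sin t * Re k) = (cos t + sin t * Re k)\<^sup>2 - (cos t - sin t * Re k)\<^sup>2"
    by (simp add: power2_eq_square algebra_simps)
  then have "cos t * sin t * Re k = 0" using 1 2 by linarith
  then have Re: "Re k = 0" using assms(1,2) by simp
  have "(cos t)\<^sup>2 + (sin t)\<^sup>2 * (Im k)\<^sup>2 = 1" using 1 Re by (simp add: power_mult_distrib)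
  then have "(sin t)\<^sup>2 * (Im k)\<^sup>2 = (sin t)\<^sup>2 * 1"
    using sin_cos_squared_add[of t] by linarith
  then have "(Im k)\<^sup>2 = 1" using assms(2) by simp
  then have "Im k = 1 \<or> Im k = - 1" by (simp add: power2_eq_1_iff)
  then show ?thesis using Re by (auto simp: complex_eq_iff)
qed

text \<open>Around the peak \<open>w\<close> of \<open>\<phi>\<close> the norm \<open>N\<close> equals \<open>cmod \<circ> \<phi>\<close>, hence is constant in the
  directions of \<open>ker \<phi>\<close>. Any \<open>\<psi>\<close> that almost attains \<open>N\<close> at \<open>T w\<close> must then be small on
  \<open>T (ker \<phi>)\<close>, and the uniform gap at peaks leaves room for only one such \<open>\<psi>\<close>. The part \<open>B\<close>
  of the norm cannot be the attaining one because it is strictly convex in two complex directions.\<close>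

lemma isometry_permutes_family:
  assumes T: "linear T" "surj T" "\<And>x. N (T x) = N x" and \<phi>: "\<phi> \<in> F"
  shows "\<exists>\<psi>\<in>F. \<forall>x. cmod (\<psi> (T x)) = cmod (\<phi> x)"
proof -
  note lin = linear_add[OF T(1)] linear_diff[OF T(1)] linear_scale[OF T(1)]
  note c\<phi> = clin_simps[OF clin_F[OF \<phi>]]
  obtain w where w: "p w \<le> 2" "B w \<le> cmod (\<phi> w) - 1 / 10"
    "\<And>\<psi>. \<psi> \<in> F \<Longrightarrow> \<psi> \<noteq> \<phi> \<Longrightarrow> cmod (\<psi> w) \<le> cmod (\<phi> w) - 1 / 10"
    using peak_point[OF \<phi>] by blast
  define V where "V = cmod (\<phi> w)"
  define \<rho> where "\<rho> = 1 / (20 * M)"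
  have V: "0 < V" using w(2) B_nonneg[of w] unfolding V_def by linarith
  have \<rho>: "0 < \<rho>" using M_pos by (simp add: \<rho>_def)
  have near: "N (w + y) = cmod (\<phi> (w + y))" if "p y \<le> \<rho>" for y
    by (rule N_near_peak[OF \<phi> w(2)]) (use w(3) that in \<open>auto simp: \<rho>_def\<close>)
  have NTw: "N (T w) = V" using near[of 0] \<rho> by (simp add: T V_def)
  \<comment> \<open>\<open>w'\<close> is the direction in which \<open>w\<close> has to move for
    \<open>T w\<close> to be rotated by a complex phase.\<close>
  obtain w' where w': "T w' = J (T w)" using T(2) by (metis surjD)
  \<comment> \<open>It turns out that \<open>\<phi> w'\<close> is \<open>\<i>\<close> or
    \<open>- \<i>\<close> times \<open>\<phi> w\<close>. So \<open>w\<close>, \<open>w'\<close> and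
    the kernel of \<open>\<phi>\<close> span the space, and \<open>c y\<close> is
    \<open>\<phi> y / \<phi> w\<close> or its conjugate.\<close>
  obtain c where c: "\<And>y. cmod (c y) = cmod (\<phi> y) / V"
    "\<And>y. \<phi> (y - Re (c y) *\<^sub>R w - Im (c y) *\<^sub>R w') = 0"
  proof -
    define s where "s = p w + p w' + 1"
    \<comment> \<open>Rotating by the angle \<open>t\<close> moves \<open>w\<close> by at most
      \<open>t * s\<close>, so it stays where \<open>N\<close> is the modulus of
      \<open>\<phi>\<close>; \<open>t \<le> 1\<close> keeps sine and cosine positive.\<close>
    define t where "t = min 1 (\<rho> / s)"
    have s: "0 < s" by (simp add: s_def add_nonneg_pos)
    have t: "0 < t" "t \<le> 1" "t * s \<le> \<rho>" using \<rho> s by (auto simp: t_def min_def field_simps)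
    have "N (cos u *\<^sub>R w + sin u *\<^sub>R w') = V" for u
    proof -
      have "N (cos u *\<^sub>R w + sin u *\<^sub>R w') = N (cscale (cis u) (T w))"
        using w' T(3)[of "cos u *\<^sub>R w + sin u *\<^sub>R w'"] by (simp add: lin cscale_def)
      then show ?thesis using NTw by (simp add: N_cscale)
    qed
    moreover have "N (cos u *\<^sub>R w + sin u *\<^sub>R w') = cmod (\<phi> (cos u *\<^sub>R w + sin u *\<^sub>R w'))" if "\<bar>u\<bar> = t" for u
    proof -
      have "\<bar>cos u - 1\<bar> \<le> t"
      proof -
        have "1 - cos u = 2 * (sin (u / 2))\<^sup>2" using cos_double_sin[of "u / 2"] by simp
        moreover have "(sin (u / 2))\<^sup>2 \<le> \<bar>sin (u / 2)\<bar>"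
          using abs_sin_le_one[of "u/2"] mult_left_le[of "\<bar>sin (u/2)\<bar>" "\<bar>sin (u/2)\<bar>"]
          by (simp add: power2_eq_square abs_mult_self_eq)
        moreover have "\<bar>sin (u / 2)\<bar> \<le> \<bar>u / 2\<bar>" by (rule abs_sin_x_le_abs_x)
        moreover have "0 \<le> (sin (u / 2))\<^sup>2" by simp
        ultimately show ?thesis using that by linarith
      qed
      moreover have "\<bar>sin u\<bar> \<le> t" using abs_sin_x_le_abs_x[of u] that by simp
      moreover have "p ((cos u - 1) *\<^sub>R w + sin u *\<^sub>R w') \<le> \<bar>cos u - 1\<bar> * p w + \<bar>sin u\<bar> * p w'"
        using p_add[of "(cos u - 1) *\<^sub>R w" "sin u *\<^sub>R w'"] by simp
      ultimately have "p ((cos u - 1) *\<^sub>R w + sin u *\<^sub>R w') \<le> t * p w + t * p w'"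
        by (meson add_mono mult_right_mono order_trans p_nonneg)
      also have "\<dots> \<le> t * s" using t(1) by (simp add: s_def algebra_simps)
      finally have "p ((cos u - 1) *\<^sub>R w + sin u *\<^sub>R w') \<le> \<rho>" using t(3) by linarith
      from near[OF this] show ?thesis by (simp add: algebra_simps)
    qed
    ultimately have eqV: "cmod (\<phi> (cos u *\<^sub>R w + sin u *\<^sub>R w')) = V" if "\<bar>u\<bar> = t" for u
      using that by simp
    define k where "k = \<phi> w' / \<phi> w"
    have \<phi>w: "\<phi> w \<noteq> 0" using V by (auto simp: V_def)
    have fac: "\<phi> (cos u *\<^sub>R w + sin u *\<^sub>R w') = \<phi> w * (of_real (cos u) + of_real (sin u) * k)" for u
      using \<phi>w by (simp add: c\<phi> k_def field_simps)
    have 1: "cmod (of_real (cos u) + of_real (sin u) * k) = 1" if "\<bar>u\<bar> = t" for u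
      using eqV[OF that] V unfolding fac norm_mult V_def by simp
    have "0 < sin t" "0 < cos t" using t pi_gt3 by (auto intro: sin_gt_zero cos_gt_zero)
    then have "k = \<i> \<or> k = - \<i>"
      using 1[of t] 1[of "- t"] t(1) by (intro unit_rotation_imaginary[of t]) auto
    then have k: "\<phi> w' = \<i> * \<phi> w \<or> \<phi> w' = - \<i> * \<phi> w" using \<phi>w by (auto simp: k_def field_simps)
    define c where "c y = (if k = \<i> then \<phi> y / \<phi> w else cnj (\<phi> y / \<phi> w))" for y
    have "cmod (c y) = cmod (\<phi> y) / V" for y
      by (simp add: c_def norm_divide V_def)
    moreover have "\<phi> (y - Re (c y) *\<^sub>R w - Im (c y) *\<^sub>R w') = 0" for y
    proof -
      let ?q = "\<phi> y / \<phi> w"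
      have "of_real (Re (c y)) + of_real (Im (c y)) * k = ?q"
        using \<open>k = \<i> \<or> k = - \<i>\<close>
        by (auto simp: c_def complex_eq_iff simp del: complex_cnj_divide)
      then have "\<phi> w * (of_real (Re (c y)) + of_real (Im (c y)) * k) = \<phi> y" using \<phi>w by simp
      moreover have "\<phi> w' = k * \<phi> w" using \<phi>w by (simp add: k_def)
      ultimately show ?thesis by (simp add: c\<phi> algebra_simps)
    qed
    ultimately show thesis by (rule that)
  qed
  define z where "z y = y - Re (c y) *\<^sub>R w - Im (c y) *\<^sub>R w'" for y
  have \<phi>z: "\<phi> (z y) = 0" for y using c(2) by (simp add: z_def)
  \<comment> \<open>The real plane of \<open>w\<close> and \<open>w'\<close> is carried to the
    complex line of \<open>T w\<close>.\<close>
  have Ty: "T y = cscale (c y) (T w) + T (z y)" for y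
    by (simp add: z_def lin w' cscale_def)
  \<comment> \<open>\<open>N\<close> equals \<open>V\<close> at both \<open>T (w + y)\<close> and
    \<open>T (w - y)\<close>; the parallelogram law turns this into the bound.\<close>
  have ker_small: "(cmod (\<psi> (T y)))\<^sup>2 \<le> V\<^sup>2 - (cmod (\<psi> (T w)))\<^sup>2"
    if "\<psi> \<in> F" "\<phi> y = 0" "p y \<le> \<rho>" for \<psi> y
  proof -
    have "N (T (w + y)) = V" "N (T (w - y)) = V"
      using near[of y] near[of "- y"] that(2,3) by (simp_all add: T c\<phi> V_def)
    then have "cmod (\<psi> (T w) + \<psi> (T y)) \<le> V" "cmod (\<psi> (T w) - \<psi> (T y)) \<le> V"
      using N_ge_F[OF that(1)] by (metis lin clin_simps(1,2)[OF clin_F[OF that(1)]])+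
    then have "(cmod (\<psi> (T w) + \<psi> (T y)))\<^sup>2 \<le> V\<^sup>2" "(cmod (\<psi> (T w) - \<psi> (T y)))\<^sup>2 \<le> V\<^sup>2"
      by (auto intro: power_mono)
    moreover have "(cmod (\<psi> (T w) + \<psi> (T y)))\<^sup>2 + (cmod (\<psi> (T w) - \<psi> (T y)))\<^sup>2
      = 2 * (cmod (\<psi> (T w)))\<^sup>2 + 2 * (cmod (\<psi> (T y)))\<^sup>2"
      by (rule cmod_parallelogram)
    ultimately show ?thesis by linarith
  qed
  have small_multiple: "\<exists>s>0. p (s *\<^sub>R y) \<le> \<rho>" for y
  proof -
    have "0 < p y + 1" using p_nonneg[of y] by linarith
    then show ?thesis
      using \<rho> by (intro exI[of _ "\<rho> / (p y + 1)"]) (simp add: field_simps)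
  qed
  have BTw: "B (T w) < V"
  proof (rule ccontr)
    assume "\<not> ?thesis"
    then have BV: "B (T w) = V" using N_ge_B[of "T w"] NTw by simp
    have ker: "\<alpha> (T y) = 0" "\<beta> (T y) = 0" if y: "\<phi> y = 0" for y
    proof -
      obtain s where s: "0 < s" "p (s *\<^sub>R y) \<le> \<rho>" using small_multiple by blast
      have "N (T (w + s *\<^sub>R y)) = V" "N (T (w - s *\<^sub>R y)) = V"
        using near[of "s *\<^sub>R y"] near[of "- s *\<^sub>R y"] s(2) y by (simp_all add: T c\<phi> V_def)
      then have "B (T w + T (s *\<^sub>R y)) \<le> B (T w)" "B (T w - T (s *\<^sub>R y)) \<le> B (T w)"
        using N_ge_B BV by (metis lin(1,2))+
      from B_strict[OF this] show "\<alpha> (T y) = 0" "\<beta> (T y) = 0"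
        using s(1) clin_ab by (auto simp: lin clin_simps)
    qed
    \<comment> \<open>Both functionals vanish on the image of the kernel, so only the multiple of
      \<open>T w\<close> counts and they would be proportional, against \<open>e1\<close> and
      \<open>e2\<close>.\<close>
    have *: "\<alpha> x * \<beta> (T w) = \<beta> x * \<alpha> (T w)" for x
    proof -
      obtain y where "x = T y" using T(2) by (metis surjD)
      then show ?thesis
        using Ty[of y] ker[OF \<phi>z, of y] clin_ab by (simp add: clin_simps)
    qed
    have "\<alpha> (T w) = 0" "\<beta> (T w) = 0" using *[of e1] *[of e2] e12 by auto
    moreover obtain y where "e1 = T y" using T(2) by (metis surjD)
    ultimately have "\<alpha> e1 = 0"
      using Ty[of y] ker[OF \<phi>z, of y] clin_ab by (simp add: clin_simps)
    then show False using e12 by simp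
  qed
  have attain: "\<exists>\<psi>\<in>F. V - \<eta> < cmod (\<psi> (T w))" if "0 < \<eta>" for \<eta>
  proof (rule ccontr)
    assume "\<not> ?thesis"
    then have "cmod (\<psi> (T w)) \<le> max (V - \<eta>) (B (T w))" if "\<psi> \<in> F" for \<psi> using that by force
    then have "N (T w) \<le> max (V - \<eta>) (B (T w))" by (intro N_leI) auto
    then show False using that NTw BTw by simp
  qed
  \<comment> \<open>\<open>M1\<close> bounds the preimage of a peak point, \<open>c1\<close> the
    coefficient of this preimage, and \<open>z1\<close> its component in the kernel of
    \<open>\<phi>\<close>.\<close>
  define M1 where "M1 = 2 * M / r"
  define c1 where "c1 = C * M1 / V"
  define z1 where "z1 = M1 + c1 * (p w + p w') + 1"
  have M1: "0 < M1" using M_pos r_pos by (simp add: M1_def)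
  have c1: "0 \<le> c1" using M1 C_nonneg V by (simp add: c1_def)
  have z1: "0 < z1" using M1 c1 by (simp add: z1_def add_pos_nonneg add_nonneg_pos)
  \<comment> \<open>At the peak point \<open>u\<close> of \<open>\<psi>\<close>, the modulus of
    \<open>\<psi>\<close> is at most and that of \<open>\<xi>\<close> at least
    \<open>cmod (c y) * V\<close>, up to errors that vanish with \<open>\<eta>\<close>; yet
    \<open>u\<close> separates them by \<open>1/10\<close>.\<close>
  have gap: "1 / 10 \<le> c1 * \<eta> + 2 * (z1 / \<rho>) * sqrt (2 * V * \<eta>)"
    if \<psi>: "\<psi> \<in> F" "V - \<eta> < cmod (\<psi> (T w))" and \<xi>: "\<xi> \<in> F" "V - \<eta> < cmod (\<xi> (T w))" and ne: "\<psi> \<noteq> \<xi>"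
      and \<eta>: "0 < \<eta>" "\<eta> < V" for \<psi> \<xi> \<eta>
  proof -
    obtain u where u: "p u \<le> 2" "cmod (\<xi> u) \<le> cmod (\<psi> u) - 1 / 10"
      using peak_point[OF \<psi>(1)] \<xi>(1) ne by metis
    obtain y where y: "u = T y" using T(2) by (metis surjD)
    have "r * p y \<le> N u" using N_ge[of y] by (simp add: y T)
    also have "\<dots> \<le> M * 2" using N_le[of u] mult_left_mono[OF u(1), of M] M_pos by linarith
    finally have py: "p y \<le> M1" using r_pos by (simp add: M1_def field_simps)
    have "cmod (\<phi> y) \<le> C * M1" using F_le[OF \<phi>, of y] mult_left_mono[OF py C_nonneg] by linarith
    then have cy: "cmod (c y) \<le> c1" using V by (simp add: c(1) c1_def divide_right_mono)
    have pz: "p (z y) \<le> z1"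
    proof -
      have "p (z y) \<le> p y + p (Re (c y) *\<^sub>R w) + p (Im (c y) *\<^sub>R w')"
        unfolding z_def using p_diff[of "y - Re (c y) *\<^sub>R w" "Im (c y) *\<^sub>R w'"] p_diff[of y "Re (c y) *\<^sub>R w"]
        by linarith
      also have "\<dots> \<le> M1 + c1 * p w + c1 * p w'"
        using py cy abs_Re_le_cmod[of "c y"] abs_Im_le_cmod[of "c y"]
        by (intro add_mono) (auto intro!: mult_right_mono)
      also have "\<dots> \<le> z1" by (simp add: z1_def algebra_simps)
      finally show ?thesis .
    qed
    have kz: "cmod (\<omega> (T (z y))) \<le> (z1 / \<rho>) * sqrt (2 * V * \<eta>)"
      if \<omega>: "\<omega> \<in> F" "V - \<eta> < cmod (\<omega> (T w))" for \<omega>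
    proof -
      let ?s = "\<rho> / z1"
      have s: "0 < ?s" using \<rho> z1 by simp
      have "p (?s *\<^sub>R z y) \<le> \<rho>"
        using pz \<rho> z1 by (simp add: field_simps mult_left_mono)
      then have "(cmod (\<omega> (T (?s *\<^sub>R z y))))\<^sup>2 \<le> V\<^sup>2 - (cmod (\<omega> (T w)))\<^sup>2"
        using \<phi>z by (intro ker_small \<omega>(1)) (auto simp: c\<phi>)
      also have "\<dots> \<le> V\<^sup>2 - (V - \<eta>)\<^sup>2"
        using \<omega>(2) \<eta> by (intro diff_left_mono power_mono) auto
      also have "\<dots> \<le> 2 * V * \<eta>" by (simp add: power2_eq_square algebra_simps)
      finally have "cmod (\<omega> (T (?s *\<^sub>R z y))) \<le> sqrt (2 * V * \<eta>)" by (rule real_le_rsqrt)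
      then have "?s * cmod (\<omega> (T (z y))) \<le> sqrt (2 * V * \<eta>)"
        using \<rho> z1 by (simp add: lin clin_simps(3)[OF clin_F[OF \<omega>(1)]] norm_mult norm_divide)
      then show ?thesis using \<rho> z1 by (simp add: field_simps)
    qed
    have "cmod (\<psi> u) \<le> cmod (c y) * V + cmod (\<psi> (T (z y)))"
    proof -
      have "\<psi> u = c y * \<psi> (T w) + \<psi> (T (z y))"
        using Ty[of y] by (simp add: y clin_simps[OF clin_F[OF \<psi>(1)]])
      then have "cmod (\<psi> u) \<le> cmod (c y) * cmod (\<psi> (T w)) + cmod (\<psi> (T (z y)))"
        using norm_triangle_ineq[of "c y * \<psi> (T w)" "\<psi> (T (z y))"] by (simp add: norm_mult)
      moreover have "cmod (c y) * cmod (\<psi> (T w)) \<le> cmod (c y) * V"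
        using N_ge_F[OF \<psi>(1), of "T w"] NTw by (intro mult_left_mono) auto
      ultimately show ?thesis by linarith
    qed
    moreover have "cmod (c y) * (V - \<eta>) - cmod (\<xi> (T (z y))) \<le> cmod (\<xi> u)"
    proof -
      have "\<xi> u = c y * \<xi> (T w) + \<xi> (T (z y))"
        using Ty[of y] by (simp add: y clin_simps[OF clin_F[OF \<xi>(1)]])
      then have "cmod (c y) * cmod (\<xi> (T w)) - cmod (\<xi> (T (z y))) \<le> cmod (\<xi> u)"
        using norm_diff_ineq[of "c y * \<xi> (T w)" "\<xi> (T (z y))"] by (simp add: norm_mult)
      moreover have "cmod (c y) * (V - \<eta>) \<le> cmod (c y) * cmod (\<xi> (T w))"
        using \<xi>(2) by (intro mult_left_mono) auto
      ultimately show ?thesis by linarith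
    qed
    moreover have "cmod (c y) * \<eta> \<le> c1 * \<eta>" using cy \<eta> by simp
    moreover define Q where "Q = (z1 / \<rho>) * sqrt (2 * V * \<eta>)"
    ultimately have "1/10 \<le> c1 * \<eta> + 2 * Q"
      using kz[OF \<psi>, folded Q_def] kz[OF \<xi>, folded Q_def] u(2)
      unfolding right_diff_distrib by linarith
    then show ?thesis by (simp add: Q_def)
  qed
  obtain \<eta>0 where \<eta>0: "0 < \<eta>0" "\<eta>0 < V" "c1 * \<eta>0 + 2 * (z1 / \<rho>) * sqrt (2 * V * \<eta>0) < 1 / 10"
  proof -
    have "((\<lambda>\<eta>. c1 * \<eta> + 2 * (z1 / \<rho>) * sqrt (2 * V * \<eta>)) \<longlongrightarrow> c1 * 0 + 2 * (z1 / \<rho>) * sqrt (2 * V * 0)) (at_right 0)"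
      by (intro tendsto_intros)
    then have "\<forall>\<^sub>F \<eta> in at_right 0. c1 * \<eta> + 2 * (z1 / \<rho>) * sqrt (2 * V * \<eta>) < 1 / 10"
      by (rule order_tendstoD) simp
    moreover have "\<forall>\<^sub>F \<eta> in at_right 0. \<eta> < V" using V by (auto simp: eventually_at_right_field intro!: exI[of _ V])
    moreover have "\<forall>\<^sub>F \<eta> in at_right 0. (0::real) < \<eta>" by (simp add: eventually_at_right_less)
    ultimately have "\<forall>\<^sub>F \<eta> in at_right (0::real). 0 < \<eta> \<and> \<eta> < V \<and>
        c1 * \<eta> + 2 * (z1 / \<rho>) * sqrt (2 * V * \<eta>) < 1 / 10"
      by eventually_elim simp
    then obtain \<eta> where "0 < \<eta> \<and> \<eta> < V \<and> c1 * \<eta> + 2 * (z1 / \<rho>) * sqrt (2 * V * \<eta>) < 1 / 10"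
      using eventually_happens'[OF trivial_limit_at_right_real] by blast
    then show thesis using that by blast
  qed
  obtain \<psi> where \<psi>: "\<psi> \<in> F" "V - \<eta>0 < cmod (\<psi> (T w))" using attain[OF \<eta>0(1)] by blast
  \<comment> \<open>For every smaller error some member comes that close to \<open>V\<close>, and by
    \<open>gap\<close> it is always \<open>\<psi>\<close>.\<close>
  have "V \<le> cmod (\<psi> (T w))"
  proof (rule field_le_epsilon)
    fix e :: real assume "0 < e"
    then obtain \<xi> where \<xi>: "\<xi> \<in> F" "V - min e \<eta>0 < cmod (\<xi> (T w))" using attain[of "min e \<eta>0"] \<eta>0(1) by auto
    then have "V - \<eta>0 < cmod (\<xi> (T w))" by linarith
    then have "\<xi> = \<psi>" using gap[OF \<psi> \<xi>(1) _ _ \<eta>0(1,2)] \<eta>0(3) by force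
    then show "V \<le> cmod (\<psi> (T w)) + e"
      using \<xi>(2) min.cobounded1[of e \<eta>0] by auto
  qed
  then have \<psi>V: "cmod (\<psi> (T w)) = V" using N_ge_F[OF \<psi>(1), of "T w"] NTw by simp
  have "cmod (\<psi> (T y)) = cmod (\<phi> y)" for y
  proof -
    obtain s where s: "0 < s" "p (s *\<^sub>R z y) \<le> \<rho>" using small_multiple by blast
    \<comment> \<open>Now that \<open>\<psi>\<close> attains \<open>V\<close>, the bound of
      \<open>ker_small\<close> is zero.\<close>
    have "(cmod (\<psi> (T (s *\<^sub>R z y))))\<^sup>2 \<le> 0"
      using ker_small[OF \<psi>(1) _ s(2)] \<phi>z by (simp add: c\<phi> \<psi>V)
    then have "\<psi> (T (z y)) = 0" using s(1) by (simp add: lin clin_simps(3)[OF clin_F[OF \<psi>(1)]])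
    then have "\<psi> (T y) = c y * \<psi> (T w)"
      using Ty[of y] by (simp add: clin_simps[OF clin_F[OF \<psi>(1)]])
    then show ?thesis using V by (simp add: norm_mult \<psi>V c(1))
  qed
  then show ?thesis using \<psi>(1) by blast
qed

end

section \<open>A family that encodes a well-order\<close>

context complex_norm
begin

text \<open>Since \<open>k\<close> vanishes with \<open>\<phi>\<close>, it is determined by its
  values \<open>\<mu>\<close> and \<open>\<nu>\<close> at \<open>e\<close> and \<open>J e\<close>,
  where \<open>\<phi> e = 1\<close>. Both have modulus \<open>1\<close> and their sum has modulus
  \<open>sqrt 2\<close>, which leaves only \<open>\<nu> = \<i> * \<mu>\<close> and
  \<open>\<nu> = - \<i> * \<mu>\<close>.\<close>

lemma linear_modulus_eq:
  assumes k: "linear k" and \<phi>: "clin \<phi>" and eq: "\<And>y. cmod (k y) = cmod (\<phi> y)"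
  obtains \<mu> where "cmod \<mu> = 1" "(\<forall>y. k y = \<mu> * \<phi> y) \<or> (\<forall>y. k y = \<mu> * cnj (\<phi> y))"
proof (cases "\<forall>y. \<phi> y = 0")
  case True
  then have "k y = 0" for y using eq[of y] by simp
  then show thesis using that[of 1] True by simp
next
  case False
  then obtain e' where "\<phi> e' \<noteq> 0" by blast
  define e where "e = cscale (1 / \<phi> e') e'"
  have e: "\<phi> e = 1" using \<open>\<phi> e' \<noteq> 0\<close> \<phi> by (simp add: e_def clin_simps)
  define \<mu> where "\<mu> = k e"
  define \<nu> where "\<nu> = k (J e)"
  have \<mu>: "cmod \<mu> = 1" using eq[of e] e by (simp add: \<mu>_def)
  have \<nu>: "cmod \<nu> = 1" using eq[of "J e"] e \<phi> by (simp add: \<nu>_def clin_simps)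
  have "cmod (\<mu> + \<nu>) = cmod (1 + \<i>)"
    using eq[of "e + J e"] e \<phi> k by (simp add: \<mu>_def \<nu>_def clin_simps linear_add)
  then have s: "(cmod (\<mu> + \<nu>))\<^sup>2 = 2" by (simp add: cmod_power2)
  define q where "q = \<nu> / \<mu>"
  have "\<mu> \<noteq> 0" using \<mu> by auto
  then have qm: "\<nu> = q * \<mu>" by (simp add: q_def)
  have "(Re q)\<^sup>2 + (Im q)\<^sup>2 = 1" using \<mu> \<nu> by (simp add: q_def norm_divide cmod_power2[symmetric])
  moreover have "\<mu> + \<nu> = (1 + q) * \<mu>" by (simp add: qm algebra_simps)
  then have "cmod (1 + q) = cmod (\<mu> + \<nu>)" using \<mu> by (simp add: norm_mult)
  with s have "(cmod (1 + q))\<^sup>2 = 2" by (simp only:)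
  then have "(1 + Re q)\<^sup>2 + (Im q)\<^sup>2 = 2" by (simp add: cmod_power2)
  moreover have "(1 + Re q)\<^sup>2 = 1 + 2 * Re q + (Re q)\<^sup>2" by (simp add: power2_sum)
  ultimately have "Re q = 0" by linarith
  with \<open>(Re q)\<^sup>2 + (Im q)\<^sup>2 = 1\<close> have "(Im q)\<^sup>2 = 1" by simp
  with \<open>Re q = 0\<close> have q: "q = \<i> \<or> q = - \<i>" by (auto simp: complex_eq_iff power2_eq_1_iff)
  have ky: "k y = of_real (Re (\<phi> y)) * \<mu> + of_real (Im (\<phi> y)) * \<nu>" for y
  proof -
    have "\<phi> (y - cscale (\<phi> y) e) = 0" using \<phi> e by (simp add: clin_simps)
    then have "k (y - cscale (\<phi> y) e) = 0" using eq[of "y - cscale (\<phi> y) e"] by simp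
    then have "k y = k (cscale (\<phi> y) e)" using k by (simp add: linear_diff)
    then show ?thesis
      using k by (simp add: cscale_def linear_add linear_scale \<mu>_def \<nu>_def scaleR_conv_of_real)
  qed
  show thesis
  proof (rule that[OF \<mu>])
    from q show "(\<forall>y. k y = \<mu> * \<phi> y) \<or> (\<forall>y. k y = \<mu> * cnj (\<phi> y))"
    proof
      assume q: "q = \<i>"
      have "k y = \<mu> * \<phi> y" for y
      proof -
        have "k y = \<mu> * (of_real (Re (\<phi> y)) + \<i> * of_real (Im (\<phi> y)))"
          using ky[of y] q by (simp add: qm algebra_simps)
        then show ?thesis by (simp only: complex_eq[symmetric])
      qed
      then show ?thesis by blast
    next
      assume q: "q = - \<i>"
      have "k y = \<mu> * cnj (\<phi> y)" for y
      proof -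
        have "cnj (\<phi> y) = of_real (Re (\<phi> y)) - \<i> * of_real (Im (\<phi> y))" by (simp add: complex_eq_iff)
        moreover have "k y = \<mu> * (of_real (Re (\<phi> y)) - \<i> * of_real (Im (\<phi> y)))"
          using ky[of y] q by (simp add: qm algebra_simps)
        ultimately show ?thesis by simp
      qed
      then show ?thesis by blast
    qed
  qed
qed

end

text \<open>The coefficients sum to \<open>11/10 > 1\<close>, so a combination with them beats \<open>f s\<close> and \<open>f t\<close> at
  a suitable sum of \<open>x s\<close> and \<open>x t\<close>; each is at most \<open>8/10\<close>, so \<open>f s\<close> wins at \<open>x s\<close>.\<close>

definition coeff1 :: "nat \<Rightarrow> real" where
  "coeff1 j = (if j = 0 then 6/10 else if j = 1 then 7/10 else if j = 2 then 8/10 else 75/100)"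

definition coeff2 :: "nat \<Rightarrow> real" where
  "coeff2 j = 11/10 - coeff1 j"

lemma nat_less_4: "j < 4 \<longleftrightarrow> j = 0 \<or> j = 1 \<or> j = 2 \<or> j = (3::nat)"
  by auto

lemma coeff_bounds: "6/10 \<le> coeff1 j" "coeff1 j \<le> 8/10" "3/10 \<le> coeff2 j" "coeff2 j \<le> 5/10"
  "coeff1 j + coeff2 j = 11/10"
  by (auto simp: coeff1_def coeff2_def)

lemma coeff1_separated:
  assumes "j < 4" "i < 4" "\<bar>coeff1 i - coeff1 j\<bar> \<le> 2/100"
  shows "i = j"
  using assms by (auto simp: coeff1_def nat_less_4)

text \<open>The product is a fourth root of unity other than \<open>1\<close>.\<close>

lemma phase_separated:
  assumes "j < 4" "i < 4" "i \<noteq> j"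
  shows "Re (\<i> ^ i * cnj (\<i> ^ j)) \<le> 0"
  using assms unfolding nat_less_4 by (auto simp: power3_eq_cube)

text \<open>\<open>x\<close> and \<open>f\<close> form the biorthogonal system and \<open>g\<close>
  makes it total. \<open>g m\<close> is exempt in \<open>total\<close> because the least index
  \<open>m\<close> is never the second member of a pair; \<open>n\<close> guarantees a second
  coordinate.\<close>

locale linked_system = complex_norm J p K
  for J :: "'a::real_normed_vector \<Rightarrow> 'a" and p K +
  fixes A :: "'i set" and x :: "'i \<Rightarrow> 'a" and f g :: "'i \<Rightarrow> 'a \<Rightarrow> complex"
    and lt :: "'i \<Rightarrow> 'i \<Rightarrow> bool" and m n :: 'i and D :: real
  assumes p_x: "s \<in> A \<Longrightarrow> p (x s) = 1"
    and clin_f: "s \<in> A \<Longrightarrow> clin (f s)" and clin_g: "s \<in> A \<Longrightarrow> clin (g s)"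
    and f_x: "s \<in> A \<Longrightarrow> t \<in> A \<Longrightarrow> f s (x t) = (if s = t then 1 else 0)"
    and f_le: "s \<in> A \<Longrightarrow> cmod (f s y) \<le> D * p y" and g_le: "s \<in> A \<Longrightarrow> cmod (g s y) \<le> p y"
    and total: "(\<And>s. s \<in> A \<Longrightarrow> f s y = 0) \<Longrightarrow> (\<And>s. s \<in> A \<Longrightarrow> s \<noteq> m \<Longrightarrow> g s y = 0) \<Longrightarrow> y = 0"
    and m: "m \<in> A" and n: "n \<in> A" "n \<noteq> m"
    and wf_lt: "wf {(s, t). lt s t}" and lt_total: "s \<in> A \<Longrightarrow> t \<in> A \<Longrightarrow> s \<noteq> t \<Longrightarrow> lt s t \<or> lt t s"
    and m_least: "s \<in> A \<Longrightarrow> s \<noteq> m \<Longrightarrow> lt m s"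
begin

lemma lt_asym: "lt s t \<Longrightarrow> \<not> lt t s"
  using wf_asym[OF wf_lt] by auto

lemma lt_irrefl: "\<not> lt s s"
  using lt_asym by blast

definition E :: real where
  "E = 1 + 2 * D"

lemma E_ge: "3 \<le> E" "D \<le> E" "1 \<le> D"
proof -
  show "1 \<le> D" using f_le[OF m, of "x m"] f_x[OF m m] p_x[OF m] by simp
  then show "3 \<le> E" "D \<le> E" by (auto simp: E_def)
qed

text \<open>On the unit ball of \<open>N\<close>, where \<open>p\<close> is at most
  \<open>4 * E\<close>, the perturbation is at most \<open>1/100\<close>. \<open>P 0\<close> and
  \<open>P 1\<close> stay pure combinations of two coordinates.\<close>

definition eps :: "nat \<Rightarrow> real" where
  "eps j = (if j < 2 then 0 else 1 / (400 * E\<^sup>2))"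

text \<open>Subtracting the two coordinates makes \<open>G s t\<close> vanish at \<open>x s\<close> and \<open>x t\<close>, so that the
  perturbation leaves the values of \<open>P j s t\<close> there exact.\<close>

definition G :: "'i \<Rightarrow> 'i \<Rightarrow> 'a \<Rightarrow> complex" where
  "G s t y = g t y - g t (x s) * f s y - g t (x t) * f t y"

text \<open>The factor \<open>\<i> ^ j\<close> separates the four combinations on the same pair by
  phase, so that each has its own peak.\<close>

definition P :: "nat \<Rightarrow> 'i \<Rightarrow> 'i \<Rightarrow> 'a \<Rightarrow> complex" where
  "P j s t y = of_real (coeff1 j) * f s y + of_real (coeff2 j) * \<i> ^ j * f t y + of_real (eps j) * G s t y"

definition F :: "('a \<Rightarrow> complex) set" where
  "F = f ` A \<union> {P j s t | j s t. j < 4 \<and> s \<in> A \<and> t \<in> A \<and> lt s t}"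

lemma clin_G: "s \<in> A \<Longrightarrow> t \<in> A \<Longrightarrow> clin (G s t)"
proof -
  assume "s \<in> A" "t \<in> A"
  then have "clin (\<lambda>y. 1 * (1 * g t y + (- g t (x s)) * f s y) + (- g t (x t)) * f t y)"
    by (intro clin_comb clin_f clin_g)
  then show ?thesis unfolding G_def by simp
qed

lemma G_x: "s \<in> A \<Longrightarrow> t \<in> A \<Longrightarrow> s \<noteq> t \<Longrightarrow> G s t (x s) = 0 \<and> G s t (x t) = 0"
  by (simp add: G_def f_x)

lemma G_le: "cmod (G s t y) \<le> E * p y" if "s \<in> A" "t \<in> A"
proof -
  have "cmod (g t (x s) * f s y) \<le> 1 * (D * p y)" "cmod (g t (x t) * f t y) \<le> 1 * (D * p y)"
    unfolding norm_mult using g_le[OF that(2), of "x s"] g_le[OF that(2), of "x t"] f_le that p_x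
    by (intro mult_mono; simp)+
  then show ?thesis
    using norm_triangle_ineq4[of "g t y - g t (x s) * f s y" "g t (x t) * f t y"]
      norm_triangle_ineq4[of "g t y" "g t (x s) * f s y"] g_le[OF that(2), of y]
    by (simp add: G_def E_def algebra_simps)
qed

lemma eps_G_le: "cmod (of_real (eps j) * G s t y) \<le> 1/100" if "s \<in> A" "t \<in> A" "p y \<le> 4 * E"
proof -
  have "cmod (G s t y) \<le> E * (4 * E)"
    using G_le[OF that(1,2), of y] mult_left_mono[OF that(3), of E] E_ge by linarith
  moreover have "\<bar>eps j\<bar> \<le> 1 / (400 * E\<^sup>2)" by (simp add: eps_def)
  ultimately have "\<bar>eps j\<bar> * cmod (G s t y) \<le> 1 / (400 * E\<^sup>2) * (E * (4 * E))"
    by (intro mult_mono) auto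
  also have "\<dots> = 1/100" using E_ge by (simp add: power2_eq_square)
  finally show ?thesis by (simp add: norm_mult)
qed

lemma clin_P: "s \<in> A \<Longrightarrow> t \<in> A \<Longrightarrow> clin (P j s t)"
proof -
  assume st: "s \<in> A" "t \<in> A"
  have "clin (\<lambda>y. 1 * (of_real (coeff1 j) * f s y + (of_real (coeff2 j) * \<i> ^ j) * f t y) + of_real (eps j) * G s t y)"
    by (intro clin_comb clin_f clin_G st)
  then show ?thesis unfolding P_def by simp
qed

lemma P_le: "cmod (P j s t y - of_real (eps j) * G s t y) \<le> coeff1 j * cmod (f s y) + coeff2 j * cmod (f t y)"
  using norm_triangle_ineq[of "of_real (coeff1 j) * f s y" "of_real (coeff2 j) * \<i> ^ j * f t y"] coeff_bounds[of j]
  by (simp add: P_def norm_mult norm_power)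

lemma P_x:
  assumes "s \<in> A" "t \<in> A" "s \<noteq> t"
  shows "P j s t (x s) = of_real (coeff1 j)" "P j s t (x t) = of_real (coeff2 j) * \<i> ^ j"
  using assms G_x by (simp_all add: P_def f_x)

lemma P_x_other:
  assumes "s \<in> A" "t \<in> A" "u \<in> A" "u \<noteq> s" "u \<noteq> t"
  shows "cmod (P j s t (x u)) \<le> 1/100"
  using eps_G_le[OF assms(1,2), of "x u" j] assms E_ge p_x[of u] by (simp add: P_def f_x)

lemma P_x_le: "cmod (P j s t (x u)) \<le> 8/10" if "s \<in> A" "t \<in> A" "u \<in> A" "s \<noteq> t"
proof -
  consider "u = s" | "u = t" | "u \<noteq> s" "u \<noteq> t" by blast
  then show ?thesis
  proof cases
    case 3
    then show ?thesis using P_x_other[of s t u j] that by linarith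
  qed (use that coeff_bounds[of j] in \<open>auto simp: P_x norm_mult norm_power\<close>)
qed

lemma F_cases:
  assumes "\<phi> \<in> F"
  obtains s where "s \<in> A" "\<phi> = f s" | j s t where "j < 4" "s \<in> A" "t \<in> A" "lt s t" "s \<noteq> t" "\<phi> = P j s t"
  using assms lt_irrefl unfolding F_def by blast

lemma F_at_x: "\<phi> \<in> F \<Longrightarrow> s \<in> A \<Longrightarrow> \<phi> \<noteq> f s \<Longrightarrow> cmod (\<phi> (x s)) \<le> 8/10"
proof (erule F_cases)
  fix t assume "s \<in> A" "\<phi> \<noteq> f s" "t \<in> A" "\<phi> = f t"
  then show ?thesis by (auto simp: f_x)
next
  fix j a b assume "s \<in> A" "a \<in> A" "b \<in> A" "a \<noteq> b" "\<phi> = P j a b"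
  then show ?thesis using P_x_le by blast
qed

lemma F_bound: "\<phi> \<in> F \<Longrightarrow> cmod (\<phi> y) \<le> 2 * E * p y"
proof (erule F_cases)
  fix s assume s: "s \<in> A" "\<phi> = f s"
  have "D * p y \<le> 2 * E * p y" using E_ge by (intro mult_right_mono) auto
  then show ?thesis using f_le[OF s(1), of y] s(2) by simp
next
  fix j s t assume *: "j < (4::nat)" "s \<in> A" "t \<in> A" "\<phi> = P j s t"
  have "coeff1 j * cmod (f s y) \<le> coeff1 j * (D * p y)" "coeff2 j * cmod (f t y) \<le> coeff2 j * (D * p y)"
    using f_le * coeff_bounds[of j] by (auto intro!: mult_left_mono)
  moreover have "\<bar>eps j\<bar> * cmod (G s t y) \<le> (1/100) * (E * p y)"
  proof (intro mult_mono)
    have "100 \<le> 400 * E\<^sup>2" using power_mono[OF E_ge(1), of 2] by simp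
    then show "\<bar>eps j\<bar> \<le> 1/100" using E_ge by (simp add: eps_def field_simps)
  qed (use G_le * in auto)
  moreover have "coeff1 j * (D * p y) + coeff2 j * (D * p y) = 11/10 * (D * p y)"
    using coeff_bounds(5)[of j] by (metis distrib_right)
  moreover have "D * p y \<le> 1/2 * (E * p y)"
    by (simp add: E_def algebra_simps)
  moreover have "0 \<le> E * p y" using E_ge by simp
  moreover have "cmod (P j s t y) \<le> cmod (P j s t y - of_real (eps j) * G s t y) + \<bar>eps j\<bar> * cmod (G s t y)"
    using norm_triangle_ineq[of "P j s t y - of_real (eps j) * G s t y" "of_real (eps j) * G s t y"]
    by (simp add: norm_mult)
  ultimately have "cmod (P j s t y) \<le> 2 * (E * p y)"
    using P_le[of j s t y] by linarith
  then show ?thesis using * by simp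
qed

text \<open>The factor \<open>1 / (4 * E)\<close> keeps \<open>B\<close> well below the values of
  the family members at their peaks, which are at least \<open>1\<close>.\<close>

lemma B_bound:
  assumes "p w \<le> 2"
  shows "1 / (4 * E) * norm (p w, f m w, f n w) \<le> 1/2"
proof -
  have "norm (p w, f m w, f n w) \<le> norm (p w) + (cmod (f m w) + cmod (f n w))"
    using norm_Pair_le[of "p w" "(f m w, f n w)"] norm_Pair_le[of "f m w" "f n w"] by linarith
  also have "\<dots> \<le> E * p w"
    using f_le[OF m, of w] f_le[OF n(1), of w] by (simp add: E_def algebra_simps)
  also have "\<dots> \<le> E * 2" using assms E_ge by (intro mult_left_mono) auto
  finally show ?thesis using E_ge by (simp add: field_simps)
qed

text \<open>\<open>w\<close> aligns the two phases, so the coefficients add up. A competitor on the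
  same pair has phases at least a right angle apart, so its squared modulus is at most
  \<open>0.64 + 0.25\<close>. Any other combination exceeds \<open>1/100\<close> at no more than one
  of \<open>x s\<close> and \<open>x t\<close>, the reversed pair being excluded by
  asymmetry.\<close>

lemma P_peak:
  assumes st: "j < 4" "s \<in> A" "t \<in> A" "lt s t"
  defines "w \<equiv> x s + cscale (cnj (\<i> ^ j)) (x t)"
  shows "p w \<le> 2" "cmod (P j s t w) = 11/10" "\<And>\<psi>. \<psi> \<in> F \<Longrightarrow> \<psi> \<noteq> P j s t \<Longrightarrow> cmod (\<psi> w) \<le> 1"
proof -
  have ne: "s \<noteq> t" using st lt_irrefl by blast
  show "p w \<le> 2"
    using p_add[of "x s" "cscale (cnj (\<i> ^ j)) (x t)"] st by (simp add: w_def p_x norm_power)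
  have ev: "\<psi> w = \<psi> (x s) + cnj (\<i> ^ j) * \<psi> (x t)" if "clin \<psi>" for \<psi>
    using that by (simp add: w_def clin_simps)
  have unit: "(- \<i>) ^ j * \<i> ^ j = 1" "\<i> ^ j * (- \<i>) ^ j = 1"
    by (simp_all flip: power_mult_distrib)
  have "P j s t w = of_real (coeff1 j) + of_real (coeff2 j) * (cnj (\<i> ^ j) * \<i> ^ j)"
    using st ne by (simp add: ev clin_P P_x)
  then have "P j s t w = of_real (coeff1 j + coeff2 j)" by (simp add: unit)
  then show "cmod (P j s t w) = 11/10" by (simp only: coeff_bounds(5)) simp
  fix \<psi> assume "\<psi> \<in> F" "\<psi> \<noteq> P j s t"
  from this(1) show "cmod (\<psi> w) \<le> 1"
  proof (cases rule: F_cases)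
    case (1 u)
    then show ?thesis using st ne by (simp add: ev clin_f f_x norm_power)
  next
    case (2 i a b)
    have le: "cmod (\<psi> w) \<le> cmod (\<psi> (x s)) + cmod (\<psi> (x t))"
      using norm_triangle_ineq[of "\<psi> (x s)" "cnj (\<i> ^ j) * \<psi> (x t)"] 2
      by (simp add: ev clin_P norm_mult norm_power)
    show ?thesis
    proof (cases "a = s \<and> b = t")
      case True
      then have ij: "i \<noteq> j" using 2 \<open>\<psi> \<noteq> P j s t\<close> by blast
      define z where "z = \<i> ^ i * cnj (\<i> ^ j)"
      have z: "Re z \<le> 0" "cmod z = 1"
        using phase_separated[OF st(1) 2(1) ij] by (simp_all add: z_def norm_mult norm_power)
      have "\<psi> w = of_real (coeff1 i) + of_real (coeff2 i) * z"
        using 2 True ne by (simp add: ev clin_P P_x z_def)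
      then have "(cmod (\<psi> w))\<^sup>2 = (coeff1 i + coeff2 i * Re z)\<^sup>2 + (coeff2 i * Im z)\<^sup>2"
        by (simp add: cmod_power2)
      also have "\<dots> = (coeff1 i)\<^sup>2 + 2 * (coeff1 i * coeff2 i * Re z) + (coeff2 i)\<^sup>2 * (cmod z)\<^sup>2"
        unfolding cmod_power2 by (simp add: power2_eq_square algebra_simps)
      also have "\<dots> \<le> (coeff1 i)\<^sup>2 + (coeff2 i)\<^sup>2"
        using z coeff_bounds[of i] by (simp add: mult_nonneg_nonpos)
      also have "\<dots> \<le> (8/10)\<^sup>2 + (5/10)\<^sup>2"
        using coeff_bounds[of i] by (intro add_mono power_mono) auto
      also have "\<dots> \<le> 1\<^sup>2" by (simp add: power2_eq_square)
      finally show ?thesis by (rule power2_le_imp_le) simp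
    next
      case False
      have "\<not> (a = t \<and> b = s)" using 2 st lt_asym by blast
      then have "(s \<noteq> a \<and> s \<noteq> b) \<or> (t \<noteq> a \<and> t \<noteq> b)" using False ne 2 by blast
      then have "cmod (\<psi> (x s)) \<le> 1/100 \<or> cmod (\<psi> (x t)) \<le> 1/100"
        using P_x_other[of a b s i] P_x_other[of a b t i] 2 st by auto
      then show ?thesis using le P_x_le[of a b s i] P_x_le[of a b t i] 2 st by auto
    qed
  qed
qed

end

text \<open>The peak of \<open>f s\<close> is \<open>x s\<close>, where all other members are at
  most \<open>8/10\<close>; a combination peaks at the aligned sum, with \<open>11/10\<close>
  against \<open>1\<close>.\<close>

sublocale linked_system \<subseteq> peaked_family J p K F "f m" "f n" "x m" "x n" "1 / (4 * E)" "2 * E"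
proof
  show "clin \<phi>" if "\<phi> \<in> F" for \<phi> using that by (rule F_cases) (auto simp: clin_f clin_P)
  show "cmod (\<phi> y) \<le> 2 * E * p y" if "\<phi> \<in> F" for \<phi> y using F_bound[OF that] .
  show "F \<noteq> {}" using m by (auto simp: F_def)
  show "0 < 1 / (4 * E)" using E_ge by simp
  show "clin (f m)" "clin (f n)" using clin_f m n by auto
  have "f s \<in> F" if "s \<in> A" for s using that by (auto simp: F_def)
  then show "cmod (f m y) \<le> 2 * E * p y" "cmod (f n y) \<le> 2 * E * p y" for y
    using F_bound m n by blast+
  show "f m (x m) = 1" "f n (x m) = 0" "f m (x n) = 0" "f n (x n) = 1" using m n by (auto simp: f_x)
  fix \<phi> assume "\<phi> \<in> F"
  then show "\<exists>w. p w \<le> 2 \<and> 1 / (4 * E) * norm (p w, f m w, f n w) \<le> cmod (\<phi> w) - 1 / 10 \<and>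
      (\<forall>\<psi>\<in>F - {\<phi>}. cmod (\<psi> w) \<le> cmod (\<phi> w) - 1 / 10)"
  proof (cases rule: F_cases)
    case (1 s)
    then show ?thesis
      using B_bound[of "x s"] F_at_x[of _ s] by (intro exI[of _ "x s"]) (force simp: p_x f_x)
  next
    case (2 j s t)
    note pk = P_peak[OF 2(1-4)]
    show ?thesis
      using pk(1) B_bound[OF pk(1)] pk(3) unfolding 2(6)
      by (intro exI[of _ "x s + cscale (cnj (\<i> ^ j)) (x t)"]) (simp only: pk(2), auto)
  qed
qed

section \<open>Rigidity\<close>

context linked_system
begin

definition isometric :: "('a \<Rightarrow> 'a) \<Rightarrow> bool" where
  "isometric T \<longleftrightarrow> linear T \<and> surj T \<and> (\<forall>y. N (T y) = N y)"

lemma iso_inverse: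
  assumes "isometric T"
  obtains S where "isometric S" "\<And>y. S (T y) = y" "\<And>y. T (S y) = y"
proof -
  have T: "linear T" "surj T" "\<And>y. N (T y) = N y" using assms by (auto simp: isometric_def)
  have "inj T"
  proof (rule injI)
    fix y z assume "T y = T z"
    then have "N (y - z) = N 0" using T(3)[of "y - z"] T(1) N_eq_0[of 0] by (simp add: linear_diff)
    then show "y = z" using N_eq_0[of "y - z"] N_eq_0[of 0] by simp
  qed
  define S where "S = inv_into UNIV T"
  have TS: "T (S y) = y" for y using T(2) by (simp add: S_def surj_f_inv_f)
  have ST: "S (T y) = y" for y using \<open>inj T\<close> by (simp add: S_def)
  have "linear S"
  proof (rule linearI)
    show "S (y + z) = S y + S z" for y z
      using ST[of "S y + S z"] T(1) by (simp add: linear_add TS)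
    show "S (c *\<^sub>R y) = c *\<^sub>R S y" for c y
      using ST[of "c *\<^sub>R S y"] T(1) by (simp add: linear_scale TS)
  qed
  moreover have "surj S" using ST by (metis surjI)
  moreover have "N (S y) = N y" for y using T(3)[of "S y"] TS by simp
  ultimately have "isometric S" by (simp add: isometric_def)
  then show thesis using that ST TS by blast
qed

lemma iso_image: "isometric T \<Longrightarrow> \<phi> \<in> F \<Longrightarrow> \<exists>\<psi>\<in>F. \<forall>y. cmod (\<psi> (T y)) = cmod (\<phi> y)"
  using isometry_permutes_family[of T \<phi>] by (simp add: isometric_def)

lemma iso_preimage:
  assumes "isometric T" "\<phi> \<in> F"
  shows "\<exists>\<psi>\<in>F. \<forall>y. cmod (\<phi> (T y)) = cmod (\<psi> y)"
proof -
  obtain S where S: "isometric S" "\<And>y. S (T y) = y" "\<And>y. T (S y) = y" using iso_inverse[OF assms(1)] by metis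
  obtain \<psi> where "\<psi> \<in> F" "\<And>y. cmod (\<psi> (S y)) = cmod (\<phi> y)" using iso_image[OF S(1) assms(2)] by blast
  then show ?thesis using S(2) by metis
qed

lemma f_F: "s \<in> A \<Longrightarrow> f s \<in> F"
  by (auto simp: F_def)

lemma P_F: "j < 4 \<Longrightarrow> s \<in> A \<Longrightarrow> t \<in> A \<Longrightarrow> lt s t \<Longrightarrow> P j s t \<in> F"
  by (auto simp: F_def)

lemma p_le_of_N: "N y \<le> 1 \<Longrightarrow> p y \<le> 4 * E"
proof -
  assume "N y \<le> 1"
  moreover have "p y \<le> 4 * E * N y" using N_ge[of y] E_ge by (simp add: field_simps)
  ultimately show ?thesis using mult_left_mono[of "N y" 1 "4 * E"] E_ge by linarith
qed

lemma N_x_le: "s \<in> A \<Longrightarrow> N (x s) \<le> 1"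
proof (rule N_leI)
  assume s: "s \<in> A"
  show "B (x s) \<le> 1" using B_bound[of "x s"] p_x[OF s] by (simp add: B_def)
  show "cmod (\<phi> (x s)) \<le> 1" if "\<phi> \<in> F" for \<phi>
    using F_at_x[OF that s] f_x[OF s s] by (cases "\<phi> = f s") auto
qed

lemma P_approx:
  assumes "s \<in> A" "t \<in> A" "p y \<le> 4 * E"
  shows "cmod (P j s t y - (of_real (coeff1 j) * f s y + of_real (coeff2 j) * \<i> ^ j * f t y)) \<le> 1/100"
  using eps_G_le[OF assms, of j] by (simp add: P_def)

text \<open>Where \<open>P j a b\<close> has modulus \<open>1\<close> on the unit ball, \<open>f a\<close> or \<open>f b\<close> exceeds \<open>9/10\<close>, while
  \<open>x s\<close> is a point at which \<open>f s\<close> is \<open>1\<close> and all other members of \<open>F\<close> are at most \<open>8/10\<close>.\<close>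

lemma iso_coordinate:
  assumes T: "isometric T" and s: "s \<in> A"
  shows "\<exists>u\<in>A. \<forall>y. cmod (f s (T y)) = cmod (f u y)"
proof -
  obtain \<psi> where \<psi>: "\<psi> \<in> F" "\<And>y. cmod (f s (T y)) = cmod (\<psi> y)"
    using iso_preimage[OF T f_F[OF s]] by blast
  from \<psi>(1) show ?thesis
  proof (cases rule: F_cases)
    case (1 u)
    then show ?thesis using \<psi>(2) by auto
  next
    case (2 j a b)
    obtain S where S: "isometric S" "\<And>y. T (S y) = y" using iso_inverse[OF T] by metis
    define y where "y = S (x s)"
    have Ty: "T y = x s" by (simp add: y_def S)
    have "N y \<le> 1" using S(1) N_x_le[OF s] by (simp add: isometric_def y_def)
    then have py: "p y \<le> 4 * E" by (rule p_le_of_N)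
    have "cmod (P j a b y) = 1" using \<psi>(2)[of y] s by (simp add: Ty 2 f_x)
    moreover have "cmod (P j a b y) \<le> cmod (P j a b y - of_real (eps j) * G a b y) + cmod (of_real (eps j) * G a b y)"
      using norm_triangle_ineq[of "P j a b y - of_real (eps j) * G a b y" "of_real (eps j) * G a b y"] by simp
    ultimately have ge: "99/100 \<le> coeff1 j * cmod (f a y) + coeff2 j * cmod (f b y)"
      using P_le[of j a b y] eps_G_le[OF 2(2,3) py, of j] by linarith
    have "9/10 \<le> cmod (f a y) \<or> 9/10 \<le> cmod (f b y)"
    proof (rule ccontr)
      assume "\<not> ?thesis"
      then have "coeff1 j * cmod (f a y) < coeff1 j * (9/10)" "coeff2 j * cmod (f b y) < coeff2 j * (9/10)"
        using coeff_bounds[of j] by (auto intro!: mult_strict_left_mono)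
      then show False using ge coeff_bounds(5)[of j] by linarith
    qed
    \<comment> \<open>\<open>c\<close> is an index at which the coordinate of \<open>y\<close> is
      large, \<open>d\<close> the other one.\<close>
    then obtain c d where cd: "c \<in> A" "d \<in> A" "c \<noteq> d" "{c, d} = {a, b}" "9/10 \<le> cmod (f c y)"
      using 2 by (metis insert_commute)
    obtain \<xi> where \<xi>: "\<xi> \<in> F" "\<And>z. cmod (\<xi> (T z)) = cmod (f c z)"
      using iso_image[OF T f_F[OF cd(1)]] by blast
    \<comment> \<open>Only \<open>f s\<close> can reach \<open>9/10\<close> at \<open>x s\<close>.
      Then \<open>P j a b\<close> and \<open>f c\<close> agree in modulus, which fails at
      \<open>x d\<close>.\<close>
    have "\<xi> = f s" using F_at_x[OF \<xi>(1) s] \<xi>(2)[of y] cd(5) by (force simp: Ty)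
    then have "cmod (P j a b (x d)) = cmod (f c (x d))" using \<xi>(2) \<psi>(2) 2 by metis
    moreover have "P j a b (x d) \<noteq> 0"
      using cd(4) P_x[OF 2(2,3,5), of j] coeff_bounds[of j] by (auto simp: doubleton_eq_iff)
    ultimately show ?thesis using cd by (simp add: f_x)
  qed
qed

section \<open>Isometries respect the well-order\<close>

lemma iso_order:
  assumes T: "isometric T" and st: "s \<in> A" "t \<in> A" "lt s t" and uv: "u \<in> A" "v \<in> A"
    and u: "\<And>y. cmod (f s (T y)) = cmod (f u y)" and v: "\<And>y. cmod (f t (T y)) = cmod (f v y)"
  shows "lt u v"
proof -
  have "s \<noteq> t" using st lt_irrefl by blast
  have "u \<noteq> v"
  proof
    assume "u = v"
    obtain y where "x s = T y" using T unfolding isometric_def by (metis surjD)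
    then have "cmod (f s (x s)) = cmod (f t (x s))" using u[of y] v[of y] \<open>u = v\<close> by simp
    then show False using \<open>s \<noteq> t\<close> st by (simp add: f_x)
  qed
  obtain \<psi> where \<psi>: "\<psi> \<in> F" "\<And>y. cmod (P 0 s t (T y)) = cmod (\<psi> y)"
    using iso_preimage[OF T P_F[OF _ st]] by force
  have P0: "P 0 s t y = of_real (6/10) * f s y + of_real (5/10) * f t y" for y
    by (simp add: P_def coeff1_def coeff2_def eps_def)
  have "f t (T (x u)) = 0" "f s (T (x v)) = 0" "cmod (f s (T (x u))) = 1" "cmod (f t (T (x v))) = 1"
    using u[of "x u"] v[of "x u"] u[of "x v"] v[of "x v"] uv \<open>u \<noteq> v\<close> by (auto simp: f_x)
  \<comment> \<open>No coordinate takes these values, so \<open>\<psi>\<close> is a combination on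
    \<open>u\<close> and \<open>v\<close>. First coefficients are at least \<open>6/10\<close> and
    second ones at most \<open>5/10\<close>, which fixes the order.\<close>
  then have val: "cmod (\<psi> (x u)) = 6/10" "cmod (\<psi> (x v)) = 5/10"
    unfolding \<psi>(2)[symmetric] P0 by (simp_all add: norm_mult)
  from \<psi>(1) show ?thesis
  proof (cases rule: F_cases)
    case (1 c)
    then show ?thesis using val(1) uv by (auto simp: f_x split: if_splits)
  next
    case (2 j a b)
    have "u = a \<or> u = b" "v = a \<or> v = b"
      using P_x_other[OF 2(2,3) uv(1), of j] P_x_other[OF 2(2,3) uv(2), of j] val 2(6) by auto
    moreover have "u \<noteq> b"
      using val(1) P_x(2)[OF 2(2,3,5), of j] coeff_bounds[of j] 2(6) by (auto simp: norm_mult norm_power)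
    ultimately show ?thesis using 2(4) \<open>u \<noteq> v\<close> by blast
  qed
qed

text \<open>Infinite descent: if \<open>s\<close> went to a smaller \<open>u\<close>, then by
  preservation of the order \<open>u\<close> would go to something smaller still.\<close>

lemma iso_not_decreasing:
  assumes "isometric T" "s \<in> A" "u \<in> A" "\<And>y. cmod (f s (T y)) = cmod (f u y)"
  shows "\<not> lt u s"
  using assms(2-4)
proof (induction s arbitrary: u rule: wf_induct_rule[OF wf_lt])
  case (1 s)
  show ?case
  proof
    assume us: "lt u s"
    obtain u' where u': "u' \<in> A" "\<And>y. cmod (f u (T y)) = cmod (f u' y)"
      using iso_coordinate[OF assms(1) 1(3)] by blast
    have "lt u' u" using iso_order[OF assms(1) 1(3,2) us u'(1) 1(3) u'(2) 1(4)] .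
    moreover have "\<not> lt u' u" using 1(1)[of u u'] us 1(3) u' by simp
    ultimately show False by simp
  qed
qed

lemma iso_fixes_coordinate:
  assumes T: "isometric T" and s: "s \<in> A"
  shows "cmod (f s (T y)) = cmod (f s y)"
proof -
  obtain u where u: "u \<in> A" "\<And>y. cmod (f s (T y)) = cmod (f u y)" using iso_coordinate[OF T s] by blast
  obtain S where S: "isometric S" "\<And>y. T (S y) = y" using iso_inverse[OF T] by metis
  have "cmod (f u (S y)) = cmod (f s y)" for y using u(2)[of "S y"] S(2) by simp
  then have "\<not> lt s u" using iso_not_decreasing[OF S(1) u(1) s] by blast
  moreover have "\<not> lt u s" using iso_not_decreasing[OF T s u] .
  ultimately have "u = s" using lt_total[OF s u(1)] by blast
  then show ?thesis using u(2) by simp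
qed

text \<open>The moduli at \<open>x s\<close> and \<open>x t\<close> are known up to
  \<open>1/100\<close>. This identifies the ordered pair, and then \<open>j\<close>, because the
  values of \<open>coeff1\<close> differ by more than \<open>2/100\<close>.\<close>

lemma iso_fixes_P:
  assumes T: "isometric T" and st: "j < 4" "s \<in> A" "t \<in> A" "lt s t"
  shows "cmod (P j s t (T y)) = cmod (P j s t y)"
proof -
  have "s \<noteq> t" using st lt_irrefl by blast
  obtain \<psi> where \<psi>: "\<psi> \<in> F" "\<And>y. cmod (P j s t (T y)) = cmod (\<psi> y)"
    using iso_preimage[OF T P_F[OF st]] by blast
  have small: "p (T (x u)) \<le> 4 * E" if "u \<in> A" for u
    using N_x_le[OF that] T by (intro p_le_of_N) (simp add: isometric_def)
  have near: "\<bar>cmod (\<psi> (x u)) - c\<bar> \<le> 1/100"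
    if "u \<in> A" "cmod (of_real (coeff1 j) * f s (T (x u)) + of_real (coeff2 j) * \<i> ^ j * f t (T (x u))) = c" for u c
    using P_approx[OF st(2,3) small[OF that(1)], of j] that(2) norm_triangle_ineq3 unfolding \<psi>(2)[symmetric]
    by (metis order_trans)
  have "f t (T (x s)) = 0" "f s (T (x t)) = 0" "cmod (f s (T (x s))) = 1" "cmod (f t (T (x t))) = 1"
    using iso_fixes_coordinate[OF T st(2), of "x s"] iso_fixes_coordinate[OF T st(2), of "x t"]
      iso_fixes_coordinate[OF T st(3), of "x s"] iso_fixes_coordinate[OF T st(3), of "x t"] st \<open>s \<noteq> t\<close>
    by (auto simp: f_x)
  then have val: "\<bar>cmod (\<psi> (x s)) - coeff1 j\<bar> \<le> 1/100" "\<bar>cmod (\<psi> (x t)) - coeff2 j\<bar> \<le> 1/100"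
    using coeff_bounds[of j]
    by (auto intro!: near[OF st(2)] near[OF st(3)] simp only: norm_mult norm_power) (simp_all add: norm_mult norm_power)
  from \<psi>(1) show ?thesis
  proof (cases rule: F_cases)
    case (1 c)
    then have "cmod (\<psi> (x s)) = 0 \<or> cmod (\<psi> (x s)) = 1" using st by (simp add: f_x)
    then show ?thesis using val(1) coeff_bounds[of j] by auto
  next
    case (2 i a b)
    have "1/100 < cmod (P i a b (x s))" "1/100 < cmod (P i a b (x t))"
      using val coeff_bounds[of j] unfolding 2(6) by linarith+
    then have "s = a \<or> s = b" "t = a \<or> t = b"
      using P_x_other[OF 2(2,3) st(2), of i] P_x_other[OF 2(2,3) st(3), of i] by linarith+
    then have ab: "s = a" "t = b" using 2(4) st(4) lt_asym \<open>s \<noteq> t\<close> by blast+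
    have "\<bar>coeff1 i - coeff1 j\<bar> \<le> 2/100"
      using val(1) P_x(1)[OF 2(2,3,5), of i] coeff_bounds[of i] by (simp add: 2(6) ab)
    then have "i = j" using coeff1_separated[OF st(1) 2(1)] by simp
    then show ?thesis using \<psi>(2) 2(6) ab by simp
  qed
qed

section \<open>Phases and multipliers\<close>

lemma iso_linear_or_antilinear:
  assumes "isometric T" "clin \<phi>" "\<And>y. cmod (\<phi> (T y)) = cmod (\<phi> y)"
  obtains \<mu> where "cmod \<mu> = 1" "(\<forall>y. \<phi> (T y) = \<mu> * \<phi> y) \<or> (\<forall>y. \<phi> (T y) = \<mu> * cnj (\<phi> y))"
proof -
  have "linear (\<lambda>y. \<phi> (T y))"
    using assms(1,2) by (auto simp: isometric_def clin_def intro: linear_compose[unfolded o_def])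
  then show thesis using linear_modulus_eq[OF _ assms(2,3)] that by blast
qed

text \<open>\<open>P 0\<close> makes the phases of \<open>f s\<close> and \<open>f t\<close> agree, the imaginary coefficient of \<open>P 1\<close> excludes
  antilinearity.\<close>

lemma iso_coordinates:
  assumes T: "isometric T" and st: "s \<in> A" "t \<in> A" "lt s t"
  obtains \<mu> where "cmod \<mu> = 1" "\<And>y. f s (T y) = \<mu> * f s y" "\<And>y. f t (T y) = \<mu> * f t y"
proof -
  have ne: "s \<noteq> t" using st lt_irrefl by blast
  obtain \<mu> where \<mu>: "cmod \<mu> = 1" "(\<forall>y. f s (T y) = \<mu> * f s y) \<or> (\<forall>y. f s (T y) = \<mu> * cnj (f s y))"
    by (rule iso_linear_or_antilinear[OF T clin_f[OF st(1)] iso_fixes_coordinate[OF T st(1)]])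
  obtain \<nu> where \<nu>: "cmod \<nu> = 1" "(\<forall>y. f t (T y) = \<nu> * f t y) \<or> (\<forall>y. f t (T y) = \<nu> * cnj (f t y))"
    by (rule iso_linear_or_antilinear[OF T clin_f[OF st(2)] iso_fixes_coordinate[OF T st(2)]])
  have fx: "f s (T (x s)) = \<mu>" "f s (T (x t)) = 0" "f t (T (x s)) = 0" "f t (T (x t)) = \<nu>"
    "f t (T (J (x s))) = 0" "f s (T (J (x t))) = 0"
    using \<mu>(2) \<nu>(2) st ne by (auto simp: f_x clin_simps(6)[OF clin_f])
  have P01: "P 0 s t y = of_real (6/10) * f s y + of_real (5/10) * f t y"
    "P 1 s t y = of_real (7/10) * f s y + of_real (4/10) * \<i> * f t y" for y
    by (simp_all add: P_def coeff1_def coeff2_def eps_def)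
  obtain \<mu>0 where \<mu>0': "(\<forall>y. P 0 s t (T y) = \<mu>0 * P 0 s t y) \<or> (\<forall>y. P 0 s t (T y) = \<mu>0 * cnj (P 0 s t y))"
    by (rule iso_linear_or_antilinear[OF T clin_P[OF st(1,2)] iso_fixes_P[OF T _ st], of 0]) auto
  have v: "P 0 s t (x s) = 6/10" "P 0 s t (x t) = 5/10"
    unfolding P01 using st ne by (simp_all add: f_x)
  \<comment> \<open>The values of \<open>P 0\<close> at \<open>x s\<close> and \<open>x t\<close>
    are real, so a conjugation would not affect them and both points give the same
    multiplier.\<close>
  have "P 0 s t (T (x s)) = \<mu>0 * (6/10)" "P 0 s t (T (x t)) = \<mu>0 * (5/10)"
    using \<mu>0' by (auto simp: v)
  then have \<nu>\<mu>: "\<nu> = \<mu>" unfolding P01 by (simp add: fx)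
  have \<mu>0: "\<mu> \<noteq> 0" using \<mu>(1) by auto
  obtain \<mu>1 where \<mu>1: "(\<forall>y. P 1 s t (T y) = \<mu>1 * P 1 s t y) \<or> (\<forall>y. P 1 s t (T y) = \<mu>1 * cnj (P 1 s t y))"
    by (rule iso_linear_or_antilinear[OF T clin_P[OF st(1,2)] iso_fixes_P[OF T _ st], of 1]) auto
  have "\<mu> = \<mu>1" using \<mu>1 fx st ne unfolding P01 by (auto simp: f_x dest!: spec[of _ "x s"])
  \<comment> \<open>At \<open>x t\<close> the value of \<open>P 1\<close> is imaginary, so a
    conjugation would change its sign.\<close>
  have not_anti: "\<not> (\<forall>y. P 1 s t (T y) = \<mu>1 * cnj (P 1 s t y))"
  proof
    assume "\<forall>y. P 1 s t (T y) = \<mu>1 * cnj (P 1 s t y)"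
    from spec[OF this, of "x t"] show False
      using fx st ne \<mu>0 unfolding P01 by (simp add: f_x \<nu>\<mu> \<open>\<mu> = \<mu>1\<close>[symmetric])
  qed
  then have lin1: "P 1 s t (T y) = \<mu> * P 1 s t y" for y using \<mu>1 \<open>\<mu> = \<mu>1\<close> by blast
  \<comment> \<open>At \<open>T (J (x s))\<close> the functional \<open>f t\<close> vanishes, so the
    linearity of \<open>P 1\<close> passes to \<open>f s\<close>; \<open>J (x t)\<close> does the
    same for \<open>f t\<close>.\<close>
  have "f s (T (J (x s))) = \<mu> * \<i>"
    using lin1[of "J (x s)"] fx st ne unfolding P01 by (simp add: f_x clin_simps(6)[OF clin_f])
  then have 1: "f s (T y) = \<mu> * f s y" for y
  proof -
    have "\<not> (\<forall>y. f s (T y) = \<mu> * cnj (f s y))"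
    proof
      assume "\<forall>y. f s (T y) = \<mu> * cnj (f s y)"
      from spec[OF this, of "J (x s)"] show False
        using \<open>f s (T (J (x s))) = \<mu> * \<i>\<close> \<mu>0 st by (simp add: f_x clin_simps(6)[OF clin_f])
    qed
    then show ?thesis using \<mu>(2) by blast
  qed
  have "\<i> * f t (T (J (x t))) = - \<mu>"
    using lin1[of "J (x t)"] fx st ne unfolding P01 by (simp add: f_x clin_simps(6)[OF clin_f])
  then have "- \<i> * (\<i> * f t (T (J (x t)))) = - \<i> * (- \<mu>)" by simp
  then have "f t (T (J (x t))) = \<mu> * \<i>" by simp
  then have 2: "f t (T y) = \<mu> * f t y" for y
  proof -
    have "\<not> (\<forall>y. f t (T y) = \<nu> * cnj (f t y))"
    proof
      assume "\<forall>y. f t (T y) = \<nu> * cnj (f t y)"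
      from spec[OF this, of "J (x t)"] show False
        using \<open>f t (T (J (x t))) = \<mu> * \<i>\<close> \<mu>0 st by (simp add: \<nu>\<mu> f_x clin_simps(6)[OF clin_f])
    qed
    then show ?thesis using \<nu>(2) unfolding \<nu>\<mu> by blast
  qed
  show thesis using that[OF \<mu>(1) 1 2] .
qed

text \<open>\<open>P 2\<close> and \<open>P 3\<close> carry the same multiple of \<open>G s t\<close>, so their difference involves \<open>f s\<close> and
  \<open>f t\<close> only; comparing it with the two separate multipliers identifies these with the multiplier
  \<open>\<mu>\<close> of the coordinates.\<close>

lemma iso_perturbation:
  assumes T: "isometric T" and st: "s \<in> A" "t \<in> A" "lt s t"
    and \<mu>: "cmod \<mu> = 1" and fs: "\<And>y. f s (T y) = \<mu> * f s y" and ft: "\<And>y. f t (T y) = \<mu> * f t y"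
  shows "g t (T y) = \<mu> * g t y"
proof -
  have ne: "s \<noteq> t" using st lt_irrefl by blast
  let ?e = "1 / (400 * E\<^sup>2)"
  have P23: "P 2 s t y = of_real (8/10) * f s y - of_real (3/10) * f t y + of_real ?e * G s t y"
    "P 3 s t y = of_real (75/100) * f s y - of_real (35/100) * \<i> * f t y + of_real ?e * G s t y" for y
    by (simp_all add: P_def coeff1_def coeff2_def eps_def power3_eq_cube)
  define d where "d y = P 2 s t y - P 3 s t y" for y
  have d: "d y = of_real (5/100) * f s y + (of_real (35/100) * \<i> - of_real (3/10)) * f t y" for y
    unfolding d_def P23 by (simp add: algebra_simps flip: of_real_diff)
  have dT: "d (T y) = \<mu> * d y" for y unfolding d fs ft by (simp add: algebra_simps)
  have dJ: "d (T (J y)) = \<i> * d (T y)" for y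
  proof -
    have "d (J y) = \<i> * d y" unfolding d using st by (simp add: clin_simps(6)[OF clin_f] algebra_simps)
    then show ?thesis by (simp add: dT)
  qed
  have \<mu>0: "\<mu> \<noteq> 0" using \<mu> by auto
  have dx: "d (T (x s)) \<noteq> 0" unfolding dT using st ne \<mu>0 by (simp add: d f_x)
  have nz: "P j s t (T (x s)) \<noteq> 0" if "j < 4" for j
    using iso_fixes_P[OF T that st, of "x s"] P_x(1)[OF st(1,2) ne, of j] coeff_bounds[of j] by auto
  obtain \<mu>2 where \<mu>2: "(\<forall>y. P 2 s t (T y) = \<mu>2 * P 2 s t y) \<or> (\<forall>y. P 2 s t (T y) = \<mu>2 * cnj (P 2 s t y))"
    by (rule iso_linear_or_antilinear[OF T clin_P[OF st(1,2)] iso_fixes_P[OF T _ st], of 2]) auto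
  obtain \<mu>3 where \<mu>3: "(\<forall>y. P 3 s t (T y) = \<mu>3 * P 3 s t y) \<or> (\<forall>y. P 3 s t (T y) = \<mu>3 * cnj (P 3 s t y))"
    by (rule iso_linear_or_antilinear[OF T clin_P[OF st(1,2)] iso_fixes_P[OF T _ st], of 3]) auto
  have PJ: "P j s t (J y) = \<i> * P j s t y" for j y by (rule clin_simps(6)[OF clin_P[OF st(1,2)]])
  let ?a = "P 2 s t (T (x s))" and ?b = "P 3 s t (T (x s))"
  have dJ': "P 2 s t (T (J (x s))) - P 3 s t (T (J (x s))) = \<i> * (?a - ?b)"
    using dJ[of "x s"] by (simp add: d_def)
  have J2: "P 2 s t (T (J (x s))) = \<i> * ?a \<and> (\<forall>y. P 2 s t (T y) = \<mu>2 * P 2 s t y) \<or> P 2 s t (T (J (x s))) = - \<i> * ?a"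
    using \<mu>2 by (auto simp: PJ)
  have J3: "P 3 s t (T (J (x s))) = \<i> * ?b \<and> (\<forall>y. P 3 s t (T y) = \<mu>3 * P 3 s t y) \<or> P 3 s t (T (J (x s))) = - \<i> * ?b"
    using \<mu>3 by (auto simp: PJ)
  \<comment> \<open>If \<open>P 2\<close> or \<open>P 3\<close> were antilinear, \<open>dJ'\<close>
    would force \<open>?a\<close>, \<open>?b\<close> or their difference to vanish.\<close>
  have "\<not> (P 2 s t (T (J (x s))) = - \<i> * ?a)"
  proof
    assume h: "P 2 s t (T (J (x s))) = - \<i> * ?a"
    from J3 show False
    proof
      assume "P 3 s t (T (J (x s))) = \<i> * ?b \<and> (\<forall>y. P 3 s t (T y) = \<mu>3 * P 3 s t y)"
      then have "P 3 s t (T (J (x s))) = \<i> * ?b" by (rule conjunct1)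
      then have "2 * \<i> * ?a = 0" using dJ' h by (simp add: algebra_simps)
      then show False using nz[of 2] by simp
    next
      assume "P 3 s t (T (J (x s))) = - \<i> * ?b"
      then have "2 * \<i> * (?a - ?b) = 0" using dJ' h by (simp add: algebra_simps)
      then show False using dx by (simp add: d_def)
    qed
  qed
  then have l2: "\<And>y. P 2 s t (T y) = \<mu>2 * P 2 s t y" and J2': "P 2 s t (T (J (x s))) = \<i> * ?a" using J2 by blast+
  have "\<not> (P 3 s t (T (J (x s))) = - \<i> * ?b)"
  proof
    assume "P 3 s t (T (J (x s))) = - \<i> * ?b"
    then have "2 * \<i> * ?b = 0" using dJ' J2' by (simp add: algebra_simps)
    then show False using nz[of 3] by simp
  qed
  then have l3: "\<And>y. P 3 s t (T y) = \<mu>3 * P 3 s t y" using J3 by blast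
  have eq: "\<mu>2 * P 2 s t y - \<mu>3 * P 3 s t y = \<mu> * d y" for y
    using dT[of y] l2[of y] l3[of y] by (simp add: d_def)
  \<comment> \<open>At \<open>x s\<close> and \<open>x t\<close>, \<open>eq\<close> becomes the
    homogeneous system \<open>16 * a = 15 * b\<close>, \<open>6 * a = 7 * \<i> * b\<close> for the
    deviations from \<open>\<mu>\<close>; it has only the zero solution.\<close>
  define a where "a = \<mu>2 - \<mu>"
  define b where "b = \<mu>3 - \<mu>"
  have "16 * \<mu>2 - 15 * \<mu>3 = \<mu>"
    using eq[of "x s"] st ne unfolding d P23 by (simp add: f_x G_x)
  moreover have "16 * a - 15 * b = 16 * \<mu>2 - 15 * \<mu>3 - \<mu>" by (simp add: a_def b_def algebra_simps)
  ultimately have ab: "16 * a = 15 * b" by simp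
  have "\<mu> * 120 + \<i> * (\<mu>3 * 140) = \<mu>2 * 120 + \<i> * (\<mu> * 140)"
    using eq[of "x t"] st ne unfolding d P23 by (simp add: f_x G_x field_simps)
  then have "20 * (6 * a) = 20 * (7 * \<i> * b)" by (simp add: a_def b_def algebra_simps)
  then have "6 * a = 7 * \<i> * b" by simp
  then have "15 * (6 * a) = 7 * \<i> * (15 * b)" by simp
  then have "a * (90 - 112 * \<i>) = 0" unfolding ab[symmetric] by (simp add: algebra_simps)
  then have "a = 0" by (simp add: complex_eq_iff)
  then have "P 2 s t (T y) = \<mu> * P 2 s t y" using l2 by (simp add: a_def)
  then have "of_real ?e * G s t (T y) = of_real ?e * (\<mu> * G s t y)"
    unfolding P23 fs ft by (simp add: algebra_simps)
  then have "G s t (T y) = \<mu> * G s t y" using E_ge by simp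
  then show ?thesis unfolding G_def fs ft by (simp add: algebra_simps)
qed

text \<open>The pairs \<open>(m, t)\<close> pass the multiplier of \<open>f m\<close> on to every
  \<open>f t\<close> and \<open>g t\<close>. The difference between \<open>T\<close> and this scalar
  is then killed by a total family.\<close>

theorem isometry_scalar:
  assumes T: "linear T" "surj T" "\<And>y. N (T y) = N y"
  shows "\<exists>\<mu>. cmod \<mu> = 1 \<and> (\<forall>y. T y = cscale \<mu> y)"
proof -
  have iso: "isometric T" using T by (simp add: isometric_def)
  obtain \<mu> where \<mu>: "cmod \<mu> = 1" "\<And>y. f m (T y) = \<mu> * f m y"
    using iso_coordinates[OF iso m n(1) m_least[OF n]] by metis
  have f: "f t (T y) = \<mu> * f t y" if t: "t \<in> A" for t y
  proof (cases "t = m")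
    case False
    obtain \<nu> where \<nu>: "\<And>y. f m (T y) = \<nu> * f m y" "\<And>y. f t (T y) = \<nu> * f t y"
      using iso_coordinates[OF iso m t m_least[OF t False]] by metis
    then have "\<nu> = \<mu>" using \<mu>(2)[of "x m"] m by (simp add: f_x)
    then show ?thesis using \<nu> by simp
  qed (use \<mu> in simp)
  have g: "g t (T y) = \<mu> * g t y" if "t \<in> A" "t \<noteq> m" for t y
    by (rule iso_perturbation[OF iso m that(1) m_least[OF that] \<mu> f[OF that(1)]])
  have "T y - cscale \<mu> y = 0" for y
    by (rule total) (use f g in \<open>simp_all add: clin_simps(2,7)[OF clin_f] clin_simps(2,7)[OF clin_g]\<close>)
  then show ?thesis using \<mu>(1) by auto
qed

end

section \<open>Sufficiency\<close>

lemma space_dim_le_2: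
  fixes B :: "'a::real_vector set"
  assumes "finite B" "span B = UNIV" "card B \<le> 2"
  shows "\<not> space_dim TYPE('a) > 2"
proof -
  have "dim (UNIV :: 'a set) \<le> card B" using assms by (intro dim_le_card) auto
  then have "space_dim TYPE('a) \<le> enat 2" using assms by (auto simp: space_dim_def)
  then show ?thesis by (simp add: numeral_eq_enat not_less)
qed

text \<open>The supremum over all rotations of a vector absorbs phases, which makes it homogeneous
  for complex scalars.\<close>

lemma invariant_norm:
  fixes J :: "'a::real_normed_vector \<Rightarrow>\<^sub>L 'a"
  assumes J: "J o\<^sub>L J = - id_blinfun"
  shows "\<exists>p. complex_norm (blinfun_apply J) p (1 + norm J)"
proof -
  have JJ: "J (J x) = - x" for x
    using arg_cong[OF J, of "\<lambda>T. blinfun_apply T x"] by (simp add: uminus_blinfun.rep_eq)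
  define c where "c z x = Re z *\<^sub>R x + Im z *\<^sub>R J x" for z x
  have cc: "c z (c w x) = c (z * w) x" for z w x
    by (simp add: c_def JJ blinfun.add_right blinfun.scaleR_right algebra_simps)
  have c_of_real: "c (of_real r) x = r *\<^sub>R x" for r x by (simp add: c_def)
  define p where "p x = (SUP u\<in>{u. cmod u = 1}. norm (c u x))" for x
  have bd: "norm (c u x) \<le> (1 + norm J) * norm x" if "cmod u = 1" for u x
  proof -
    have "norm (c u x) \<le> \<bar>Re u\<bar> * norm x + \<bar>Im u\<bar> * norm (J x)"
      unfolding c_def by (metis norm_scaleR norm_triangle_ineq)
    also have "\<dots> \<le> 1 * norm x + 1 * norm (J x)"
      using abs_Re_le_cmod[of u] abs_Im_le_cmod[of u] that by (intro add_mono mult_right_mono) auto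
    also have "\<dots> \<le> (1 + norm J) * norm x" using norm_blinfun[of J x] by (simp add: algebra_simps)
    finally show ?thesis .
  qed
  have bdd: "bdd_above ((\<lambda>u. norm (c u x)) ` {u. cmod u = 1})" for x
    using bd by (intro bdd_aboveI2[where M="(1 + norm J) * norm x"]) auto
  have ge: "norm (c u x) \<le> p x" if "cmod u = 1" for u x
    unfolding p_def by (rule cSUP_upper[OF _ bdd]) (use that in simp)
  have le: "p x \<le> M" if "\<And>u. cmod u = 1 \<Longrightarrow> norm (c u x) \<le> M" for x M
    unfolding p_def by (rule cSUP_least) (use that in \<open>auto intro: exI[of _ 1]\<close>)
  have sc: "p (c z x) \<le> cmod z * p x" if "z \<noteq> 0" for z x
  proof (rule le)
    fix u assume "cmod u = 1"
    then have "cmod (u * z / cmod z) = 1" using that by (simp add: norm_mult norm_divide)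
    moreover have "c u (c z x) = cmod z *\<^sub>R c (u * z / cmod z) x"
      using that by (simp add: cc c_of_real[symmetric])
    ultimately show "norm (c u (c z x)) \<le> cmod z * p x" using ge by (simp add: mult_left_mono)
  qed
  have "complex_norm (blinfun_apply J) p (1 + norm J)"
  proof (rule complex_norm.intro)
    show "linear (blinfun_apply J)"
      by (rule linearI) (simp_all add: blinfun.add_right blinfun.scaleR_right)
    show "J (J x) = - x" for x by (rule JJ)
    show "p (x + y) \<le> p x + p y" for x y
    proof (rule le)
      fix u assume u: "cmod u = 1"
      have "c u (x + y) = c u x + c u y" by (simp add: c_def blinfun.add_right algebra_simps)
      then show "norm (c u (x + y)) \<le> p x + p y"
        using norm_triangle_ineq[of "c u x" "c u y"] ge[OF u, of x] ge[OF u, of y] by simp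
    qed
    show "norm x \<le> p x" for x using ge[of 1 x] by (simp add: c_def)
    show "p x \<le> (1 + norm J) * norm x" for x using bd by (rule le)
    show "p (Re z *\<^sub>R x + Im z *\<^sub>R J x) = cmod z * p x" for z x
    proof (cases "z = 0")
      case True
      have "p 0 = 0"
        by (rule antisym[OF le]) (use ge[of 1 0] in \<open>simp_all add: c_def\<close>)
      then show ?thesis using True by simp
    next
      case False
      have "p (c (1 / z) (c z x)) \<le> p (c z x) / cmod z"
        using sc[of "1 / z" "c z x"] False by (simp add: norm_divide)
      moreover have "c (1 / z) (c z x) = x" using False c_of_real[of 1 x] by (simp add: cc)
      ultimately have "p x * cmod z \<le> p (c z x)" using False by (simp add: field_simps)
      then show ?thesis using sc[OF False, of x] by (simp add: c_def mult.commute)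
    qed
  qed
  then show ?thesis by blast
qed

text \<open>The system of \<open>biorthogonal_total\<close>, indexed by its own pairs, and a
  well-order of their type are fed into \<open>linked_system\<close>; \<open>m\<close> is the least
  member.\<close>

lemma rigid_norm:
  fixes J :: "'a::real_normed_vector \<Rightarrow>\<^sub>L 'a"
  assumes J: "J o\<^sub>L J = - id_blinfun" and dim: "space_dim TYPE('a) > 2"
  shows "\<exists>N. equivalent_norm N \<and> (\<forall>z x. N (Re z *\<^sub>R x + Im z *\<^sub>R J x) = cmod z * N x) \<and>
    (\<forall>T. linear T \<longrightarrow> surj T \<longrightarrow> (\<forall>x. N (T x) = N x) \<longrightarrow>
       (\<exists>\<mu>. cmod \<mu> = 1 \<and> (\<forall>x. T x = Re \<mu> *\<^sub>R x + Im \<mu> *\<^sub>R J x)))"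
proof -
  obtain p where "complex_norm (blinfun_apply J) p (1 + norm J)" using invariant_norm[OF J] ..
  then interpret complex_norm "blinfun_apply J" p "1 + norm J" .
  obtain D A where DA: "biorthogonal D A"
    and g_ex: "\<And>m. \<exists>g. (\<forall>a\<in>A. clin (g a) \<and> (\<forall>x. cmod (g a x) \<le> p x)) \<and>
         (\<forall>x. (\<forall>a\<in>A. snd a x = 0) \<longrightarrow> (\<forall>a\<in>A - {m}. g a x = 0) \<longrightarrow> x = 0)"
    by (rule biorthogonal_total) blast
  have A: "p (fst a) = 1" "clin (snd a)" "cmod (snd a x) \<le> D * p x" "snd a (fst a) = 1" if "a \<in> A" for a x
    using DA that by (auto simp: biorthogonal_def)
  have orth: "snd a (fst b) = (if a = b then 1 else 0)" if "a \<in> A" "b \<in> A" for a b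
    using DA that A(4) by (auto simp: biorthogonal_def)
  \<comment> \<open>With at most one member the space would be spanned over the reals by
    \<open>e\<close> and \<open>J e\<close>, against the dimension.\<close>
  have two: "\<not> A \<subseteq> {m}" for m
  proof
    assume Am: "A \<subseteq> {m}"
    from g_ex[of m] obtain g where "(\<forall>a\<in>A. clin (g a) \<and> (\<forall>x. cmod (g a x) \<le> p x)) \<and>
         (\<forall>x. (\<forall>a\<in>A. snd a x = 0) \<longrightarrow> (\<forall>a\<in>A - {m}. g a x = 0) \<longrightarrow> x = 0)" ..
    then have tot: "x = 0" if "\<And>a. a \<in> A \<Longrightarrow> snd a x = 0" for x using that Am by blast
    define e where "e = fst m"
    have "y \<in> span {e, J e}" for y
    proof (cases "m \<in> A")
      case True
      have "y - cscale (snd m y) e = 0"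
        using Am A(2,4)[OF True] by (intro tot) (auto simp: clin_simps e_def)
      then have "y = Re (snd m y) *\<^sub>R e + Im (snd m y) *\<^sub>R J e" by (simp add: cscale_def)
      then show ?thesis by (metis insertCI span_add span_base span_scale)
    next
      case False
      then have "y = 0" using Am by (intro tot) auto
      then show ?thesis by (simp add: span_zero)
    qed
    then have "span {e, J e} = UNIV" by auto
    moreover have "card {e, J e} \<le> 2" by (cases "e = J e") auto
    ultimately show False using space_dim_le_2[of "{e, J e}"] dim by simp
  qed
  obtain r :: "('a \<times> ('a \<Rightarrow> complex)) rel" where r: "well_order_on UNIV r"
    using well_order_on by blast
  define lt where "lt a b \<longleftrightarrow> (a, b) \<in> r - Id" for a b
  have wf: "wf {(a, b). lt a b}"
  proof -
    have "{(a, b). lt a b} = r - Id" by (auto simp: lt_def)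
    then show ?thesis using r by (simp add: well_order_on_def)
  qed
  have total: "lt a b \<or> lt b a" if "a \<noteq> b" for a b
  proof -
    have "total r" using r by (simp add: well_order_on_def linear_order_on_def)
    then show ?thesis using that by (simp add: lt_def total_on_def del: split_paired_All)
  qed
  obtain m where m: "m \<in> A" "\<And>a. lt a m \<Longrightarrow> a \<notin> A"
  proof -
    obtain a0 where "a0 \<in> A" using two by blast
    from wfE_min[OF wf this] that show thesis by auto
  qed
  obtain n where n: "n \<in> A" "n \<noteq> m" using two[of m] by blast
  from g_ex[of m] obtain g where "(\<forall>a\<in>A. clin (g a) \<and> (\<forall>x. cmod (g a x) \<le> p x)) \<and>
         (\<forall>x. (\<forall>a\<in>A. snd a x = 0) \<longrightarrow> (\<forall>a\<in>A - {m}. g a x = 0) \<longrightarrow> x = 0)" ..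
  then have g: "\<And>a. a \<in> A \<Longrightarrow> clin (g a)" "\<And>a x. a \<in> A \<Longrightarrow> cmod (g a x) \<le> p x"
    "\<And>x. (\<forall>a\<in>A. snd a x = 0) \<Longrightarrow> (\<forall>a\<in>A - {m}. g a x = 0) \<Longrightarrow> x = 0"
    by blast+
  interpret linked_system "blinfun_apply J" p "1 + norm J" A fst snd g lt m n D
  proof
    show "p (fst a) = 1" "clin (snd a)" "clin (g a)" "cmod (snd a y) \<le> D * p y" "cmod (g a y) \<le> p y"
      if "a \<in> A" for a y using A[OF that] g(1,2)[OF that] by auto
    show "snd a (fst b) = (if a = b then 1 else 0)" if "a \<in> A" "b \<in> A" for a b using orth[OF that] .
    show "y = 0" if "\<And>a. a \<in> A \<Longrightarrow> snd a y = 0" "\<And>a. a \<in> A \<Longrightarrow> a \<noteq> m \<Longrightarrow> g a y = 0" for y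
      using that by (intro g(3)) auto
    show "lt m a" if "a \<in> A" "a \<noteq> m" for a using that m(2)[of a] total[of a m] by blast
  qed (use m n wf total in auto)
  have "equivalent_norm N"
    unfolding equivalent_norm_def
  proof (intro conjI allI)
    have lo: "1 / (4 * E) * norm x \<le> N x" for x
      using N_ge[of x] mult_left_mono[OF norm_le_p[of x], of "1 / (4 * E)"] E_ge by auto
    have up: "N x \<le> M * (1 + norm J) * norm x" for x
      unfolding mult.assoc
      by (rule order_trans[OF N_le mult_left_mono[OF p_le less_imp_le[OF M_pos]]])
    have "0 < 1 / (4 * E)" using E_ge by simp
    moreover have "0 < M * (1 + norm J)" using M_pos by (simp add: add_pos_nonneg)
    ultimately show "\<exists>c>0. \<exists>C>0. \<forall>x. c * norm x \<le> N x \<and> N x \<le> C * norm x"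
      using lo up by blast
  qed (simp_all add: N_nonneg N_eq_0 N_scaleR N_add)
  moreover have "N (Re z *\<^sub>R x + Im z *\<^sub>R J x) = cmod z * N x" for z x
    using N_cscale[of z x] by (simp add: cscale_def)
  moreover have "\<exists>\<mu>. cmod \<mu> = 1 \<and> (\<forall>x. T x = Re \<mu> *\<^sub>R x + Im \<mu> *\<^sub>R J x)"
    if "linear T" "surj T" "\<And>x. N (T x) = N x" for T
    using isometry_scalar[OF that] by (simp add: cscale_def)
  ultimately show ?thesis by (intro exI[of _ N] conjI allI impI) simp_all
qed

section \<open>From the rigid norm to a display\<close>

lemma Hausdorff_GL_topology: "Hausdorff_space (GL_topology :: ('a::real_normed_vector \<Rightarrow>\<^sub>L 'a) topology)"
proof -
  have "Hausdorff_space (product_topology (\<lambda>_::'a. euclidean :: 'a topology) UNIV)"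
    by (simp add: Hausdorff_space_product_topology)
  then have "Hausdorff_space (euclidean :: ('a \<Rightarrow> 'a) topology)"
    by (simp add: euclidean_product_topology)
  moreover have "continuous_map strong_operator_topology (euclidean :: ('a \<Rightarrow> 'a) topology) blinfun_apply"
    unfolding strong_operator_topology_def by (rule continuous_map_pullback[where g="\<lambda>x. x", unfolded o_def]) simp
  moreover have "inj_on blinfun_apply (topspace (strong_operator_topology :: ('a \<Rightarrow>\<^sub>L 'a) topology))"
    by (auto intro: inj_onI simp: blinfun_apply_inject)
  ultimately have "Hausdorff_space (strong_operator_topology :: ('a \<Rightarrow>\<^sub>L 'a) topology)"
    by (rule Hausdorff_space_injective_preimage)
  then show ?thesis
    unfolding GL_topology_def by (rule Hausdorff_space_subtopology)
qed

text \<open>The circle is compact and the strong topology is Hausdorff, so a continuous injection is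
  an embedding; rigidity identifies its image.\<close>

lemma complex_structure_displayable:
  fixes J :: "'a::real_normed_vector \<Rightarrow>\<^sub>L 'a"
  assumes J: "J o\<^sub>L J = - id_blinfun" and dim: "space_dim TYPE('a) > 2"
  shows "displayable circle_group circle_topology TYPE('a)"
proof -
  obtain N where N: "equivalent_norm N" "\<And>z x. N (Re z *\<^sub>R x + Im z *\<^sub>R J x) = cmod z * N x"
    and rigid: "\<And>T. linear T \<Longrightarrow> surj T \<Longrightarrow> (\<And>x. N (T x) = N x) \<Longrightarrow>
       \<exists>\<mu>. cmod \<mu> = 1 \<and> (\<forall>x. T x = Re \<mu> *\<^sub>R x + Im \<mu> *\<^sub>R J x)"
    using rigid_norm[OF J dim] by (elim exE conjE) simp
  have JJ: "J (J x) = - x" for x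
    using arg_cong[OF J, of "\<lambda>T. blinfun_apply T x"] by (simp add: uminus_blinfun.rep_eq)
  define \<rho> :: "complex \<Rightarrow> 'a \<Rightarrow>\<^sub>L 'a" where "\<rho> z = Re z *\<^sub>R id_blinfun + Im z *\<^sub>R J" for z
  have \<rho>: "\<rho> z x = Re z *\<^sub>R x + Im z *\<^sub>R J x" for z x
    by (simp add: \<rho>_def plus_blinfun.rep_eq scaleR_blinfun.rep_eq)
  have mult: "\<rho> (z * w) = \<rho> z o\<^sub>L \<rho> w" for z w
    by (rule blinfun_eqI) (simp add: \<rho> JJ blinfun.add_right blinfun.scaleR_right algebra_simps)
  have one: "\<rho> 1 = id_blinfun" by (simp add: \<rho>_def)
  have unit: "z * cnj z = 1" if "cmod z = 1" for z :: complex
    using that complex_norm_square[of z] by simp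
  have GL: "\<rho> z \<in> carrier GL" if "cmod z = 1" for z
    using unit[OF that] mult[of z "cnj z"] mult[of "cnj z" z] one
    by (auto simp: GL_def mult.commute intro!: exI[of _ "\<rho> (cnj z)"])
  have hom: "\<rho> \<in> hom circle_group GL"
    using GL mult by (auto simp: hom_def circle_group_def GL_def)
  obtain x0 :: 'a where x0: "x0 \<noteq> 0"
  proof -
    have "\<exists>x::'a. x \<noteq> 0"
    proof (rule ccontr)
      assume "\<not> ?thesis"
      then have "span {} = (UNIV :: 'a set)" by auto
      then show False using space_dim_le_2[of "{} :: 'a set"] dim by simp
    qed
    then show thesis using that by blast
  qed
  have inj: "inj \<rho>"
  proof (rule injI)
    fix z w assume "\<rho> z = \<rho> w"
    then have "\<rho> z x0 = \<rho> w x0" by simp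
    then have "\<rho> (z - w) x0 = 0"
      unfolding \<rho> by (simp add: scaleR_left_diff_distrib algebra_simps)
    then have "cmod (z - w) * N x0 = N 0" using N(2)[of "z - w" x0] by (simp add: \<rho>)
    moreover have "N 0 = 0" "N x0 \<noteq> 0" using N(1) x0 unfolding equivalent_norm_def by blast+
    ultimately show "z = w" by simp
  qed
  have "continuous_map circle_topology euclidean (\<lambda>z. \<rho> z x)" for x
    unfolding circle_topology_def \<rho> by (auto intro!: continuous_intros)
  then have "continuous_map circle_topology GL_topology \<rho>"
    unfolding GL_topology_def continuous_map_in_subtopology continuous_on_strong_operator_topo_iff_coordinatewise
    using GL by (auto simp: circle_topology_def)
  moreover have "compact_space circle_topology"
  proof -
    have "compact (sphere (0::complex) 1)" by simp
    then show ?thesis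
      by (simp add: circle_topology_def compact_space_subtopology sphere_def dist_norm)
  qed
  ultimately have "embedding_map circle_topology GL_topology \<rho>"
    using Hausdorff_GL_topology inj by (intro continuous_imp_embedding_map) (auto intro: inj_on_subset)
  moreover have "\<rho> ` carrier circle_group = Isom N"
  proof
    show "\<rho> ` carrier circle_group \<subseteq> Isom N"
    proof (rule image_subsetI)
      fix z assume "z \<in> carrier circle_group"
      then have z: "cmod z = 1" by (simp add: circle_group_def)
      have "\<rho> z (\<rho> (cnj z) x) = x" for x
        using arg_cong[OF mult[of z "cnj z"], of "\<lambda>T. blinfun_apply T x"] unit[OF z] by (simp add: one)
      then have "surj (blinfun_apply (\<rho> z))" by (metis surjI)
      then show "\<rho> z \<in> Isom N" using N(2)[of z] z by (simp add: Isom_def \<rho>)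
    qed
    show "Isom N \<subseteq> \<rho> ` carrier circle_group"
    proof
      fix T assume "T \<in> Isom N"
      then have "surj (blinfun_apply T)" "\<And>x. N (T x) = N x" by (auto simp: Isom_def)
      then obtain \<mu> where "cmod \<mu> = 1" "\<And>x. T x = Re \<mu> *\<^sub>R x + Im \<mu> *\<^sub>R J x"
        using rigid[of "blinfun_apply T"] by (metis blinfun.bounded_linear_right bounded_linear.linear)
      then have "T = \<rho> \<mu>" "\<mu> \<in> carrier circle_group"
        by (auto intro: blinfun_eqI simp: \<rho> circle_group_def)
      then show "T \<in> \<rho> ` carrier circle_group" by blast
    qed
  qed
  ultimately have "display circle_group circle_topology \<rho>"
    using hom N(1) topological_group_circle by (auto simp: display_def)
  then show ?thesis by (auto simp: displayable_def)
qed

section \<open>Necessity\<close>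

text \<open>The angle is rounded down to a multiple of \<open>2 * pi / Suc n\<close>.\<close>

lemma unit_circle_root_of_unity_approx:
  fixes u :: complex
  assumes "cmod u = 1"
  obtains v where "\<And>n. v n ^ Suc n = 1" "v \<longlonglongrightarrow> u"
proof -
  obtain t where t: "u = cis t" using assms by (metis complex_norm_eq_1_exp cis_conv_exp mult.commute)
  define s where "s = t / (2 * pi)"
  define q where "q n = of_int \<lfloor>s * real (Suc n)\<rfloor> / real (Suc n)" for n
  have "\<bar>q n - s\<bar> \<le> 1 / real (Suc n)" for n
  proof -
    have "\<bar>of_int \<lfloor>s * real (Suc n)\<rfloor> - s * real (Suc n)\<bar> \<le> 1" by linarith
    moreover have "q n - s = (of_int \<lfloor>s * real (Suc n)\<rfloor> - s * real (Suc n)) / real (Suc n)"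
      by (simp add: q_def field_simps)
    ultimately show ?thesis by (simp only: abs_divide abs_of_nat) (intro divide_right_mono; simp)
  qed
  then have "(\<lambda>n. q n - s) \<longlonglongrightarrow> 0"
    by (intro Lim_null_comparison[OF _ LIMSEQ_inverse_real_of_nat]) (auto simp: inverse_eq_divide)
  then have q: "q \<longlonglongrightarrow> s" by (simp add: LIM_zero_iff)
  define v where "v n = cis (2 * pi * q n)" for n
  have "v n ^ Suc n = 1" for n
  proof -
    have "v n ^ Suc n = cis (real (Suc n) * (2 * pi * q n))" by (simp only: v_def Complex.DeMoivre)
    also have "real (Suc n) * (2 * pi * q n) = 2 * pi * of_int \<lfloor>s * real (Suc n)\<rfloor>"
      by (simp add: q_def)
    also have "cis \<dots> = 1" by (simp add: cis_multiple_2pi)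
    finally show ?thesis .
  qed
  moreover have "v \<longlonglongrightarrow> cis (2 * pi * s)"
    unfolding v_def using q by (intro tendsto_intros)
  then have "v \<longlonglongrightarrow> u" by (simp add: t s_def)
  ultimately show thesis by (rule that)
qed

lemma equivalent_norm_continuous:
  fixes N :: "'a::real_normed_vector \<Rightarrow> real"
  assumes N: "equivalent_norm N" and v: "v \<longlonglongrightarrow> y"
  shows "(\<lambda>n. N (v n)) \<longlonglongrightarrow> N y"
proof -
  have add: "N (x + z) \<le> N x + N z" and scale: "N (a *\<^sub>R x) = \<bar>a\<bar> * N x" for x z a
    using N by (auto simp: equivalent_norm_def)
  obtain C where C: "\<And>x. N x \<le> C * norm x" using N unfolding equivalent_norm_def by blast
  have bound: "\<bar>N (v n) - N y\<bar> \<le> C * norm (v n - y)" for n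
    using add[of "v n - y" y] add[of "y - v n" "v n"] scale[of "-1" "v n - y"] C[of "v n - y"] by simp
  have "(\<lambda>n. C * norm (v n - y)) \<longlonglongrightarrow> 0"
    by (rule tendsto_mult_right_zero[OF tendsto_norm_zero[OF LIM_zero[OF v]]])
  then have "(\<lambda>n. N (v n) - N y) \<longlonglongrightarrow> 0"
    by (rule Lim_null_comparison[rotated]) (simp add: bound)
  then show ?thesis by (rule LIM_zero_cancel)
qed

lemma displayable_complex_structure:
  assumes "displayable circle_group circle_topology TYPE('a::real_normed_vector)"
  shows "admits_complex_structure TYPE('a) \<and> space_dim TYPE('a) > 2"
proof -
  obtain \<rho> :: "complex \<Rightarrow> 'a \<Rightarrow>\<^sub>L 'a" and N where hom: "\<rho> \<in> hom circle_group GL"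
    and emb: "embedding_map circle_topology GL_topology \<rho>"
    and N: "equivalent_norm N" and img: "\<rho> ` carrier circle_group = Isom N"
    using assms by (auto simp: displayable_def display_def)
  have mult: "\<rho> (z * w) = \<rho> z o\<^sub>L \<rho> w" if "cmod z = 1" "cmod w = 1" for z w
    using hom that by (auto simp: hom_def circle_group_def GL_def)
  have one: "\<rho> 1 = id_blinfun"
    using hom_one[OF hom group_circle group_GL] by (simp add: circle_group_def GL_def)
  have inj: "z = w" if "cmod z = 1" "cmod w = 1" "\<rho> z = \<rho> w" for z w
    using emb that unfolding embedding_map_def
    by (auto dest!: homeomorphic_imp_injective_map simp: circle_topology_def inj_on_def)
  have Isom: "T \<in> Isom N \<longleftrightarrow> (\<exists>z. cmod z = 1 \<and> T = \<rho> z)" for T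
    using img by (auto simp: circle_group_def)
  have N0: "N 0 = 0" and N_scale: "N (a *\<^sub>R x) = \<bar>a\<bar> * N x" and N_eq_0: "N x = 0 \<longleftrightarrow> x = 0" for a x
    using N by (auto simp: equivalent_norm_def)
  have N_minus: "N (- x) = N x" for x using N_scale[of "-1" x] by simp
  have N\<rho>: "N (\<rho> z x) = N x" if "cmod z = 1" for z x
    using Isom that by (auto simp: Isom_def)
  have nontriv: "\<exists>x::'a. x \<noteq> 0"
  proof (rule ccontr)
    assume "\<not> ?thesis"
    then have "\<rho> 1 = \<rho> (- 1)" by (intro blinfun_eqI) metis
    then show False using inj[of 1 "- 1"] by simp
  qed
  \<comment> \<open>\<open>- id_blinfun\<close> preserves \<open>N\<close>, so it is some
    \<open>\<rho> z\<close>. Injectivity gives \<open>z * z = 1\<close>, and \<open>z = 1\<close> is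
    impossible in a nonzero space.\<close>
  have \<rho>m1: "\<rho> (- 1) = - id_blinfun"
  proof -
    have "surj (\<lambda>x::'a. - x)" by (metis add.inverse_inverse surjI)
    then have "- id_blinfun \<in> Isom N" by (simp add: Isom_def uminus_blinfun.rep_eq N_minus)
    then obtain z where z: "cmod z = 1" "- id_blinfun = \<rho> z" using Isom by blast
    have "\<rho> (z * z) = \<rho> 1"
      unfolding mult[OF z(1) z(1)] z(2)[symmetric] one by (rule blinfun_eqI) (simp add: uminus_blinfun.rep_eq)
    then have "z * z = 1" using inj[of "z * z" 1] z(1) by (simp add: norm_mult)
    then have "z = 1 \<or> z = - 1" by (metis power2_eq_1_iff power2_eq_square)
    moreover have "z \<noteq> 1"
    proof
      assume "z = 1"
      then have "- id_blinfun = (id_blinfun :: 'a \<Rightarrow>\<^sub>L 'a)" using z one by simp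
      then have "- x = x" for x :: 'a by (metis id_blinfun.rep_eq id_apply uminus_blinfun.rep_eq)
      then have "x + x = 0" for x :: 'a by (metis add.right_inverse)
      then have "x = 0" for x :: 'a by (metis scaleR_2 scaleR_eq_0_iff zero_neq_numeral)
      then show False using nontriv by blast
    qed
    ultimately show ?thesis using z by simp
  qed
  define J where "J = \<rho> \<i>"
  have JJ: "J o\<^sub>L J = - id_blinfun" using mult[of \<i> \<i>] \<rho>m1 by (simp add: J_def)
  have Jx: "J (J x) = - x" for x
    using arg_cong[OF JJ, of "\<lambda>T. blinfun_apply T x"] by (simp add: uminus_blinfun.rep_eq)
  have comm: "\<rho> z (J x) = J (\<rho> z x)" if "cmod z = 1" for z x
    using mult[OF that, of \<i>] mult[OF _ that, of \<i>]
    by (metis J_def blinfun_apply_blinfun_compose mult.commute norm_ii)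
  have "space_dim TYPE('a) > 2"
  proof (rule ccontr)
    assume le: "\<not> space_dim TYPE('a) > 2"
    \<comment> \<open>\<open>R w\<close> is multiplication by the complex number \<open>w\<close> in
      the structure \<open>J\<close>.\<close>
    define R where "R w x = Re w *\<^sub>R x + Im w *\<^sub>R J x" for w x
    have RR: "R w (R w' x) = R (w * w') x" for w w' x
      by (simp add: R_def Jx blinfun.add_right blinfun.scaleR_right algebra_simps)
    have R1: "R 1 x = x" "R 0 x = 0" "R \<i> x = J x" for x by (simp_all add: R_def)
    have R_add: "R (w + w') x = R w x + R w' x" for w w' x by (simp add: R_def algebra_simps)
    have R_real: "R (of_real r) x = r *\<^sub>R x" for r x by (simp add: R_def)
    have R_eq_0: "w = 0" if "R w x = 0" "x \<noteq> 0" for w x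
    proof (rule ccontr)
      assume "w \<noteq> 0"
      then have "x = R (1 / w) (R w x)" by (simp add: RR R1)
      also have "\<dots> = 0" by (simp add: that(1)) (simp add: R_def)
      finally show False using that(2) by simp
    qed
    have R_inj: "w = w'" if "R w x = R w' x" "x \<noteq> 0" for w w' x
    proof -
      have "R (w - w') x = R w x - R w' x" by (simp add: R_def algebra_simps)
      then show ?thesis using R_eq_0[of "w - w'" x] that by simp
    qed
    obtain x0 :: 'a where x0: "x0 \<noteq> 0" using nontriv by blast
    have "J x0 \<noteq> r *\<^sub>R x0" for r
      using R_inj[of \<i> x0 "of_real r"] x0 by (auto simp: R1 R_real complex_eq_iff)
    then have ind: "independent {J x0, x0}" "J x0 \<noteq> x0"
      using x0 span_singleton[of x0] by (auto simp: independent_insert) (metis scaleR_one)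
    have spanned: "\<exists>w. y = R w x0" for y
    proof -
      obtain B :: "'a set" where B: "finite B" "span B = UNIV" "dim (UNIV :: 'a set) \<le> 2"
        using le by (auto simp: space_dim_def numeral_eq_enat not_less split: if_splits)
      obtain B' :: "'a set" where B': "B' \<subseteq> B" "independent B'" "UNIV \<subseteq> span B'" "finite B'"
        using maximal_independent_subset[of B] B(1,2) by (metis finite_subset span_mono span_span subset_UNIV)
      have card: "card B' \<le> 2" using B(3) B'(2,3) dim_eq_card[of B' UNIV] by (simp add: top.extremum_unique)
      have "y \<in> span {J x0, x0}"
      proof (rule ccontr)
        assume "y \<notin> span {J x0, x0}"
        then have "y \<notin> {J x0, x0}" using span_base by metis
        then have "independent (insert y {J x0, x0})"
          using ind \<open>y \<notin> span {J x0, x0}\<close> by (subst independent_insert) simp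
        then have "card (insert y {J x0, x0}) \<le> card B'"
          using independent_span_bound[OF B'(4)] B'(3) by blast
        moreover have "card (insert y {J x0, x0}) = 3" using \<open>y \<notin> {J x0, x0}\<close> ind(2) by simp
        ultimately show False using card by simp
      qed
      then obtain a b where "y = a *\<^sub>R J x0 + b *\<^sub>R x0"
        by (auto simp: span_insert span_singleton algebra_simps)
      then show ?thesis by (intro exI[of _ "Complex b a"]) (simp add: R_def add.commute)
    qed
    \<comment> \<open>Commuting with \<open>J\<close>, the operator \<open>\<rho> z\<close> is
      determined by its value at \<open>x0\<close>.\<close>
    have "\<exists>w. \<forall>y. \<rho> z y = R w y" if z: "cmod z = 1" for z
    proof -
      obtain w where w: "\<rho> z x0 = R w x0" using spanned by blast
      have "\<rho> z y = R w y" for y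
      proof -
        obtain w' where w': "y = R w' x0" using spanned by blast
        have "\<rho> z y = R w' (\<rho> z x0)"
          unfolding w' R_def using comm[OF z] by (simp add: blinfun.add_right blinfun.scaleR_right)
        then show ?thesis by (simp add: w w' RR mult.commute)
      qed
      then show ?thesis by blast
    qed
    then obtain c where c: "\<And>z y. cmod z = 1 \<Longrightarrow> \<rho> z y = R (c z) y" by metis
    have c_mult: "c (z * w) = c z * c w" if "cmod z = 1" "cmod w = 1" for z w
      using mult[OF that] c[OF that(1)] c[OF that(2)] c[of "z * w"] that x0
      by (intro R_inj[of _ x0]) (simp_all add: norm_mult RR[symmetric] flip: c)
    have c1: "c 1 = 1" using c[of 1 x0] one x0 by (intro R_inj[of _ x0]) (simp_all add: R1)
    have c_pow: "c (z ^ n) = c z ^ n" if "cmod z = 1" for z n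
      by (induction n) (simp_all add: c1 c_mult that norm_power)
    have c_inj: "z = w" if "cmod z = 1" "cmod w = 1" "c z = c w" for z w
      using that by (intro inj) (auto intro!: blinfun_eqI simp: c)
    \<comment> \<open>\<open>c\<close> is multiplicative and injective, so it permutes the finite
      set of roots of unity of order dividing \<open>Suc n\<close>. Each such rotation is therefore
      some \<open>\<rho> z\<close>.\<close>
    have root: "N (R u y) = N y" if "u ^ Suc n = 1" for u y n
    proof -
      let ?U = "{z::complex. z ^ Suc n = 1}"
      have fin: "finite ?U" using finite_roots_unity[of "Suc n"] by simp
      have U1: "cmod z = 1" if "z \<in> ?U" for z
      proof -
        have "z ^ Suc n = 1" using that by blast
        then have "cmod z ^ Suc n = 1 ^ Suc n" unfolding norm_power[symmetric] by simp
        then show ?thesis by (rule power_eq_imp_eq_base) auto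
      qed
      have "inj_on c ?U" by (rule inj_onI) (rule c_inj[OF U1 U1])
      moreover have "c ` ?U \<subseteq> ?U" 
      proof (rule image_subsetI)
        fix z assume z: "z \<in> ?U"
        then have "z ^ Suc n = 1" by blast
        then show "c z \<in> ?U" using c_pow[OF U1[OF z], of "Suc n"] c1 by simp
      qed
      ultimately have "c ` ?U = ?U" using endo_inj_surj[OF fin] by simp
      moreover have "u \<in> ?U" using that by simp
      ultimately obtain z where "z \<in> ?U" "u = c z" by (metis imageE)
      then show ?thesis using U1[of z] c[of z y] N\<rho>[of z y] by simp
    qed
    \<comment> \<open>Roots of unity are dense in the circle and \<open>N\<close> is
      continuous.\<close>
    have rot: "N (R u y) = N y" if u: "cmod u = 1" for u y
    proof -
      obtain v where v: "\<And>n. v n ^ Suc n = 1" "v \<longlonglongrightarrow> u"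
        using unit_circle_root_of_unity_approx[OF u] by blast
      have "(\<lambda>n. R (v n) y) \<longlonglongrightarrow> R u y" unfolding R_def by (intro tendsto_intros v)
      then have "(\<lambda>n. N (R (v n) y)) \<longlonglongrightarrow> N (R u y)" by (rule equivalent_norm_continuous[OF N])
      then have "(\<lambda>n. N y) \<longlonglongrightarrow> N (R u y)" by (simp only: root[OF v(1)])
      then show ?thesis by (simp add: LIMSEQ_const_iff)
    qed
    have NR: "N (R w y) = cmod w * N y" for w y
    proof (cases "w = 0")
      case False
      have "R w y = cmod w *\<^sub>R R (w / cmod w) y" using False by (simp add: R_real[symmetric] RR)
      then show ?thesis using rot[of "w / cmod w" y] False by (simp add: N_scale norm_divide)
    qed (simp add: R1 N0)
    obtain k where k: "\<And>y. y = R (k y) x0" using spanned by metis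
    have k_add: "k (y + z) = k y + k z" for y z
      using k[of y] k[of z] k[of "y + z"] x0 by (intro R_inj[of _ x0]) (simp_all add: R_add)
    have k_scale: "k (r *\<^sub>R y) = of_real r * k y" for r y
      using k[of y] k[of "r *\<^sub>R y"] x0 by (intro R_inj[of _ x0]) (simp_all add: RR[symmetric] R_real)
    \<comment> \<open>Complex conjugation in the coordinate \<open>k\<close>; \<open>N\<close>
      depends only on the modulus of this coordinate.\<close>
    define \<kappa> where "\<kappa> y = R (cnj (k y)) x0" for y
    have \<kappa>N: "N (\<kappa> y) = N y" for y using NR[of "cnj (k y)" x0] NR[of "k y" x0] k[of y] by (simp add: \<kappa>_def)
    have k_R: "k (R w x0) = w" for w using k[of "R w x0"] x0 by (intro R_inj[of _ x0]) simp_all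
    have "bounded_linear \<kappa>"
    proof -
      obtain a b where ab: "0 < a" "\<And>x. a * norm x \<le> N x" "\<And>x. N x \<le> b * norm x"
        using N unfolding equivalent_norm_def by blast
      have "norm (\<kappa> y) \<le> norm y * (b / a)" for y
        using ab(2)[of "\<kappa> y"] ab(3)[of y] \<kappa>N[of y] ab(1) by (simp add: field_simps)
      then show ?thesis
        by (intro bounded_linear_intro[of _ "b / a"])
          (auto simp: \<kappa>_def k_add R_add k_scale RR[symmetric] R_real)
    qed
    then have ap: "blinfun_apply (Blinfun \<kappa>) = \<kappa>" by (rule bounded_linear_Blinfun_apply)
    have "\<kappa> (\<kappa> y) = y" for y using k[of y] by (simp add: \<kappa>_def k_R)
    then have "surj \<kappa>" by (metis surjI)
    then have "Blinfun \<kappa> \<in> Isom N" by (simp add: Isom_def ap \<kappa>N)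
    then obtain z where z: "cmod z = 1" "Blinfun \<kappa> = \<rho> z" using Isom by blast
    \<comment> \<open>As some \<open>\<rho> z\<close> the conjugation commutes with
      \<open>J\<close>, yet it sends \<open>J x0\<close> to \<open>- J x0\<close> and fixes
      \<open>x0\<close>.\<close>
    then have "\<kappa> (J x0) = J (\<kappa> x0)" using comm[of z x0] ap by simp
    moreover have "\<kappa> (J x0) = - J x0" using k_R[of \<i>] by (simp add: \<kappa>_def R1) (simp add: R_def)
    moreover have "\<kappa> x0 = x0" using k_R[of 1] by (simp add: \<kappa>_def R1)
    ultimately have "J x0 + J x0 = 0" by (metis add.left_inverse)
    then have "R (2 * \<i>) x0 = 0" by (simp add: R_def scaleR_2)
    then show False using R_eq_0[of "2 * \<i>" x0] x0 by simp
  qed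
  then show ?thesis using JJ by (auto simp: admits_complex_structure_def)
qed

theorem theorem29:
  shows "displayable circle_group circle_topology TYPE('a::banach) \<longleftrightarrow>
         admits_complex_structure TYPE('a) \<and> space_dim TYPE('a) > 2"
  using displayable_complex_structure complex_structure_displayable
  by (auto simp: admits_complex_structure_def)

end
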